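(* Let $\widetilde\ell>0$, $\widetilde\Omega=(0,\pi)\times(-\widetilde\ell,\widetilde\ell)$, $0<\nu<\frac12$, $E_1>E_2>0$ and $\kappa=\frac{E_1-E_2}{E_2}>0$. Consider the eigenvalue problem $$\begin{cases} \Delta^2 u+\kappa\frac{\partial^4u}{\partial x^4}=\lambda u & \text{in }\widetilde\Omega,\\ u(0,y)=u_{xx}(0,y)=u(\pi,y)=u_{xx}(\pi,y)=0 & \text{for } y\in(-\widetilde\ell,\widetilde\ell),\\ u_{yy}(x,\pm\widetilde\ell)+\nu u_{xx}(x,\pm\widetilde\ell)=0 & \text{for } x\in(0,\pi),\\ u_{yyy}(x,\pm\widetilde\ell)+(2-\nu)u_{xxy}(x,\pm\widetilde\ell)=0 & \text{for } x\in(0,\pi). \end{cases}$$ Then for its eigenvalues (below, $m$ and $j$ denote positive integers) we have: (i) for any $m\ge1$ there exists a sequence of eigenvalues $\widetilde\lambda_{j,m}\uparrow+\infty$ (as $j\to\infty$) such that $\widetilde\lambda_{j,m}>(\kappa+1)m^4$ for all $j\ge1$; the corresponding eigenfunctions are of the kind $$\left[a\cosh(\beta y)+b\sinh(\beta y)+c\cos(\gamma y)+d\sin(\gamma y)\right]\sin(mx)$$ where $\beta=\sqrt{\sqrt{\widetilde\lambda_{j,m}-\kappa m^4}+m^2}$, $\gamma=\sqrt{\sqrt{\widetilde\lambda_{j,m}-\kappa m^4}-m^2}$ and $a,b,c,d$ are suitable constants depending on $m$ and $j$; (ii) denoting by $\overline s$ the unique positive solution of the equation $\tanh(s)=\left(\frac{\nu}{2-\nu}\right)^2s$,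 if $m_*=\overline s/(\sqrt2\,\widetilde\ell)$ is an integer then $\widetilde\lambda=(\kappa+1)m_*^4$ is an eigenvalue with corresponding eigenfunctions generated by $$\left[\nu\widetilde\ell\sinh(\sqrt2\,m_*y)+(2-\nu)\sinh(\sqrt2\,m_*\widetilde\ell)\,y\right]\sin(m_*x);$$ (iii) for any $m\ge1$ there exists an eigenvalue $\widetilde\lambda_m^-\in\left([(1-\nu)^2+\kappa]m^4,(\kappa+1)m^4\right)$ with corresponding eigenfunctions generated by $$\left[\frac{\sqrt{\widetilde\lambda_m^--\kappa m^4}-(1-\nu)m^2}{\cosh(\beta\widetilde\ell)}\cosh(\beta y)+\frac{\sqrt{\widetilde\lambda_m^--\kappa m^4}+(1-\nu)m^2}{\cosh(\gamma\widetilde\ell)}\cosh(\gamma y)\right]\sin(mx),$$ where $\beta=\sqrt{m^2+\sqrt{\widetilde\lambda_m^--\kappa m^4}}$ and $\gamma=\sqrt{m^2-\sqrt{\widetilde\lambda_m^--\kappa m^4}}$; moreover the sequence $m\mapsto\widetilde\lambda_m^-$ is increasing; (iv) for any $m\ge1$ satisfying $$\widetilde\ell m\sqrt2\,\coth(\widetilde\ell m\sqrt2)>\left(\frac{2-\nu}{\nu}\right)^2$$ there exists an eigenvalue $\widetilde\lambda_m^+\in\left(\widetilde\lambda_m^-,(\kappa+1)m^4\right)$ with corresponding eigenfunctions generated by $$\left[\frac{\sqrt{\widetilde\lambda_m^+-\kappa m^4}-(1-\nu)m^2}{\sinh(\beta\widetilde\ell)}\sinh(\beta y)+\frac{\sqrt{\widetilde\lambda_m^+-\kappa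 m^4}+(1-\nu)m^2}{\sinh(\gamma\widetilde\ell)}\sinh(\gamma y)\right]\sin(mx),$$ where $\beta=\sqrt{m^2+\sqrt{\widetilde\lambda_m^+-\kappa m^4}}$ and $\gamma=\sqrt{m^2-\sqrt{\widetilde\lambda_m^+-\kappa m^4}}$; moreover the sequence $m\mapsto\widetilde\lambda_m^+$ is increasing; (v) there are no eigenvalues other than the ones characterized in (i)-(iv).
   Context: The parameters come from an orthotropic plate with Young moduli $E_1>E_2>0$, Poisson ratio $\nu=\nu_{12}\in(0,\frac12)$ and shear modulus assumed to be $\mu_{12}=\frac{\mathcal K(1-\nu)}2$ with $\mathcal K=\frac{E_2}{1-\nu_{12}\nu_{21}}$, $\nu_{21}=\nu_{12}E_2/E_1$; only $\nu$, $\kappa$ and $\widetilde\ell$ enter the eigenvalue problem (here $\widetilde\ell=\frac{\pi}{L}\ell$ for a plate of length $L$ and width $2\ell$). A number $\lambda\in\mathbb R$ is an eigenvalue if the problem has a nontrivial solution $u$ (an eigenfunction), in the weak sense: $u\in H^2_*(\widetilde\Omega)=\{w\in H^2(\widetilde\Omega): w=0\text{ on }\{0,\pi\}\times(-\widetilde\ell,\widetilde\ell)\}$, $u\not\equiv0$, and $$\int_{\widetilde\Omega}\left[\nu\Delta u\Delta v+(1-\nu)D^2u:D^2v+\kappa u_{xx}v_{xx}\right]dx\,dy=\lambda\int_{\widetilde\Omega}uv\,dx\,dy\quad\text{for all }v\in H^2_*(\widetilde\Omega),$$ where $D^2u:D^2v=u_{xx}v_{xx}+2u_{xy}v_{xy}+u_{yy}v_{yy}$.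 *)

theory Defs
  imports "HOL-Analysis.Analysis"
begin

subsection \<open>Test functions and weak derivatives in the plane\<close>

definition partial_x :: "(real \<times> real \<Rightarrow> real) \<Rightarrow> real \<times> real \<Rightarrow> real" where
  "partial_x f = (\<lambda>(x, y). deriv (\<lambda>t. f (t, y)) x)"

definition partial_y :: "(real \<times> real \<Rightarrow> real) \<Rightarrow> real \<times> real \<Rightarrow> real" where
  "partial_y f = (\<lambda>(x, y). deriv (\<lambda>t. f (x, t)) y)"

primrec C_k :: "nat \<Rightarrow> (real \<times> real \<Rightarrow> real) \<Rightarrow> bool" where
  "C_k 0 f \<longleftrightarrow> continuous_on UNIV f"
| "C_k (Suc k) f \<longleftrightarrow>
     continuous_on UNIV f \<and>
     (\<forall>x y. (\<lambda>t. f (t, y)) differentiable (at x) \<and> (\<lambda>t. f (x, t)) differentiable (at y)) \<and>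
     C_k k (partial_x f) \<and> C_k k (partial_y f)"

definition test_function :: "(real \<times> real) set \<Rightarrow> (real \<times> real \<Rightarrow> real) \<Rightarrow> bool" where
  "test_function \<Omega> \<phi> \<longleftrightarrow>
     (\<forall>k. C_k k \<phi>) \<and> (\<exists>K. compact K \<and> K \<subseteq> \<Omega> \<and> (\<forall>p. p \<notin> K \<longrightarrow> \<phi> p = 0))"

definition L2_on :: "(real \<times> real) set \<Rightarrow> (real \<times> real \<Rightarrow> real) \<Rightarrow> bool" where
  "L2_on \<Omega> u \<longleftrightarrow>
     u \<in> borel_measurable (lebesgue_on \<Omega>) \<and> integrable (lebesgue_on \<Omega>) (\<lambda>p. (u p)\<^sup>2)"

text \<open>\<open>g\<close> is the weak derivative of order \<open>i\<close> in \<open>x\<close> and \<open>j\<close> in \<open>y\<close> of \<open>u\<close>;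
  only used for \<open>u\<close> and \<open>g\<close> in \<open>L\<^sup>2\<close>.\<close>

definition has_weak_partial ::
  "(real \<times> real) set \<Rightarrow> nat \<Rightarrow> nat \<Rightarrow> (real \<times> real \<Rightarrow> real) \<Rightarrow> (real \<times> real \<Rightarrow> real) \<Rightarrow> bool" where
  "has_weak_partial \<Omega> i j u g \<longleftrightarrow>
     (\<forall>\<phi>. test_function \<Omega> \<phi> \<longrightarrow>
        integral\<^sup>L (lebesgue_on \<Omega>) (\<lambda>p. u p * (partial_x ^^ i) ((partial_y ^^ j) \<phi>) p) =
        (- 1) ^ (i + j) * integral\<^sup>L (lebesgue_on \<Omega>) (\<lambda>p. g p * \<phi> p))"

text \<open>A square integrable weak derivative is unique up to null sets, so the choice of
  representative below does not affect integrals.\<close>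

definition weak_partial ::
  "(real \<times> real) set \<Rightarrow> nat \<Rightarrow> nat \<Rightarrow> (real \<times> real \<Rightarrow> real) \<Rightarrow> real \<times> real \<Rightarrow> real" where
  "weak_partial \<Omega> i j u = (SOME g. L2_on \<Omega> g \<and> has_weak_partial \<Omega> i j u g)"

definition H2_on :: "(real \<times> real) set \<Rightarrow> (real \<times> real \<Rightarrow> real) \<Rightarrow> bool" where
  "H2_on \<Omega> u \<longleftrightarrow>
     L2_on \<Omega> u \<and> (\<forall>i j. i + j \<le> 2 \<longrightarrow> (\<exists>g. L2_on \<Omega> g \<and> has_weak_partial \<Omega> i j u g))"

subsection \<open>The plate problem\<close>

definition plate :: "real \<Rightarrow> (real \<times> real) set" where
  "plate l = {0<..<pi} \<times> {-l<..<l}"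

text \<open>In the plane \<open>H\<^sup>2\<close> embeds into the continuous functions on the closed rectangle, so the
  condition on the short edges is the pointwise one for the continuous representative.\<close>

definition H2_star :: "real \<Rightarrow> (real \<times> real \<Rightarrow> real) \<Rightarrow> bool" where
  "H2_star l w \<longleftrightarrow>
     H2_on (plate l) w \<and>
     (\<exists>w0. continuous_on (closure (plate l)) w0 \<and>
           (AE p in lebesgue_on (plate l). w p = w0 p) \<and>
           (\<forall>p \<in> {0, pi} \<times> {-l<..<l}. w0 p = 0))"

definition plate_form ::
  "real \<Rightarrow> real \<Rightarrow> real \<Rightarrow> (real \<times> real \<Rightarrow> real) \<Rightarrow> (real \<times> real \<Rightarrow> real) \<Rightarrow> real" where
  "plate_form l \<nu> \<kappa> u v =
     (let D = weak_partial (plate l) in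
      integral\<^sup>L (lebesgue_on (plate l)) (\<lambda>p.
        \<nu> * ((D 2 0 u p + D 0 2 u p) * (D 2 0 v p + D 0 2 v p))
        + (1 - \<nu>) * (D 2 0 u p * D 2 0 v p + 2 * (D 1 1 u p * D 1 1 v p) + D 0 2 u p * D 0 2 v p)
        + \<kappa> * (D 2 0 u p * D 2 0 v p)))"

definition is_eigenfunction ::
  "real \<Rightarrow> real \<Rightarrow> real \<Rightarrow> real \<Rightarrow> (real \<times> real \<Rightarrow> real) \<Rightarrow> bool" where
  "is_eigenfunction l \<nu> \<kappa> \<mu> u \<longleftrightarrow>
     H2_star l u \<and> \<not> (AE p in lebesgue_on (plate l). u p = 0) \<and>
     (\<forall>v. H2_star l v \<longrightarrow>
        plate_form l \<nu> \<kappa> u v = \<mu> * integral\<^sup>L (lebesgue_on (plate l)) (\<lambda>p. u p * v p))"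

definition is_eigenvalue :: "real \<Rightarrow> real \<Rightarrow> real \<Rightarrow> real \<Rightarrow> bool" where
  "is_eigenvalue l \<nu> \<kappa> \<mu> \<longleftrightarrow> (\<exists>u. is_eigenfunction l \<nu> \<kappa> \<mu> u)"

subsection \<open>Eigenfunctions attached to a longitudinal mode\<close>

definition in_mode :: "real \<Rightarrow> nat \<Rightarrow> (real \<times> real \<Rightarrow> real) \<Rightarrow> bool" where
  "in_mode l m u \<longleftrightarrow>
     (\<exists>\<phi>. AE p in lebesgue_on (plate l). u p = \<phi> (snd p) * sin (real m * fst p))"

text \<open>The eigenfunctions corresponding to the eigenvalue \<open>\<mu>\<close> in the mode \<open>m\<close> are generated by
  \<open>w\<close>. The restriction to one mode is needed because eigenvalues listed for different \<open>m\<close> may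
  coincide, in which case the full eigenspace is spanned by the generators of all modes involved.\<close>

definition eigenfunctions_generated_by ::
  "real \<Rightarrow> real \<Rightarrow> real \<Rightarrow> nat \<Rightarrow> real \<Rightarrow> (real \<times> real \<Rightarrow> real) \<Rightarrow> bool" where
  "eigenfunctions_generated_by l \<nu> \<kappa> m \<mu> w \<longleftrightarrow>
     is_eigenfunction l \<nu> \<kappa> \<mu> w \<and> in_mode l m w \<and>
     (\<forall>u. is_eigenfunction l \<nu> \<kappa> \<mu> u \<and> in_mode l m u \<longrightarrow>
        (\<exists>c. AE p in lebesgue_on (plate l). u p = c * w p))"

definition root_part :: "real \<Rightarrow> nat \<Rightarrow> real \<Rightarrow> real" where
  "root_part \<kappa> m \<mu> = sqrt (\<mu> - \<kappa> * real m ^ 4)"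

definition beta :: "real \<Rightarrow> nat \<Rightarrow> real \<Rightarrow> real" where
  "beta \<kappa> m \<mu> = sqrt (root_part \<kappa> m \<mu> + (real m)\<^sup>2)"

text \<open>The two definitions of \<open>\<gamma>\<close>, above and below \<open>(\<kappa> + 1) m\<^sup>4\<close> respectively.\<close>

definition gamma_above :: "real \<Rightarrow> nat \<Rightarrow> real \<Rightarrow> real" where
  "gamma_above \<kappa> m \<mu> = sqrt (root_part \<kappa> m \<mu> - (real m)\<^sup>2)"

definition gamma_below :: "real \<Rightarrow> nat \<Rightarrow> real \<Rightarrow> real" where
  "gamma_below \<kappa> m \<mu> = sqrt ((real m)\<^sup>2 - root_part \<kappa> m \<mu>)"

definition eigfun_above ::
  "real \<Rightarrow> nat \<Rightarrow> real \<Rightarrow> real \<Rightarrow> real \<Rightarrow> real \<Rightarrow> real \<Rightarrow> real \<times> real \<Rightarrow> real" where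
  "eigfun_above \<kappa> m \<mu> a b c d = (\<lambda>(x, y).
     (a * cosh (beta \<kappa> m \<mu> * y) + b * sinh (beta \<kappa> m \<mu> * y)
      + c * cos (gamma_above \<kappa> m \<mu> * y) + d * sin (gamma_above \<kappa> m \<mu> * y)) * sin (real m * x))"

definition eigfun_critical :: "real \<Rightarrow> real \<Rightarrow> nat \<Rightarrow> real \<times> real \<Rightarrow> real" where
  "eigfun_critical l \<nu> m = (\<lambda>(x, y).
     (\<nu> * l * sinh (sqrt 2 * real m * y) + (2 - \<nu>) * sinh (sqrt 2 * real m * l) * y)
     * sin (real m * x))"

definition eigfun_minus :: "real \<Rightarrow> real \<Rightarrow> real \<Rightarrow> nat \<Rightarrow> real \<Rightarrow> real \<times> real \<Rightarrow> real" where
  "eigfun_minus l \<nu> \<kappa> m \<mu> = (\<lambda>(x, y).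
     ((root_part \<kappa> m \<mu> - (1 - \<nu>) * (real m)\<^sup>2) / cosh (beta \<kappa> m \<mu> * l) * cosh (beta \<kappa> m \<mu> * y)
      + (root_part \<kappa> m \<mu> + (1 - \<nu>) * (real m)\<^sup>2) / cosh (gamma_below \<kappa> m \<mu> * l)
        * cosh (gamma_below \<kappa> m \<mu> * y)) * sin (real m * x))"

definition eigfun_plus :: "real \<Rightarrow> real \<Rightarrow> real \<Rightarrow> nat \<Rightarrow> real \<Rightarrow> real \<times> real \<Rightarrow> real" where
  "eigfun_plus l \<nu> \<kappa> m \<mu> = (\<lambda>(x, y).
     ((root_part \<kappa> m \<mu> - (1 - \<nu>) * (real m)\<^sup>2) / sinh (beta \<kappa> m \<mu> * l) * sinh (beta \<kappa> m \<mu> * y)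
      + (root_part \<kappa> m \<mu> + (1 - \<nu>) * (real m)\<^sup>2) / sinh (gamma_below \<kappa> m \<mu> * l)
        * sinh (gamma_below \<kappa> m \<mu> * y)) * sin (real m * x))"

definition s_bar :: "real \<Rightarrow> real" where
  "s_bar \<nu> = (THE s. s > 0 \<and> tanh s = (\<nu> / (2 - \<nu>))\<^sup>2 * s)"

definition m_star :: "real \<Rightarrow> real \<Rightarrow> real" where
  "m_star l \<nu> = s_bar \<nu> / (sqrt 2 * l)"

definition coth :: "real \<Rightarrow> real" where
  "coth s = cosh s / sinh s"

definition plus_condition :: "real \<Rightarrow> real \<Rightarrow> nat \<Rightarrow> bool" where
  "plus_condition l \<nu> m \<longleftrightarrow> l * real m * sqrt 2 * coth (l * real m * sqrt 2) > ((2 - \<nu>) / \<nu>)\<^sup>2"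

text \<open>\<open>\<mu>\<close> is one of the eigenvalues listed for the mode \<open>m\<close>, given the families of eigenvalues
  above \<open>(\<kappa> + 1) m\<^sup>4\<close> and the two families below it.\<close>

definition listed_eigenvalue ::
  "real \<Rightarrow> real \<Rightarrow> real \<Rightarrow> (nat \<Rightarrow> nat \<Rightarrow> real) \<Rightarrow> (nat \<Rightarrow> real) \<Rightarrow> (nat \<Rightarrow> real) \<Rightarrow> nat \<Rightarrow> real \<Rightarrow> bool" where
  "listed_eigenvalue l \<nu> \<kappa> lam lam_minus lam_plus m \<mu> \<longleftrightarrow>
     m \<ge> 1 \<and>
     ((\<exists>j\<ge>1. \<mu> = lam j m)
      \<or> (real m = m_star l \<nu> \<and> \<mu> = (\<kappa> + 1) * real m ^ 4)
      \<or> \<mu> = lam_minus m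
      \<or> (plus_condition l \<nu> m \<and> \<mu> = lam_plus m))"

end

theory Submission
  imports Defs "HOL-Complex_Analysis.Complex_Analysis"
begin

text \<open>
  The problem separates: a product \<open>F(y) sin(m x)\<close> solves the plate problem with eigenvalue
  \<open>\<kappa> m\<^sup>4 + \<rho>\<close> exactly when \<open>(d\<^sup>2/dy\<^sup>2 - M)\<^sup>2 F = \<rho> F\<close> with \<open>M = m\<^sup>2\<close> and \<open>F\<close> satisfies the
  conditions of a free edge at \<open>\<plusminus>l\<close> (\<open>mode_eigen\<close>). The proof has to show that these transverse
  problems give everything, although an eigenfunction is only known to be an \<open>H\<^sup>2\<close> function, and
  then to solve them.

  Separation. For a smooth \<open>F\<close> with free edges and an arbitrary \<open>w\<close> in the energy space, all
  derivatives in the bilinear form can be moved from \<open>w\<close> to \<open>F(y) sin(m x)\<close> (\<open>plate_form_mode\<close>).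
  So products are eigenfunctions, and an eigenfunction \<open>u\<close> is orthogonal to \<open>f(y) sin(m x)\<close> for
  each right-hand side \<open>f\<close> for which the inhomogeneous transverse problem is solvable
  (\<open>eigenfunction_orthogonal_range\<close>). By the Fredholm alternative, obtained here by shooting from
  one edge, these are all polynomials \<open>f\<close> if the mode has no eigenfunction, and the polynomials
  orthogonal to it otherwise. Hence the \<open>m\<close>-th sine coefficient of \<open>u\<close> vanishes or is a multiple
  of the transverse eigenfunction, which is unique up to a factor. The products of sines and
  powers of \<open>y\<close> are complete (\<open>annihilates_modes_imp_AE_zero\<close>), and since eigenfunctions of a
  mode have \<open>\<rho> > (1 - \<nu>\<^sup>2) M\<^sup>2 > 0\<close> (\<open>mode_eigen_lower_bound\<close>), only finitely many modes
  contribute to one eigenvalue. This yields \<open>mode_eigenfunctions_generated\<close> and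
  \<open>eigenfunction_mode_decomposition\<close>.

  Solution of the modes. With \<open>\<rho> = r\<^sup>2\<close> the solutions are combinations of \<open>cosh\<close> and \<open>sinh\<close> with
  squared rates \<open>M + r\<close> and \<open>M - r\<close> (the latter trigonometric if \<open>r > M\<close>). The edge conditions
  decouple into an even and an odd part, each with a two by two determinant. For \<open>r \<le> M\<close> both
  determinants have the form \<open>(r + a M)\<^sup>2 g(M - r) - (r - a M)\<^sup>2 g(M + r)\<close>, where \<open>a = 1 - \<nu>\<close> and
  \<open>g(\<theta>)\<close> is \<open>\<surd>\<theta> tanh(\<surd>\<theta> l)\<close> or \<open>\<surd>\<theta> coth(\<surd>\<theta> l)\<close>. Both functions \<open>g\<close> are positive on the open
  half-line, increasing and concave; this implies that there is at most one root in \<open>(a M, M)\<close>,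
  that it exists iff the expression is negative at \<open>r = M\<close>, and that it increases with \<open>M\<close>
  (\<open>gap_root\<close>, \<open>gap_no_root\<close>, \<open>gap_root_increasing\<close>). At \<open>r = M\<close> the even expression is negative,
  and the sign of the odd one decides between (ii), (iv) and neither. The lower bound for \<open>\<rho>\<close>
  excludes \<open>r \<le> a M\<close>. Above the threshold \<open>r = M\<close> the even determinant changes sign infinitely
  often, while analyticity makes the zeros of both discrete, so that the eigenvalues of a mode
  form a sequence tending to infinity.
\<close>

section \<open>Smooth functions and cutoffs on the line\<close>

text \<open>A greatest fixed point: any class of differentiable functions that contains a derivative of
  each of its members consists of smooth functions.\<close>

coinductive smooth :: "(real \<Rightarrow> real) \<Rightarrow> bool" where
  "(\<forall>t. (f has_real_derivative g t) (at t)) \<Longrightarrow> smooth g \<Longrightarrow> smooth f"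

lemma smooth_coinduct:
  assumes "X f"
    and "\<And>f. X f \<Longrightarrow> \<exists>g. (\<forall>t. (f has_real_derivative g t) (at t)) \<and> X g"
  shows "smooth f"
  using assms(1) by (coinduction arbitrary: f) (use assms(2) in blast)

lemma smooth_derivE:
  assumes "smooth f"
  obtains "\<And>t. (f has_real_derivative deriv f t) (at t)" "smooth (deriv f)"
proof -
  obtain g where g: "\<forall>t. (f has_real_derivative g t) (at t)" "smooth g"
    using assms by (cases rule: smooth.cases) auto
  moreover from g(1) have "deriv f = g"
    using DERIV_imp_deriv by blast
  ultimately show ?thesis using that by auto
qed

lemma smooth_has_deriv: "smooth f \<Longrightarrow> (f has_real_derivative deriv f t) (at t)"
  and smooth_deriv: "smooth f \<Longrightarrow> smooth (deriv f)"
  by (auto elim: smooth_derivE)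

lemma smooth_continuous_on: "smooth f \<Longrightarrow> continuous_on A f"
  by (meson DERIV_isCont continuous_at_imp_continuous_on smooth_has_deriv)

lemma smooth_borel: "smooth f \<Longrightarrow> f \<in> borel_measurable borel"
  by (intro borel_measurable_continuous_onI smooth_continuous_on)

lemma smooth_affine_arg:
  assumes "smooth f"
  shows "smooth (\<lambda>t. f (a * t + b))"
proof -
  define X where "X h \<longleftrightarrow> (\<exists>f c. smooth f \<and> h = (\<lambda>t. c * f (a * t + b)))" for h
  have "(\<lambda>t. f (a * t + b)) = (\<lambda>t. 1 * f (a * t + b))" by simp
  with assms have "X (\<lambda>t. f (a * t + b))"
    unfolding X_def by blast
  then show ?thesis
  proof (rule smooth_coinduct[where X = X])
    fix h assume "X h"
    then obtain f c where f: "smooth f" and h: "h = (\<lambda>t. c * f (a * t + b))"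
      unfolding X_def by blast
    have "((\<lambda>t. a * t + b) has_real_derivative a) (at t)" for t
      by (auto intro!: derivative_eq_intros)
    then have "(h has_real_derivative (c * a) * deriv f (a * t + b)) (at t)" for t
      unfolding h using DERIV_cmult[OF DERIV_chain2[OF smooth_has_deriv[OF f]], of "\<lambda>t. a * t + b" a t UNIV c]
      by (simp add: mult_ac)
    moreover have "X (\<lambda>t. (c * a) * deriv f (a * t + b))"
      unfolding X_def using smooth_deriv[OF f] by blast
    ultimately show "\<exists>g. (\<forall>t. (h has_real_derivative g t) (at t)) \<and> X g"
      by (intro exI[of _ "\<lambda>t. (c * a) * deriv f (a * t + b)"]) auto
  qed
qed

text \<open>The derivative of a product or of a reciprocal is built from the same functions and their
  derivatives by sums, products and reciprocals; this closure is therefore stable under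
  differentiation, which is what coinduction asks for.\<close>

inductive smooth_closure :: "(real \<Rightarrow> real) \<Rightarrow> bool" where
  base: "smooth f \<Longrightarrow> smooth_closure f"
| add: "smooth_closure f \<Longrightarrow> smooth_closure g \<Longrightarrow> smooth_closure (\<lambda>t. f t + g t)"
| mult: "smooth_closure f \<Longrightarrow> smooth_closure g \<Longrightarrow> smooth_closure (\<lambda>t. f t * g t)"
| inverse: "smooth_closure f \<Longrightarrow> (\<forall>t. f t \<noteq> 0) \<Longrightarrow> smooth_closure (\<lambda>t. inverse (f t))"

lemma smooth_const: "smooth (\<lambda>t. c)"
proof -
  have "\<exists>d. (\<lambda>t. c) = (\<lambda>t::real. d::real)" by blast
  then show ?thesis
    by (rule smooth_coinduct[where X = "\<lambda>f. \<exists>d. f = (\<lambda>t. d)"]) (auto intro!: derivative_eq_intros exI[of _ "\<lambda>t. 0"])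
qed

lemma smooth_closure_imp_smooth:
  assumes "smooth_closure f"
  shows "smooth f"
  using assms
proof (rule smooth_coinduct[where X = smooth_closure])
  fix f assume "smooth_closure f"
  then show "\<exists>g. (\<forall>t. (f has_real_derivative g t) (at t)) \<and> smooth_closure g"
  proof induction
    case (base f)
    then show ?case
      using smooth_has_deriv smooth_deriv smooth_closure.base by blast
  next
    case (add f g)
    then obtain f' g' where "\<forall>t. (f has_real_derivative f' t) (at t)" "smooth_closure f'"
      "\<forall>t. (g has_real_derivative g' t) (at t)" "smooth_closure g'" by blast
    then show ?case
      by (intro exI[of _ "\<lambda>t. f' t + g' t"]) (auto intro!: derivative_eq_intros smooth_closure.add)
  next
    case (mult f g)
    then obtain f' g' where "\<forall>t. (f has_real_derivative f' t) (at t)" "smooth_closure f'"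
      "\<forall>t. (g has_real_derivative g' t) (at t)" "smooth_closure g'" by blast
    then show ?case using mult
      by (intro exI[of _ "\<lambda>t. f' t * g t + f t * g' t"])
        (auto intro!: derivative_eq_intros smooth_closure.add smooth_closure.mult)
  next
    case (inverse f)
    then obtain f' where f': "\<forall>t. (f has_real_derivative f' t) (at t)" "smooth_closure f'" by blast
    have "((\<lambda>t. inverse (f t)) has_real_derivative (-1) * (f' t * (inverse (f t) * inverse (f t)))) (at t)" for t
      using f' inverse.hyps(2) by (auto intro!: derivative_eq_intros)
    moreover have "smooth_closure (\<lambda>t. (-1) * (f' t * (inverse (f t) * inverse (f t))))"
      using f' inverse.hyps
      by (intro smooth_closure.mult smooth_closure.inverse) (auto intro: smooth_closure.base smooth_const)
    ultimately show ?case by (intro exI[of _ "\<lambda>t. (-1) * (f' t * (inverse (f t) * inverse (f t)))"]) auto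
  qed
qed

lemma smooth_add: "smooth f \<Longrightarrow> smooth g \<Longrightarrow> smooth (\<lambda>t. f t + g t)"
  and smooth_mult: "smooth f \<Longrightarrow> smooth g \<Longrightarrow> smooth (\<lambda>t. f t * g t)"
  and smooth_inverse: "smooth f \<Longrightarrow> (\<And>t. f t \<noteq> 0) \<Longrightarrow> smooth (\<lambda>t. inverse (f t))"
  by (simp_all add: smooth_closure_imp_smooth smooth_closure.intros)

text \<open>A function together with all its derivatives. Differential equations and boundary conditions
  then become pointwise identities between its members.\<close>

definition tower :: "(nat \<Rightarrow> real \<Rightarrow> real) \<Rightarrow> bool" where
  "tower F \<longleftrightarrow> (\<forall>k t. (F k has_real_derivative F (Suc k) t) (at t))"

lemma tower_smooth:
  assumes "tower F" shows "smooth (F k)"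
proof -
  have "\<exists>k'. F k = F k'" by blast
  then show ?thesis
    by (rule smooth_coinduct[where X = "\<lambda>f. \<exists>k. f = F k"]) (use assms in \<open>auto simp: tower_def\<close>)
qed

lemma tower_deriv: "tower F \<Longrightarrow> deriv (F k) = F (Suc k)"
  unfolding tower_def using DERIV_imp_deriv by blast

lemma tower_has_deriv: "tower F \<Longrightarrow> (F k has_real_derivative F (Suc k) t) (at t)"
  by (simp add: tower_def)

subsection \<open>A smooth step\<close>

definition flat_exp :: "real \<Rightarrow> real" where
  "flat_exp t = (if t > 0 then exp (- 1 / t) else 0)"

lemma poly_inverse_exp_tendsto_0:
  fixes p :: "real poly"
  shows "((\<lambda>t. poly p (1 / t) * exp (- 1 / t)) \<longlongrightarrow> 0) (at_right 0)"
proof -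
  have "((\<lambda>s. poly p s * exp (- s)) \<longlongrightarrow> 0) at_top"
  proof (induction p)
    case (pCons a p)
    have *: "((\<lambda>s::real. s ^ k * exp (- s)) \<longlongrightarrow> 0) at_top" for k :: nat
      using tendsto_power_div_exp_0[of k] unfolding divide_inverse exp_minus[symmetric] .
    have "((\<lambda>s. (\<Sum>i\<le>degree (pCons a p). coeff (pCons a p) i * (s ^ i * exp (- s)))) \<longlongrightarrow> (\<Sum>i\<le>degree (pCons a p). coeff (pCons a p) i * 0)) at_top"
      by (intro tendsto_intros *)
    then show ?case
      by (simp only: poly_altdef sum_distrib_right mult.assoc mult_zero_right sum.neutral_const)
  qed simp
  then have "((\<lambda>t. poly p (inverse t) * exp (- inverse t)) \<longlongrightarrow> 0) (at_right 0)"
    by (rule filterlim_compose[OF _ filterlim_inverse_at_top_right])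
  then show ?thesis by (simp add: inverse_eq_divide)
qed

text \<open>The functions \<open>p (1 / t) exp (- 1 / t)\<close> on the positive half-line, extended by zero, with \<open>p\<close> a
  polynomial, are closed under differentiation.\<close>

lemma smooth_flat_exp: "smooth flat_exp"
proof -
  define G where "G p = (\<lambda>t. if t > 0 then poly p (1 / t) * exp (- 1 / t) else 0)" for p :: "real poly"
  have "flat_exp = G 1" by (auto simp: flat_exp_def G_def)
  then have "\<exists>p. flat_exp = G p" by blast
  then show ?thesis
  proof (rule smooth_coinduct[where X = "\<lambda>f. \<exists>p. f = G p"])
    fix f assume "\<exists>p. f = G p"
    then obtain p where f: "f = G p" by blast
    define q where "q = monom 1 2 * (p - pderiv p)"
    have "(G p has_real_derivative G q t) (at t)" for t
    proof (cases t "0::real" rule: linorder_cases)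
      case less
      have "((\<lambda>t. 0) has_real_derivative G q t) (at t)" using less by (auto simp: G_def)
      then show ?thesis
        by (rule DERIV_cong_ev[THEN iffD1, rotated 3, OF _ refl _ refl])
          (use less eventually_nhds_in_open[of "{..<0}" t] in \<open>auto simp: G_def elim!: eventually_mono\<close>)
    next
      case greater
      have "((\<lambda>t. poly p (1 / t) * exp (- 1 / t)) has_real_derivative
          (- 1 / t\<^sup>2) * poly (pderiv p) (1 / t) * exp (- 1 / t) + poly p (1 / t) * (exp (- 1 / t) * (1 / t\<^sup>2))) (at t)"
        using greater by (auto intro!: derivative_eq_intros DERIV_chain2[OF poly_DERIV] simp: power2_eq_square field_simps)
      also have "(- 1 / t\<^sup>2) * poly (pderiv p) (1 / t) * exp (- 1 / t) + poly p (1 / t) * (exp (- 1 / t) * (1 / t\<^sup>2)) = G q t"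
        using greater by (simp add: G_def q_def poly_monom field_simps)
      finally show ?thesis
        by (rule DERIV_cong_ev[THEN iffD1, rotated 3, OF _ refl _ refl])
          (use greater eventually_nhds_in_open[of "{0<..}" t] in \<open>auto simp: G_def elim!: eventually_mono\<close>)
    next
      case equal
      have "((\<lambda>h. G p h / h) \<longlongrightarrow> 0) (at 0)"
      proof (rule filterlim_split_at_real)
        show "((\<lambda>h. G p h / h) \<longlongrightarrow> 0) (at_left 0)"
          by (rule tendsto_eventually) (auto simp: eventually_at_filter G_def)
        have "((\<lambda>t. poly (monom 1 1 * p) (1 / t) * exp (- 1 / t)) \<longlongrightarrow> 0) (at_right 0)"
          by (rule poly_inverse_exp_tendsto_0)
        then show "((\<lambda>h. G p h / h) \<longlongrightarrow> 0) (at_right 0)"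
          by (rule Lim_transform_eventually) (auto simp: eventually_at_filter G_def poly_monom)
      qed
      then have "(G p has_real_derivative 0) (at 0)" by (simp add: DERIV_def) (simp add: G_def)
      then show ?thesis using equal by (simp add: G_def)
    qed
    then show "\<exists>g. (\<forall>t. (f has_real_derivative g t) (at t)) \<and> (\<exists>p. g = G p)"
      using f by blast
  qed
qed

definition smooth_step :: "real \<Rightarrow> real" where
  "smooth_step t = flat_exp t * inverse (flat_exp t + flat_exp (1 - t))"

lemma flat_exp_sum_pos: "flat_exp t + flat_exp (1 - t) > 0"
  by (simp add: flat_exp_def add_pos_pos)

lemma smooth_smooth_step: "smooth smooth_step"
proof -
  have "smooth (\<lambda>t. flat_exp ((- 1) * t + 1))" by (rule smooth_affine_arg[OF smooth_flat_exp])
  then have "smooth (\<lambda>t. flat_exp t * inverse (flat_exp t + flat_exp ((- 1) * t + 1)))"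
    using flat_exp_sum_pos
    by (intro smooth_mult smooth_inverse smooth_add smooth_flat_exp) (auto simp: less_le)
  then show ?thesis unfolding smooth_step_def[abs_def] by simp
qed

lemma smooth_step_bounds: "0 \<le> smooth_step t" "smooth_step t \<le> 1"
proof -
  have "flat_exp t \<ge> 0" "flat_exp (1 - t) \<ge> 0" by (auto simp: flat_exp_def)
  then show "0 \<le> smooth_step t" "smooth_step t \<le> 1"
    using flat_exp_sum_pos[of t] by (simp_all add: smooth_step_def divide_inverse[symmetric])
qed

lemma smooth_step_0: "t \<le> 0 \<Longrightarrow> smooth_step t = 0"
  by (simp add: smooth_step_def flat_exp_def)

lemma smooth_step_1: "t \<ge> 1 \<Longrightarrow> smooth_step t = 1"
  by (simp add: smooth_step_def flat_exp_def)

lemma deriv_smooth_step_0: "t < 0 \<or> t > 1 \<Longrightarrow> deriv smooth_step t = 0"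
proof (erule disjE)
  assume "t < 0"
  then have "eventually (\<lambda>s. smooth_step s = 0) (nhds t)"
    using eventually_nhds_in_open[of "{..<0}" t] by (auto elim!: eventually_mono simp: smooth_step_0)
  then show ?thesis
    by (subst deriv_cong_ev[where g = "\<lambda>_. 0"]) auto
next
  assume "t > 1"
  then have "eventually (\<lambda>s. smooth_step s = 1) (nhds t)"
    using eventually_nhds_in_open[of "{1<..}" t] by (auto elim!: eventually_mono simp: smooth_step_1)
  then show ?thesis
    by (subst deriv_cong_ev[where g = "\<lambda>_. 1"]) auto
qed

lemma deriv_smooth_step_bounded: "\<exists>C\<ge>0. \<forall>t. \<bar>deriv smooth_step t\<bar> \<le> C"
proof -
  have "compact (deriv smooth_step ` {0..1})"
    by (intro compact_continuous_image smooth_continuous_on smooth_deriv smooth_smooth_step) auto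
  then obtain C where C: "\<forall>t\<in>{0..1}. \<bar>deriv smooth_step t\<bar> \<le> C"
    by (auto dest!: compact_imp_bounded simp: bounded_iff)
  have "\<bar>deriv smooth_step t\<bar> \<le> \<bar>C\<bar>" for t
    using bspec[OF C, of t] deriv_smooth_step_0[of t] by (cases "t < 0 \<or> t > 1") auto
  then show ?thesis by (intro exI[of _ "\<bar>C\<bar>"]) auto
qed

subsection \<open>Cutoffs on an interval\<close>

definition test_fun :: "real \<Rightarrow> real \<Rightarrow> (real \<Rightarrow> real) \<Rightarrow> bool" where
  "test_fun c d p \<longleftrightarrow>
     smooth p \<and> (\<exists>c1 d1. c < c1 \<and> d1 < d \<and> (\<forall>t. p t \<noteq> 0 \<longrightarrow> c1 \<le> t \<and> t \<le> d1))"

text \<open>Zero within \<open>1 / n\<close> of the end points, one beyond distance \<open>2 / n\<close> from them.\<close>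

definition cutoff :: "real \<Rightarrow> real \<Rightarrow> nat \<Rightarrow> real \<Rightarrow> real" where
  "cutoff c d n t = smooth_step (real n * (t - c) - 1) * smooth_step (real n * (d - t) - 1)"

lemma smooth_cutoff: "smooth (cutoff c d n)"
proof -
  have "smooth (\<lambda>t. smooth_step (real n * t + (- real n * c - 1)) * smooth_step ((- real n) * t + (real n * d - 1)))"
    by (intro smooth_mult smooth_affine_arg smooth_smooth_step)
  then show ?thesis by (simp add: cutoff_def[abs_def] algebra_simps)
qed

lemma test_fun_cutoff_mult:
  assumes "smooth f" shows "test_fun c d (\<lambda>t. cutoff c d n t * f t)"
proof (cases "n = 0")
  case True
  then have "(\<lambda>t. cutoff c d n t * f t) = (\<lambda>t. 0)" by (simp add: cutoff_def smooth_step_0)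
  then show ?thesis
    by (simp add: test_fun_def smooth_const) (meson gt_ex lt_ex)
next
  case False
  have "c + 1 / real n \<le> t \<and> t \<le> d - 1 / real n" if "cutoff c d n t * f t \<noteq> 0" for t
  proof -
    have "\<not> real n * (t - c) - 1 \<le> 0" "\<not> real n * (d - t) - 1 \<le> 0"
      using that smooth_step_0 by (auto simp: cutoff_def)
    then show ?thesis using False by (simp add: field_simps)
  qed
  then show ?thesis unfolding test_fun_def using assms False
    by (intro conjI smooth_mult smooth_cutoff exI[of _ "c + 1 / real n"] exI[of _ "d - 1 / real n"]) auto
qed

lemma cutoff_bounds: "0 \<le> cutoff c d n t" "cutoff c d n t \<le> 1"
  using smooth_step_bounds by (auto simp: cutoff_def intro: mult_le_one)

lemma cutoff_test_fun: "test_fun c d (cutoff c d n)"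
  using test_fun_cutoff_mult[OF smooth_const[of 1]] by simp

lemma cutoff_outside: "t \<notin> {c<..<d} \<Longrightarrow> cutoff c d n t = 0"
proof -
  assume "t \<notin> {c<..<d}"
  then have "real n * (t - c) \<le> 0 \<or> real n * (d - t) \<le> 0"
    by (auto simp: mult_le_0_iff)
  then show ?thesis by (auto simp: cutoff_def smooth_step_0)
qed

lemma deriv_cutoff:
  "deriv (cutoff c d n) t =
    real n * deriv smooth_step (real n * (t - c) - 1) * smooth_step (real n * (d - t) - 1)
    - real n * smooth_step (real n * (t - c) - 1) * deriv smooth_step (real n * (d - t) - 1)"
proof -
  have *: "((\<lambda>t. real n * (t - c) - 1) has_real_derivative real n) (at t)"
    "((\<lambda>t. real n * (d - t) - 1) has_real_derivative (- real n)) (at t)"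
    by (auto intro!: derivative_eq_intros)
  from DERIV_mult[OF *[THEN DERIV_chain2[OF smooth_has_deriv[OF smooth_smooth_step]]]] show ?thesis
    unfolding cutoff_def[abs_def] by (intro DERIV_imp_deriv) (simp add: algebra_simps)
qed

lemma deriv_cutoff_bounded: "\<exists>C\<ge>0. \<forall>c d n t. \<bar>deriv (cutoff c d n) t\<bar> \<le> C * real n"
proof -
  obtain C where C: "C \<ge> 0" "\<And>t. \<bar>deriv smooth_step t\<bar> \<le> C"
    using deriv_smooth_step_bounded by blast
  have "\<bar>deriv (cutoff c d n) t\<bar> \<le> 2 * C * real n" for c d n t
  proof -
    have *: "\<bar>deriv smooth_step x * smooth_step y\<bar> \<le> C * 1" for x y
      unfolding abs_mult using C smooth_step_bounds[of y] by (intro mult_mono) auto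
    define A where "A = deriv smooth_step (real n * (t - c) - 1) * smooth_step (real n * (d - t) - 1)"
    define B where "B = deriv smooth_step (real n * (d - t) - 1) * smooth_step (real n * (t - c) - 1)"
    have "deriv (cutoff c d n) t = real n * (A - B)"
      by (simp add: deriv_cutoff A_def B_def right_diff_distrib)
    then have "\<bar>deriv (cutoff c d n) t\<bar> = real n * \<bar>A - B\<bar>"
      by (simp only: abs_mult abs_of_nat)
    also have "\<dots> \<le> real n * (C + C)"
      using *[of "real n * (t - c) - 1" "real n * (d - t) - 1"] *[of "real n * (d - t) - 1" "real n * (t - c) - 1"]
      unfolding A_def[symmetric] B_def[symmetric] by (intro mult_left_mono) linarith+
    finally show ?thesis by (simp add: algebra_simps)
  qed
  then show ?thesis using C(1) by (intro exI[of _ "2 * C"]) auto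
qed

lemma deriv_cutoff_nonzero:
  assumes "deriv (cutoff c d n) t \<noteq> 0"
  shows "real n * (t - c) \<le> 2 \<or> real n * (d - t) \<le> 2"
proof (rule ccontr)
  assume "\<not> ?thesis"
  then have "real n * (t - c) - 1 > 1" "real n * (d - t) - 1 > 1" by auto
  then show False using assms deriv_smooth_step_0 by (simp add: deriv_cutoff)
qed

lemma cutoff_eventually:
  assumes "t \<in> {c<..<d}"
  shows "eventually (\<lambda>n. cutoff c d n t = 1 \<and> deriv (cutoff c d n) t = 0) sequentially"
proof -
  obtain N :: nat where N: "real N > 2 / (t - c)" using reals_Archimedean2 by blast
  obtain N' :: nat where N': "real N' > 2 / (d - t)" using reals_Archimedean2 by blast
  have *: "cutoff c d n t = 1 \<and> deriv (cutoff c d n) t = 0" if "n \<ge> max N N'" for n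
  proof -
    have "real n > 2 / (t - c)" "real n > 2 / (d - t)" using N N' that by auto
    then have "real n * (t - c) - 1 > 1" "real n * (d - t) - 1 > 1"
      using assms by (auto simp: field_simps)
    then show ?thesis by (simp add: cutoff_def deriv_cutoff smooth_step_1 deriv_smooth_step_0)
  qed
  then show ?thesis unfolding eventually_sequentially by blast
qed

section \<open>Integration over the plate\<close>

abbreviation plate_measure :: "real \<Rightarrow> (real \<times> real) measure" where
  "plate_measure l \<equiv> lebesgue_on (plate l)"

text \<open>Weak identities are tested with products only. This suffices because products of cutoffs
  determine a function almost everywhere, and it reduces calculus in the plane to the line.\<close>

definition plate_int :: "real \<Rightarrow> (real \<times> real \<Rightarrow> real) \<Rightarrow> (real \<Rightarrow> real) \<Rightarrow> (real \<Rightarrow> real) \<Rightarrow> real" where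
  "plate_int l W p q = (LINT z|plate_measure l. W z * (p (fst z) * q (snd z)))"

lemma plate_iff: "z \<in> plate l \<longleftrightarrow> fst z \<in> {0<..<pi} \<and> snd z \<in> {-l<..<l}"
  by (cases z) (auto simp: plate_def)

lemma plate_open: "open (plate l)"
  by (simp add: plate_def open_Times)

lemma plate_borel [measurable]: "plate l \<in> sets borel"
  using plate_open by simp

lemma plate_lebesgue [simp, measurable]: "plate l \<in> sets lebesgue"
  using plate_borel by (simp add: sets_completionI_sets)

lemma space_plate_measure [simp]: "space (plate_measure l) = plate l"
  by (simp add: space_restrict_space)

lemma plate_bounded: "bounded (plate l)"
  unfolding plate_def by (intro bounded_Times) auto

lemma plate_lmeasurable: "plate l \<in> lmeasurable"
  by (intro lmeasurable_open plate_open plate_bounded)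

lemma finite_measure_plate: "finite_measure (plate_measure l)"
  using plate_lmeasurable by (rule finite_measure_lebesgue_on)

lemma borel_measurable_plate [measurable (raw)]:
  "h \<in> borel_measurable borel \<Longrightarrow> h \<in> borel_measurable (plate_measure l)"
  by (intro measurable_restrict_space1 measurable_completion) (simp add: measurable_lborel2)

lemma AE_plate_iff: "(AE z in plate_measure l. P z) \<longleftrightarrow> (AE z in lborel. z \<in> plate l \<longrightarrow> P z)"
  by (subst AE_restrict_space_iff) (auto simp: AE_completion_iff)

lemma AE_plateI: "(\<And>z. z \<in> plate l \<Longrightarrow> P z) \<Longrightarrow> AE z in plate_measure l. P z"
  by (rule AE_I2) simp

lemma smooth_fst_borel: "smooth p \<Longrightarrow> (\<lambda>z. p (fst z :: real)) \<in> borel_measurable borel"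
  and smooth_snd_borel: "smooth p \<Longrightarrow> (\<lambda>z. p (snd z :: real)) \<in> borel_measurable borel"
  by (rule measurable_compose[OF _ smooth_borel], simp add: borel_measurable_continuous_onI continuous_on_fst continuous_on_snd, assumption)+

lemma smooth_prod_borel:
  "smooth p \<Longrightarrow> smooth q \<Longrightarrow> (\<lambda>z. p (fst z) * q (snd z)) \<in> borel_measurable borel"
  by (intro borel_measurable_times smooth_fst_borel smooth_snd_borel)

lemmas smooth_prod_measurable = borel_measurable_plate[OF smooth_prod_borel]

lemma bounded_mult_integrable:
  assumes W: "integrable (plate_measure l) W"
    and h: "h \<in> borel_measurable (plate_measure l)"
    and b: "\<And>z. z \<in> plate l \<Longrightarrow> \<bar>h z\<bar> \<le> C"
  shows "integrable (plate_measure l) (\<lambda>z. W z * h z :: real)"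
proof (rule Bochner_Integration.integrable_bound[of _ "\<lambda>z. C * W z"])
  show "integrable (plate_measure l) (\<lambda>z. C * W z)" using W by simp
  show "(\<lambda>z. W z * h z) \<in> borel_measurable (plate_measure l)"
    by (intro borel_measurable_times borel_measurable_integrable[OF W] h)
  have "norm (W z * h z) \<le> norm (C * W z)" if "z \<in> plate l" for z
  proof -
    have "\<bar>h z\<bar> \<le> \<bar>C\<bar>" using b[OF that] by linarith
    then show ?thesis by (simp add: abs_mult mult.commute[of "\<bar>W z\<bar>"] mult_right_mono)
  qed
  then show "AE z in plate_measure l. norm (W z * h z) \<le> norm (C * W z)"
    by (rule AE_plateI)
qed

lemma bounded_plate_integrable:
  assumes h: "h \<in> borel_measurable (plate_measure l)"
    and b: "\<And>z. z \<in> plate l \<Longrightarrow> \<bar>h z\<bar> \<le> C"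
  shows "integrable (plate_measure l) (h :: _ \<Rightarrow> real)"
proof -
  have "integrable (plate_measure l) (\<lambda>_. 1 :: real)"
    by (rule finite_measure.integrable_const[OF finite_measure_plate])
  from bounded_mult_integrable[OF this h b] show ?thesis by simp
qed

lemma smooth_bounded_on:
  assumes "smooth p" obtains C where "C \<ge> 0" "\<And>t. t \<in> {a..b} \<Longrightarrow> \<bar>p t\<bar> \<le> C"
proof -
  have "compact (p ` {a..b})"
    by (intro compact_continuous_image smooth_continuous_on assms) auto
  then obtain C where "\<forall>t\<in>{a..b}. \<bar>p t\<bar> \<le> C"
    by (auto dest!: compact_imp_bounded simp: bounded_iff)
  then show thesis using that[of "\<bar>C\<bar>"] by fastforce
qed

lemma plate_int_integrable:
  assumes W: "integrable (plate_measure l) W" and "smooth p" "smooth q"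
  shows "integrable (plate_measure l) (\<lambda>z. W z * (p (fst z) * q (snd z)))"
proof -
  obtain C where C: "C \<ge> 0" "\<And>t. t \<in> {0..pi} \<Longrightarrow> \<bar>p t\<bar> \<le> C"
    using smooth_bounded_on[OF \<open>smooth p\<close>] by blast
  obtain D where D: "D \<ge> 0" "\<And>t. t \<in> {-l..l} \<Longrightarrow> \<bar>q t\<bar> \<le> D"
    using smooth_bounded_on[OF \<open>smooth q\<close>] by blast
  have "\<bar>p (fst z) * q (snd z)\<bar> \<le> C * D" if "z \<in> plate l" for z
    unfolding abs_mult using that C D by (intro mult_mono) (auto simp: plate_iff)
  then show ?thesis
    by (rule bounded_mult_integrable[OF W smooth_prod_measurable[OF assms(2,3)]])
qed

lemma plate_int_dominated:
  assumes W: "integrable (plate_measure l) W"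
    and h: "\<And>n. h n \<in> borel_measurable (plate_measure l)" "h' \<in> borel_measurable (plate_measure l)"
    and b: "\<And>n z. z \<in> plate l \<Longrightarrow> \<bar>h n z\<bar> \<le> C"
    and lim: "\<And>z. z \<in> plate l \<Longrightarrow> (\<lambda>n. h n z) \<longlonglongrightarrow> h' z"
  shows "(\<lambda>n. LINT z|plate_measure l. W z * h n z) \<longlonglongrightarrow> (LINT z|plate_measure l. W z * h' z :: real)"
proof (rule integral_dominated_convergence[where w = "\<lambda>z. \<bar>C\<bar> * \<bar>W z\<bar>"])
  show "(\<lambda>z. W z * h' z) \<in> borel_measurable (plate_measure l)"
    "\<And>n. (\<lambda>z. W z * h n z) \<in> borel_measurable (plate_measure l)"
    by (intro borel_measurable_times borel_measurable_integrable[OF W] h)+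
  show "integrable (plate_measure l) (\<lambda>z. \<bar>C\<bar> * \<bar>W z\<bar>)" using W by simp
  show "AE z in plate_measure l. (\<lambda>n. W z * h n z) \<longlonglongrightarrow> W z * h' z"
    by (intro AE_plateI tendsto_mult tendsto_const lim)
  have "norm (W z * h n z) \<le> \<bar>C\<bar> * \<bar>W z\<bar>" if "z \<in> plate l" for n z
    using b[OF that, of n] by (simp add: abs_mult mult.commute[of "\<bar>W z\<bar>"] mult_right_mono)
  then show "AE z in plate_measure l. norm (W z * h n z) \<le> \<bar>C\<bar> * \<bar>W z\<bar>" for n
    by (rule AE_plateI)
qed

lemma plate_int_tendsto:
  assumes W: "integrable (plate_measure l) W"
    and sm: "\<And>n. smooth (p n)" "\<And>n. smooth (q n)" "smooth p'" "smooth q'"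
    and bp: "\<And>n t. t \<in> {0<..<pi} \<Longrightarrow> \<bar>p n t\<bar> \<le> C" and bq: "\<And>n t. t \<in> {-l<..<l} \<Longrightarrow> \<bar>q n t\<bar> \<le> D"
    and lp: "\<And>t. t \<in> {0<..<pi} \<Longrightarrow> (\<lambda>n. p n t) \<longlonglongrightarrow> p' t"
    and lq: "\<And>t. t \<in> {-l<..<l} \<Longrightarrow> (\<lambda>n. q n t) \<longlonglongrightarrow> q' t"
  shows "(\<lambda>n. plate_int l W (p n) (q n)) \<longlonglongrightarrow> plate_int l W p' q'"
  unfolding plate_int_def
proof (rule plate_int_dominated[OF W, where C = "\<bar>C\<bar> * \<bar>D\<bar>"])
  show "\<bar>p n (fst z) * q n (snd z)\<bar> \<le> \<bar>C\<bar> * \<bar>D\<bar>" if "z \<in> plate l" for n z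
    unfolding abs_mult using bp[of "fst z" n] bq[of "snd z" n] that
    by (intro mult_mono) (auto simp: plate_iff)
qed (auto intro!: tendsto_mult lp lq smooth_prod_measurable sm simp: plate_iff)

lemma plate_int_add2:
  assumes "integrable (plate_measure l) W" "smooth p" "smooth q" "smooth p'"
  shows "plate_int l W (\<lambda>t. p t + p' t) q = plate_int l W p q + plate_int l W p' q"
  unfolding plate_int_def
  by (subst Bochner_Integration.integral_add[symmetric])
    (auto intro!: plate_int_integrable assms Bochner_Integration.integral_cong simp: algebra_simps)

subsection \<open>Borel representatives\<close>

text \<open>Changing a Lebesgue measurable function on a null set makes it Borel measurable, so that Fubini
  applies on the product of two copies of the line.\<close>

lemma plate_borel_version:
  fixes g :: "real \<times> real \<Rightarrow> real"
  assumes g: "integrable (plate_measure l) g"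
  obtains g' where "integrable lborel g'" "AE z in plate_measure l. g z = g' z"
    "\<And>z. z \<notin> plate l \<Longrightarrow> g' z = 0"
    "\<And>h. h \<in> borel_measurable borel \<Longrightarrow>
       (LINT z|plate_measure l. g z * h z) = (LINT z|lborel. g' z * h z)"
proof -
  have "integrable lebesgue (\<lambda>z. indicator (plate l) z *\<^sub>R g z)"
    using g by (subst (asm) integrable_restrict_space) auto
  then have f: "(\<lambda>z. indicator (plate l) z * g z) \<in> borel_measurable lebesgue"
    and fi: "integrable lebesgue (\<lambda>z. indicator (plate l) z * g z)" by auto
  obtain f' where f': "f' \<in> borel_measurable lborel" "AE z in lborel. indicator (plate l) z * g z = f' z"
    using completion_ex_borel_measurable_real[OF f] by blast
  have mf': "f' \<in> borel_measurable borel" using f'(1) by simp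
  define g' where "g' z = indicator (plate l) z * f' z" for z
  have mg': "g' \<in> borel_measurable lborel"
    using mf' by (simp add: g'_def[abs_def])
  have ae: "AE z in lborel. indicator (plate l) z * g z = g' z"
    using f'(2) by eventually_elim (auto simp: g'_def indicator_def split: if_splits)
  have aec: "AE z in lebesgue. indicator (plate l) z * g z = g' z"
    using ae by (rule AE_completion)
  show thesis
  proof
    have "integrable lebesgue g'"
      using fi by (subst integrable_cong_AE[where g = "\<lambda>z. indicator (plate l) z * g z"])
        (use mg' aec f in \<open>auto simp: eq_commute intro: measurable_completion\<close>)
    then show "integrable lborel g'"
      using mg' by (subst (asm) integrable_completion) auto
    show "AE z in plate_measure l. g z = g' z"
      unfolding AE_plate_iff using ae by eventually_elim (auto simp: indicator_def split: if_splits)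
    show "g' z = 0" if "z \<notin> plate l" for z using that by (simp add: g'_def)
    fix h :: "real \<times> real \<Rightarrow> real" assume h: "h \<in> borel_measurable borel"
    have hl: "h \<in> borel_measurable lebesgue" using h by (intro measurable_completion) simp
    have "(LINT z|plate_measure l. g z * h z) = (LINT z|lebesgue. indicator (plate l) z *\<^sub>R (g z * h z))"
      by (rule integral_restrict_space) auto
    also have "\<dots> = (LINT z|lebesgue. (indicator (plate l) z * g z) * h z)"
      by (simp add: mult.assoc)
    also have "\<dots> = (LINT z|lebesgue. g' z * h z)"
    proof (rule integral_cong_AE)
      show "(\<lambda>z. indicator (plate l) z * g z * h z) \<in> borel_measurable lebesgue"
        using f hl by (rule borel_measurable_times)
      show "(\<lambda>z. g' z * h z) \<in> borel_measurable lebesgue"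
        by (rule borel_measurable_times[OF measurable_completion[OF mg'] hl])
      show "AE z in lebesgue. indicator (plate l) z * g z * h z = g' z * h z"
        using aec by eventually_elim simp
    qed
    also have "\<dots> = (LINT z|lborel. g' z * h z)"
      using mg' h by (intro integral_completion) simp
    finally show "(LINT z|plate_measure l. g z * h z) = (LINT z|lborel. g' z * h z)" .
  qed
qed

text \<open>Open boxes are an intersection-stable generator of the Borel sets, so an integrable function
  whose integral over every box vanishes has vanishing integral over every Borel set.\<close>

lemma integral_boxes_zero_imp_AE_zero:
  fixes g :: "real \<times> real \<Rightarrow> real"
  assumes g: "integrable lborel g"
    and box: "\<And>a b. (LINT z:box a b|lborel. g z) = 0"
  shows "AE z in lborel. g z = 0"
proof (rule density_unique_real[OF g])
  show "integrable lborel (\<lambda>_. 0 :: real)" by simp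
  have si: "set_integrable lborel A g" if "A \<in> sets borel" for A
    unfolding set_integrable_def using g that by (intro integrable_mult_indicator) auto
  define E where "E = (range (\<lambda>(a, b). box a b) :: (real \<times> real) set set)"
  have UN: "(\<Union>n::nat. box (- real n, - real n) (real n, real n)) = (UNIV :: (real \<times> real) set)"
  proof -
    have "\<exists>n::nat. (x, y) \<in> box (- real n, - real n) (real n, real n)" for x y :: real
    proof -
      obtain n :: nat where "real n > \<bar>x\<bar> + \<bar>y\<bar>" using reals_Archimedean2 by blast
      then show ?thesis by (intro exI[of _ n]) (auto simp: box_def Basis_prod_def)
    qed
    then show ?thesis by auto
  qed
  have lim: "(\<lambda>n. LINT z:box (- real n, - real n) (real n, real n)|lborel. g z) \<longlonglongrightarrow> (LINT z:UNIV|lborel. g z)"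
    unfolding UN[symmetric]
  proof (rule set_integral_cont_up)
    show "incseq (\<lambda>n. box (- real n, - real n) (real n, real n))"
      by (auto simp: incseq_def box_def Basis_prod_def)
    show "set_integrable lborel (\<Union>n::nat. box (- real n, - real n) (real n, real n)) g"
      by (intro si) auto
  qed auto
  have univ: "(LINT z:UNIV|lborel. g z) = 0"
    using lim unfolding box by (simp add: LIMSEQ_const_iff)
  fix A :: "(real \<times> real) set" assume "A \<in> sets lborel"
  then have A: "A \<in> sigma_sets UNIV E"
    by (simp add: borel_eq_box E_def case_prod_unfold image_def)
  have "Int_stable E"
  proof -
    have "E = {u. \<exists>a b. u = box a b}" by (auto simp: E_def)
    note E = this
    show ?thesis unfolding Int_stable_def
    proof (intro ballI)
      fix A B assume "A \<in> E" "B \<in> E"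
      then obtain a b a' b' where AB: "A = box a b" "B = box a' b'" using E by blast
      show "A \<inter> B \<in> E" unfolding AB box_Int_box using E by blast
    qed
  qed
  moreover have "E \<subseteq> Pow UNIV" by simp
  moreover note A
  ultimately have "(LINT z:A|lborel. g z) = 0"
  proof (induct rule: sigma_sets_induct_disjoint)
    case (basic A)
    then show ?case using box by (auto simp: E_def)
  next
    case empty
    then show ?case by (simp add: set_lebesgue_integral_def)
  next
    case (compl A)
    have sA: "A \<in> sets borel" using compl(1) by (simp add: borel_eq_box E_def case_prod_unfold image_def)
    have "(LINT z:UNIV|lborel. g z) = (LINT z:A|lborel. g z) + (LINT z:(UNIV - A)|lborel. g z)"
      by (subst set_integral_Un[symmetric]) (use sA in \<open>auto intro!: si\<close>)
    then show ?case using univ compl by simp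
  next
    case (union A)
    have sA: "\<And>i. A i \<in> sets borel" using union(2) by (auto simp: borel_eq_box E_def case_prod_unfold image_def)
    have "(LINT z:(\<Union>i. A i)|lborel. g z) = (\<Sum>i. LINT z:A i|lborel. g z)"
      by (rule lebesgue_integral_countable_add)
        (use union(1) sA in \<open>auto simp: disjoint_family_on_def intro!: si\<close>)
    then show ?case using union(3) by simp
  qed
  then show "(LINT z:A|lborel. g z) = (LINT z:A|lborel. 0)" by simp
qed

text \<open>Products of cutoffs converge boundedly to indicators of boxes.\<close>

lemma plate_test_zero_imp_AE_zero:
  assumes g: "integrable (plate_measure l) g"
    and z: "\<And>p q. test_fun 0 pi p \<Longrightarrow> test_fun (-l) l q \<Longrightarrow> plate_int l g p q = 0"
  shows "AE z in plate_measure l. g z = 0"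
proof -
  obtain g' where g': "integrable lborel g'" "AE z in plate_measure l. g z = g' z"
    "\<And>z. z \<notin> plate l \<Longrightarrow> g' z = 0"
    "\<And>h. h \<in> borel_measurable borel \<Longrightarrow>
       (LINT z|plate_measure l. g z * h z) = (LINT z|lborel. g' z * h z)"
    using plate_borel_version[OF g] by blast
  have "AE z in lborel. g' z = 0"
  proof (rule integral_boxes_zero_imp_AE_zero[OF g'(1)])
    fix a b :: "real \<times> real"
    define c d c' d' where "c = max 0 (fst a)" and "d = min pi (fst b)"
      and "c' = max (-l) (snd a)" and "d' = min l (snd b)"
    have sub: "test_fun 0 pi p" if "test_fun c d p" for p
      using that unfolding test_fun_def c_def d_def by (smt (verit) max_less_iff_conj min_less_iff_conj)
    have sub': "test_fun (-l) l p" if "test_fun c' d' p" for p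
      using that unfolding test_fun_def c'_def d'_def by (smt (verit) max_less_iff_conj min_less_iff_conj)
    define h where "h n z = cutoff c d n (fst z) * cutoff c' d' n (snd z)" for n and z :: "real \<times> real"
    have hm: "h n \<in> borel_measurable borel" for n
      unfolding h_def[abs_def] by (intro borel_measurable_times smooth_fst_borel smooth_snd_borel smooth_cutoff)
    have zero: "(LINT z|lborel. g' z * h n z) = 0" for n
      using z[OF sub sub', OF cutoff_test_fun cutoff_test_fun, of n n] g'(4)[OF hm, of n]
      by (simp add: plate_int_def h_def)
    have lim: "(\<lambda>n. LINT z|lborel. g' z * h n z) \<longlonglongrightarrow> (LINT z|lborel. indicator (box a b) z * g' z)"
    proof (rule integral_dominated_convergence[where w = "\<lambda>z. \<bar>g' z\<bar>"])
      show "(\<lambda>z. indicator (box a b) z * g' z) \<in> borel_measurable lborel"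
        "\<And>n. (\<lambda>z. g' z * h n z) \<in> borel_measurable lborel"
        using g'(1) hm by auto
      show "integrable lborel (\<lambda>z. \<bar>g' z\<bar>)" using g'(1) by simp
      have "(\<lambda>n. g' z * h n z) \<longlonglongrightarrow> indicator (box a b) z * g' z" for z
      proof (cases "z \<in> plate l \<and> z \<in> box a b")
        case True
        then have zz: "fst z \<in> {c<..<d}" "snd z \<in> {c'<..<d'}"
          by (cases z; cases a; cases b; force simp: plate_iff box_def Basis_prod_def c_def d_def c'_def d'_def)+
        have "eventually (\<lambda>n. g' z * h n z = g' z) sequentially"
          using cutoff_eventually[OF zz(1)] cutoff_eventually[OF zz(2)]
          by eventually_elim (simp add: h_def)
        then show ?thesis using True by (auto intro: tendsto_eventually)
      next
        case False
        then have "\<not> (fst z \<in> {c<..<d} \<and> snd z \<in> {c'<..<d'})"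
          by (cases z; cases a; cases b; auto simp: plate_iff box_def Basis_prod_def c_def d_def c'_def d'_def)
        then have "h n z = 0" for n using cutoff_outside by (auto simp: h_def)
        moreover have "indicator (box a b) z * g' z = 0"
          using False g'(3)[of z] by (cases "z \<in> plate l") (auto simp: indicator_def)
        ultimately show ?thesis by (simp only: mult_zero_right tendsto_const)
      qed
      then show "AE z in lborel. (\<lambda>n. g' z * h n z) \<longlonglongrightarrow> indicator (box a b) z * g' z" by simp
      have "norm (g' z * h n z) \<le> \<bar>g' z\<bar>" for n z
      proof -
        have "\<bar>h n z\<bar> \<le> 1" unfolding h_def using cutoff_bounds by (simp add: abs_mult mult_le_one)
        then show ?thesis by (simp add: abs_mult mult_left_le)
      qed
      then show "AE z in lborel. norm (g' z * h n z) \<le> \<bar>g' z\<bar>" for n by simp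
    qed
    show "(LINT z:box a b|lborel. g' z) = 0"
      using lim unfolding zero by (simp add: set_lebesgue_integral_def LIMSEQ_const_iff)
  qed
  then have "AE z in plate_measure l. g' z = 0" unfolding AE_plate_iff by eventually_elim simp
  with g'(2) show ?thesis by eventually_elim simp
qed

section \<open>Integration by parts against functions that vanish only partly\<close>

text \<open>The weak derivative relation in one variable, tested with products and for integrable functions
  only; a second weak derivative splits into two such relations.\<close>

definition x_deriv_pair :: "real \<Rightarrow> (real \<times> real \<Rightarrow> real) \<Rightarrow> (real \<times> real \<Rightarrow> real) \<Rightarrow> bool" where
  "x_deriv_pair l V V' \<longleftrightarrow> integrable (plate_measure l) V \<and> integrable (plate_measure l) V' \<and>
     (\<forall>p q. test_fun 0 pi p \<longrightarrow> test_fun (-l) l q \<longrightarrow>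
        plate_int l V (deriv p) q = - plate_int l V' p q)"

definition y_deriv_pair :: "real \<Rightarrow> (real \<times> real \<Rightarrow> real) \<Rightarrow> (real \<times> real \<Rightarrow> real) \<Rightarrow> bool" where
  "y_deriv_pair l V V' \<longleftrightarrow> integrable (plate_measure l) V \<and> integrable (plate_measure l) V' \<and>
     (\<forall>p q. test_fun 0 pi p \<longrightarrow> test_fun (-l) l q \<longrightarrow>
        plate_int l V p (deriv q) = - plate_int l V' p q)"

lemma deriv_cutoff_mult:
  assumes "smooth p"
  shows "deriv (\<lambda>t. cutoff c d n t * p t) t = deriv (cutoff c d n) t * p t + cutoff c d n t * deriv p t"
  using DERIV_mult[OF smooth_has_deriv[OF smooth_cutoff] smooth_has_deriv[OF assms]]
  by (intro DERIV_imp_deriv) (simp add: mult.commute add.commute)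

lemma smooth_cutoff_mult: "smooth p \<Longrightarrow> smooth (\<lambda>t. cutoff c d n t * p t)"
  by (intro smooth_mult smooth_cutoff)

lemma cutoff_mult_tendsto:
  "t \<in> {c<..<d} \<Longrightarrow> (\<lambda>n. cutoff c d n t * x) \<longlonglongrightarrow> x"
  by (rule tendsto_eventually, rule eventually_mono[OF cutoff_eventually]) auto

lemma deriv_cutoff_mult_tendsto:
  assumes "smooth p" "t \<in> {c<..<d}"
  shows "(\<lambda>n. deriv (\<lambda>t. cutoff c d n t * p t) t) \<longlonglongrightarrow> deriv p t"
  unfolding deriv_cutoff_mult[OF assms(1)]
  by (rule tendsto_eventually) (use cutoff_eventually[OF assms(2)] in \<open>auto elim: eventually_mono\<close>)

lemma cutoff_mult_bounded:
  assumes "smooth p"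
  shows "\<exists>B. \<forall>n. \<forall>t\<in>{c<..<d}. \<bar>cutoff c d n t * p t\<bar> \<le> B"
proof -
  obtain B where B: "B \<ge> 0" "\<And>t. t \<in> {c..d} \<Longrightarrow> \<bar>p t\<bar> \<le> B"
    using smooth_bounded_on[OF assms] by blast
  have "\<bar>cutoff c d n t * p t\<bar> \<le> B" if "t \<in> {c<..<d}" for n t
  proof -
    have "\<bar>cutoff c d n t * p t\<bar> \<le> 1 * \<bar>p t\<bar>"
      unfolding abs_mult using cutoff_bounds[of c d n t] by (intro mult_right_mono) auto
    also have "\<dots> \<le> B" using B(2)[of t] that by simp
    finally show ?thesis .
  qed
  then show ?thesis by blast
qed

text \<open>The derivative of the cutoff has size \<open>n\<close>, but only within distance \<open>2 / n\<close> of the end points,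
  where a function vanishing there is of size \<open>1 / n\<close>.\<close>

lemma deriv_cutoff_mult_bounded:
  assumes p: "smooth p" and z: "p c = 0" "p d = 0" and cd: "c < d"
  shows "\<exists>B. \<forall>n. \<forall>t\<in>{c<..<d}. \<bar>deriv (\<lambda>t. cutoff c d n t * p t) t\<bar> \<le> B"
proof -
  obtain C where C: "C \<ge> 0" "\<And>n t. \<bar>deriv (cutoff c d n) t\<bar> \<le> C * real n"
    using deriv_cutoff_bounded by blast
  obtain K where K: "K \<ge> 0" "\<And>t. t \<in> {c..d} \<Longrightarrow> \<bar>deriv p t\<bar> \<le> K"
    using smooth_bounded_on[OF smooth_deriv[OF p]] by blast
  have lip: "\<bar>p s - p t\<bar> \<le> K * (t - s)" if st: "c \<le> s" "s < t" "t \<le> d" for s t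
  proof -
    obtain \<xi> where \<xi>: "s < \<xi>" "\<xi> < t" "p t - p s = (t - s) * deriv p \<xi>"
      using MVT2[OF st(2), of p "deriv p"] smooth_has_deriv[OF p] by blast
    have "\<bar>p s - p t\<bar> = (t - s) * \<bar>deriv p \<xi>\<bar>"
      using \<xi>(3) st(2) by (simp add: abs_minus_commute[of "p s"] abs_mult)
    also have "\<dots> \<le> (t - s) * K" using \<xi> st by (intro mult_left_mono K(2)) auto
    finally show ?thesis by (simp add: mult.commute)
  qed
  have "\<bar>deriv (\<lambda>t. cutoff c d n t * p t) t\<bar> \<le> C * (K * 2) + K" if t: "t \<in> {c<..<d}" for n t
  proof -
    have "\<bar>deriv (cutoff c d n) t * p t\<bar> \<le> C * (K * 2)"
    proof (cases "deriv (cutoff c d n) t = 0")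
      case True then show ?thesis using C K by simp
    next
      case False
      have "real n * \<bar>p t\<bar> \<le> K * 2"
        using deriv_cutoff_nonzero[OF False]
      proof
        assume *: "real n * (t - c) \<le> 2"
        have "\<bar>p t\<bar> \<le> K * (t - c)" using lip[of c t] t z by simp
        then have "real n * \<bar>p t\<bar> \<le> real n * (K * (t - c))" by (intro mult_left_mono) auto
        also have "\<dots> = K * (real n * (t - c))" by simp
        also have "\<dots> \<le> K * 2" using * K by (intro mult_left_mono)
        finally show ?thesis .
      next
        assume *: "real n * (d - t) \<le> 2"
        have "\<bar>p t\<bar> \<le> K * (d - t)" using lip[of t d] t z by simp
        then have "real n * \<bar>p t\<bar> \<le> real n * (K * (d - t))" by (intro mult_left_mono) auto
        also have "\<dots> = K * (real n * (d - t))" by simp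
        also have "\<dots> \<le> K * 2" using * K by (intro mult_left_mono)
        finally show ?thesis .
      qed
      then have "C * (real n * \<bar>p t\<bar>) \<le> C * (K * 2)" using C by (intro mult_left_mono)
      moreover have "\<bar>deriv (cutoff c d n) t * p t\<bar> \<le> (C * real n) * \<bar>p t\<bar>"
        unfolding abs_mult using C by (intro mult_right_mono) auto
      ultimately show ?thesis by simp
    qed
    moreover have "\<bar>cutoff c d n t * deriv p t\<bar> \<le> 1 * K"
      unfolding abs_mult using cutoff_bounds[of c d n t] K(2)[of t] t K(1) by (intro mult_mono) auto
    ultimately show ?thesis unfolding deriv_cutoff_mult[OF p] by linarith
  qed
  then show ?thesis by blast
qed

text \<open>A factor that vanishes at the end points but is not compactly supported is approximated by its
  cutoffs, whose derivatives stay bounded.\<close>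

lemma x_deriv_pair_vanishing:
  assumes V: "x_deriv_pair l V V'" and p: "smooth p" "p 0 = 0" "p pi = 0" and q: "smooth q"
  shows "plate_int l V (deriv p) q = - plate_int l V' p q"
proof -
  define P where "P n t = cutoff 0 pi n t * p t" for n t
  define Q where "Q n t = cutoff (-l) l n t * q t" for n t
  obtain B where B: "\<And>n t. t \<in> {0<..<pi} \<Longrightarrow> \<bar>P n t\<bar> \<le> B"
    using cutoff_mult_bounded[OF p(1), of 0 pi] unfolding P_def by blast
  obtain B' where B': "\<And>n t. t \<in> {0<..<pi} \<Longrightarrow> \<bar>deriv (P n) t\<bar> \<le> B'"
    using deriv_cutoff_mult_bounded[OF p pi_gt_zero] unfolding P_def[abs_def] by blast
  obtain C where C: "\<And>n t. t \<in> {-l<..<l} \<Longrightarrow> \<bar>Q n t\<bar> \<le> C"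
    using cutoff_mult_bounded[OF q, of "-l" l] unfolding Q_def by blast
  have sP: "smooth (P n)" and sQ: "smooth (Q n)" for n
    unfolding P_def[abs_def] Q_def[abs_def] by (intro smooth_cutoff_mult p q)+
  have i: "integrable (plate_measure l) V" "integrable (plate_measure l) V'"
    using V by (auto simp: x_deriv_pair_def)
  have "(\<lambda>n. plate_int l V (deriv (P n)) (Q n)) \<longlonglongrightarrow> plate_int l V (deriv p) q"
    by (rule plate_int_tendsto[OF i(1)])
      (auto intro!: sP sQ smooth_deriv p q B' C, auto simp: P_def[abs_def] Q_def intro!: cutoff_mult_tendsto deriv_cutoff_mult_tendsto p(1))
  moreover have "(\<lambda>n. - plate_int l V' (P n) (Q n)) \<longlonglongrightarrow> - plate_int l V' p q"
    by (intro tendsto_minus plate_int_tendsto[OF i(2)])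
      (auto intro!: sP sQ p q B C, auto simp: P_def Q_def intro!: cutoff_mult_tendsto)
  moreover have "plate_int l V (deriv (P n)) (Q n) = - plate_int l V' (P n) (Q n)" for n
    using V test_fun_cutoff_mult[OF p(1), of 0 pi n] test_fun_cutoff_mult[OF q, of "-l" l n]
    unfolding x_deriv_pair_def P_def[abs_def] Q_def[abs_def] by blast
  ultimately show ?thesis using LIMSEQ_unique by auto
qed

lemma y_deriv_pair_vanishing:
  assumes V: "y_deriv_pair l V V'" and l: "l > 0" and q: "smooth q" "q (-l) = 0" "q l = 0" and p: "smooth p"
  shows "plate_int l V p (deriv q) = - plate_int l V' p q"
proof -
  define P where "P n t = cutoff 0 pi n t * p t" for n t
  define Q where "Q n t = cutoff (-l) l n t * q t" for n t
  obtain B where B: "\<And>n t. t \<in> {0<..<pi} \<Longrightarrow> \<bar>P n t\<bar> \<le> B"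
    using cutoff_mult_bounded[OF p(1), of 0 pi] unfolding P_def by blast
  obtain C' where C': "\<And>n t. t \<in> {-l<..<l} \<Longrightarrow> \<bar>deriv (Q n) t\<bar> \<le> C'"
    using deriv_cutoff_mult_bounded[OF q] l unfolding Q_def[abs_def] by force
  obtain C where C: "\<And>n t. t \<in> {-l<..<l} \<Longrightarrow> \<bar>Q n t\<bar> \<le> C"
    using cutoff_mult_bounded[OF q(1), of "-l" l] unfolding Q_def by blast
  have sP: "smooth (P n)" and sQ: "smooth (Q n)" for n
    unfolding P_def[abs_def] Q_def[abs_def] by (intro smooth_cutoff_mult p q)+
  have i: "integrable (plate_measure l) V" "integrable (plate_measure l) V'"
    using V by (auto simp: y_deriv_pair_def)
  have "(\<lambda>n. plate_int l V (P n) (deriv (Q n))) \<longlonglongrightarrow> plate_int l V p (deriv q)"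
    by (rule plate_int_tendsto[OF i(1)])
      (auto intro!: sP sQ smooth_deriv p q B C', auto simp: P_def Q_def[abs_def] intro!: cutoff_mult_tendsto deriv_cutoff_mult_tendsto q(1))
  moreover have "(\<lambda>n. - plate_int l V' (P n) (Q n)) \<longlonglongrightarrow> - plate_int l V' p q"
    by (intro tendsto_minus plate_int_tendsto[OF i(2)])
      (auto intro!: sP sQ p q B C, auto simp: P_def Q_def intro!: cutoff_mult_tendsto)
  moreover have "plate_int l V (P n) (deriv (Q n)) = - plate_int l V' (P n) (Q n)" for n
    using V test_fun_cutoff_mult[OF p(1), of 0 pi n] test_fun_cutoff_mult[OF q(1), of "-l" l n]
    unfolding y_deriv_pair_def P_def[abs_def] Q_def[abs_def] by blast
  ultimately show ?thesis using LIMSEQ_unique by auto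
qed

lemma plate_strip_measure:
  assumes "l > 0" "d > 0"
  shows "(LINT z|plate_measure l. indicator {z. fst z \<le> d \<or> pi - fst z \<le> d} z) \<le> 4 * d * l"
proof -
  let ?S = "{z :: real \<times> real. fst z \<le> d \<or> pi - fst z \<le> d}"
  let ?A = "cbox (0, -l) (d, l) :: (real \<times> real) set" and ?B = "cbox (pi - d, -l) (pi, l) :: (real \<times> real) set"
  have SB: "?S \<in> sets borel"
    by (intro borel_closed closed_Collect_disj closed_Collect_le continuous_intros)
  have "(LINT z|plate_measure l. indicator ?S z) = (LINT z|lebesgue. indicator (plate l) z *\<^sub>R indicator ?S z :: real)"
    by (rule integral_restrict_space) auto
  also have "\<dots> = (LINT z|lebesgue. indicator (plate l \<inter> ?S) z)"
    by (simp add: indicator_inter_arith)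
  also have "\<dots> = measure lebesgue (plate l \<inter> ?S)"
    by simp
  also have "\<dots> \<le> measure lebesgue (?A \<union> ?B)"
    by (rule measure_mono_fmeasurable) (use SB in \<open>auto simp: plate_iff\<close>)
  also have "\<dots> \<le> measure lebesgue ?A + measure lebesgue ?B"
    by (rule measure_Un_le) auto
  also have "\<dots> = 4 * d * l"
    using assms by (simp add: content_Pair)
  finally show ?thesis .
qed

text \<open>Across the short edges a trace is needed: there the derivative of the cutoff has size \<open>n\<close> on
  two strips of width \<open>2 / n\<close>, on which \<open>w\<close> is uniformly small because its continuous
  representative vanishes on the edges.\<close>

lemma x_deriv_pair_trace:
  assumes V: "x_deriv_pair l w w'" and l: "l > 0"
    and w0: "continuous_on (closure (plate l)) w0" "AE z in plate_measure l. w z = w0 z"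
      "\<And>z. z \<in> {0, pi} \<times> {-l<..<l} \<Longrightarrow> w0 z = 0"
    and p: "smooth p" and q: "smooth q"
  shows "plate_int l w (deriv p) q = - plate_int l w' p q"
proof -
  define P where "P n t = cutoff 0 pi n t * p t" for n t
  define P1 where "P1 n t = cutoff 0 pi n t * deriv p t" for n t
  define R where "R n t = deriv (cutoff 0 pi n) t * p t" for n t
  define Q where "Q n t = cutoff (-l) l n t * q t" for n t
  obtain B where B: "\<And>n t. t \<in> {0<..<pi} \<Longrightarrow> \<bar>P n t\<bar> \<le> B"
    using cutoff_mult_bounded[OF p(1), of 0 pi] unfolding P_def by blast
  obtain B' where B': "\<And>n t. t \<in> {0<..<pi} \<Longrightarrow> \<bar>P1 n t\<bar> \<le> B'"
    using cutoff_mult_bounded[OF smooth_deriv[OF p(1)], of 0 pi] unfolding P1_def by blast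
  obtain C where C: "\<And>n t. t \<in> {-l<..<l} \<Longrightarrow> \<bar>Q n t\<bar> \<le> C"
    using cutoff_mult_bounded[OF q, of "-l" l] unfolding Q_def by blast
  obtain D where D: "D \<ge> 0" "\<And>t. t \<in> {0..pi} \<Longrightarrow> \<bar>p t\<bar> \<le> D"
    using smooth_bounded_on[OF p] by blast
  obtain E where E: "E \<ge> 0" "\<And>n t. \<bar>deriv (cutoff 0 pi n) t\<bar> \<le> E * real n"
    using deriv_cutoff_bounded by blast
  have sP: "smooth (P n)" and sQ: "smooth (Q n)" and sP1: "smooth (P1 n)" and sR: "smooth (R n)" for n
    unfolding P_def[abs_def] Q_def[abs_def] P1_def[abs_def] R_def[abs_def]
    by (intro smooth_cutoff_mult p q smooth_mult smooth_deriv smooth_cutoff)+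
  have i: "integrable (plate_measure l) w" "integrable (plate_measure l) w'"
    using V by (auto simp: x_deriv_pair_def)
  have "(\<lambda>n. plate_int l w (P1 n) (Q n)) \<longlonglongrightarrow> plate_int l w (deriv p) q"
    by (rule plate_int_tendsto[OF i(1)])
      (auto intro!: sP1 sQ smooth_deriv p q B' C, auto simp: P1_def Q_def intro!: cutoff_mult_tendsto)
  moreover have "(\<lambda>n. plate_int l w (R n) (Q n)) \<longlonglongrightarrow> 0"
  proof (rule LIMSEQ_I)
    fix \<epsilon> :: real assume "\<epsilon> > 0"
    \<comment> \<open>the two strips of width \<open>2 / n\<close> have total area at most \<open>8 l / n\<close>\<close>
    define K where "K = E * D * \<bar>C\<bar> * 8 * l + 1"
    have K: "K > 0" using E D l by (auto simp: K_def intro!: add_nonneg_pos mult_nonneg_nonneg)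
    have "uniformly_continuous_on (closure (plate l)) w0"
      using w0(1) plate_bounded by (intro compact_uniformly_continuous) (auto simp: compact_closure)
    then obtain \<delta> where \<delta>: "\<delta> > 0"
      "\<And>z z'. z \<in> closure (plate l) \<Longrightarrow> z' \<in> closure (plate l) \<Longrightarrow> dist z' z < \<delta> \<Longrightarrow> dist (w0 z') (w0 z) < \<epsilon> / K"
      using \<open>\<epsilon> > 0\<close> K unfolding uniformly_continuous_on_def by (metis divide_pos_pos)
    have cl: "closure (plate l) = {0..pi} \<times> {-l..l}"
      using l by (simp add: plate_def closure_Times)
    have small: "\<bar>w0 z\<bar> \<le> \<epsilon> / K" if z: "z \<in> plate l" "fst z < \<delta> \<or> pi - fst z < \<delta>" for z
    proof -
      have "\<bar>w0 z\<bar> < \<epsilon> / K" if "dist z (x, snd z) < \<delta>" "x \<in> {0, pi}" for x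
        using \<delta>(2)[of "(x, snd z)" z] that z(1) w0(3)[of "(x, snd z)"] pi_gt_zero
        by (cases z) (auto simp: cl plate_iff dist_real_def)
      from this[of 0] this[of pi] show ?thesis using z
        by (cases z) (auto simp: plate_iff dist_Pair_Pair dist_real_def less_imp_le)
    qed
    obtain N :: nat where N: "real N > 2 / \<delta>" using reals_Archimedean2 by blast
    have "norm (plate_int l w (R n) (Q n) - 0) < \<epsilon>" if n: "n \<ge> max N 1" for n
    proof -
      have n0: "real n > 0" using n by auto
      have nd: "2 / real n < \<delta>"
      proof -
        have "real n > 2 / \<delta>" using N n by auto
        then show ?thesis using n0 \<delta>(1) by (simp add: field_simps)
      qed
      let ?S = "{z :: real \<times> real. fst z \<le> 2 / real n \<or> pi - fst z \<le> 2 / real n}"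
      define H where "H = E * real n * D * \<bar>C\<bar> * (\<epsilon> / K)"
      have H: "H \<ge> 0" using E D K \<open>\<epsilon> > 0\<close> by (simp add: H_def)
      have *: "\<bar>w0 z * (R n (fst z) * Q n (snd z))\<bar> \<le> H * indicator ?S z" if z: "z \<in> plate l" for z
      proof (cases "deriv (cutoff 0 pi n) (fst z) = 0")
        case True then show ?thesis using H by (simp add: R_def)
      next
        case False
        have S: "z \<in> ?S" using deriv_cutoff_nonzero[OF False] n0 by (auto simp: field_simps)
        then have "fst z < \<delta> \<or> pi - fst z < \<delta>" using nd by auto
        then have a: "\<bar>w0 z\<bar> \<le> \<epsilon> / K" using small z by blast
        have b: "\<bar>R n (fst z)\<bar> \<le> (E * real n) * D"
          unfolding R_def abs_mult using E D z by (intro mult_mono) (auto simp: plate_iff)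
        have c: "\<bar>Q n (snd z)\<bar> \<le> \<bar>C\<bar>" using C[of "snd z" n] z by (auto simp: plate_iff)
        have "\<bar>w0 z\<bar> * (\<bar>R n (fst z)\<bar> * \<bar>Q n (snd z)\<bar>) \<le> (\<epsilon> / K) * ((E * real n * D) * \<bar>C\<bar>)"
          using a b c E D K \<open>\<epsilon> > 0\<close> by (intro mult_mono) auto
        then show ?thesis using S by (simp add: H_def abs_mult mult_ac)
      qed
      have iS: "integrable (plate_measure l) (\<lambda>z. H * indicator ?S z)"
      proof (rule bounded_plate_integrable[where C = H])
        show "(\<lambda>z. H * indicator ?S z) \<in> borel_measurable (plate_measure l)"
          by (intro borel_measurable_plate borel_measurable_times borel_measurable_const
              borel_measurable_indicator borel_closed closed_Collect_disj closed_Collect_le continuous_intros)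
      qed (use H in \<open>auto simp: indicator_def\<close>)
      have "\<bar>plate_int l w (R n) (Q n)\<bar> \<le> (LINT z|plate_measure l. \<bar>w z * (R n (fst z) * Q n (snd z))\<bar>)"
        unfolding plate_int_def by (rule integral_abs_bound)
      also have "\<dots> \<le> (LINT z|plate_measure l. H * indicator ?S z)"
      proof (rule integral_mono_AE)
        show "integrable (plate_measure l) (\<lambda>z. \<bar>w z * (R n (fst z) * Q n (snd z))\<bar>)"
          by (intro integrable_abs plate_int_integrable i sR sQ)
        show "AE z in plate_measure l. \<bar>w z * (R n (fst z) * Q n (snd z))\<bar> \<le> H * indicator ?S z"
        proof -
          have "AE z in plate_measure l. \<bar>w0 z * (R n (fst z) * Q n (snd z))\<bar> \<le> H * indicator ?S z"
            by (rule AE_plateI) (rule *)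
          with w0(2) show ?thesis by eventually_elim simp
        qed
      qed (rule iS)
      also have "\<dots> = H * (LINT z|plate_measure l. indicator ?S z)"
        by (rule integral_mult_right_zero)
      also have "\<dots> \<le> H * (4 * (2 / real n) * l)"
        using n0 H by (intro mult_left_mono plate_strip_measure l) auto
      also have "\<dots> = (E * D * \<bar>C\<bar> * 8 * l) * (\<epsilon> / K)"
        using n0 by (simp add: H_def field_simps)
      also have "\<dots> < K * (\<epsilon> / K)"
        using K \<open>\<epsilon> > 0\<close> by (intro mult_strict_right_mono) (auto simp: K_def)
      also have "\<dots> = \<epsilon>" using K by simp
      finally show ?thesis by simp
    qed
    then show "\<exists>no. \<forall>n\<ge>no. norm (plate_int l w (R n) (Q n) - 0) < \<epsilon>" by blast
  qed
  ultimately have "(\<lambda>n. plate_int l w (R n) (Q n) + plate_int l w (P1 n) (Q n)) \<longlonglongrightarrow> 0 + plate_int l w (deriv p) q"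
    by (intro tendsto_add)
  moreover have "plate_int l w (R n) (Q n) + plate_int l w (P1 n) (Q n) = plate_int l w (deriv (P n)) (Q n)" for n
  proof -
    have "deriv (P n) = (\<lambda>t. R n t + P1 n t)"
      unfolding P_def[abs_def] R_def P1_def using deriv_cutoff_mult[OF p] by blast
    then show ?thesis by (simp add: plate_int_add2[OF i(1) sR sQ sP1])
  qed
  moreover have "plate_int l w (deriv (P n)) (Q n) = - plate_int l w' (P n) (Q n)" for n
    using V test_fun_cutoff_mult[OF p(1), of 0 pi n] test_fun_cutoff_mult[OF q, of "-l" l n]
    unfolding x_deriv_pair_def P_def[abs_def] Q_def[abs_def] by blast
  moreover have "(\<lambda>n. - plate_int l w' (P n) (Q n)) \<longlonglongrightarrow> - plate_int l w' p q"
    by (intro tendsto_minus plate_int_tendsto[OF i(2)])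
      (auto intro!: sP sQ p q B C, auto simp: P_def Q_def intro!: cutoff_mult_tendsto)
  ultimately show ?thesis using LIMSEQ_unique by auto
qed

section \<open>Separable functions as test functions and as elements of the energy space\<close>

definition sep :: "(real \<Rightarrow> real) \<Rightarrow> (real \<Rightarrow> real) \<Rightarrow> real \<times> real \<Rightarrow> real" where
  "sep p q z = p (fst z) * q (snd z)"

lemma smooth_funpow_deriv: "smooth p \<Longrightarrow> smooth ((deriv ^^ k) p)"
  by (induction k) (auto intro: smooth_deriv)

lemma continuous_on_sep: "smooth p \<Longrightarrow> smooth q \<Longrightarrow> continuous_on A (sep p q)"
proof -
  assume "smooth p" "smooth q"
  note sm = this
  have "continuous_on A (\<lambda>z. p (fst z))"
    by (rule continuous_on_compose2[OF smooth_continuous_on[OF sm(1), of UNIV] continuous_on_fst[OF continuous_on_id]]) simp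
  moreover have "continuous_on A (\<lambda>z. q (snd z))"
    by (rule continuous_on_compose2[OF smooth_continuous_on[OF sm(2), of UNIV] continuous_on_snd[OF continuous_on_id]]) simp
  ultimately show ?thesis unfolding sep_def[abs_def] by (rule continuous_on_mult)
qed

lemma partial_x_sep:
  assumes "smooth p" shows "partial_x (sep p q) = sep (deriv p) q"
proof (rule ext, clarify)
  fix x y
  have "((\<lambda>t. p t * q y) has_real_derivative deriv p x * q y) (at x)"
    by (rule DERIV_cmult_right[OF smooth_has_deriv[OF assms]])
  then show "partial_x (sep p q) (x, y) = sep (deriv p) q (x, y)"
    by (simp add: partial_x_def sep_def DERIV_imp_deriv)
qed

lemma partial_y_sep:
  assumes "smooth q" shows "partial_y (sep p q) = sep p (deriv q)"
proof (rule ext, clarify)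
  fix x y
  have "((\<lambda>t. p x * q t) has_real_derivative p x * deriv q y) (at y)"
    by (rule DERIV_cmult[OF smooth_has_deriv[OF assms]])
  then show "partial_y (sep p q) (x, y) = sep p (deriv q) (x, y)"
    by (simp add: partial_y_def sep_def DERIV_imp_deriv)
qed

lemma funpow_partial_sep:
  assumes "smooth p" "smooth q"
  shows "(partial_x ^^ i) ((partial_y ^^ j) (sep p q)) = sep ((deriv ^^ i) p) ((deriv ^^ j) q)"
proof -
  have "(partial_y ^^ j) (sep p q) = sep p ((deriv ^^ j) q)"
    by (induction j) (auto simp: partial_y_sep smooth_funpow_deriv assms)
  moreover have "(partial_x ^^ i) (sep p r) = sep ((deriv ^^ i) p) r" for r
    by (induction i) (auto simp: partial_x_sep smooth_funpow_deriv assms)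
  ultimately show ?thesis by simp
qed

lemma C_k_sep: "smooth p \<Longrightarrow> smooth q \<Longrightarrow> C_k k (sep p q)"
proof (induction k arbitrary: p q)
  case 0
  then show ?case by (simp add: continuous_on_sep)
next
  case (Suc k)
  have "(\<lambda>t. sep p q (t, y)) differentiable (at x)" for x y
    using DERIV_cmult_right[OF smooth_has_deriv[OF Suc.prems(1)]]
    by (auto simp: sep_def real_differentiable_def)
  moreover have "(\<lambda>t. sep p q (x, t)) differentiable (at y)" for x y
    using DERIV_cmult[OF smooth_has_deriv[OF Suc.prems(2)]]
    by (auto simp: sep_def real_differentiable_def)
  ultimately show ?case using Suc
    by (simp add: continuous_on_sep partial_x_sep partial_y_sep smooth_deriv)
qed

lemma test_function_sep:
  assumes "test_fun 0 pi p" "test_fun (-l) l q"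
  shows "test_function (plate l) (sep p q)"
proof -
  obtain a b where ab: "0 < a" "b < pi" "\<And>t. p t \<noteq> 0 \<Longrightarrow> a \<le> t \<and> t \<le> b"
    using assms(1) unfolding test_fun_def by blast
  obtain c d where cd: "-l < c" "d < l" "\<And>t. q t \<noteq> 0 \<Longrightarrow> c \<le> t \<and> t \<le> d"
    using assms(2) unfolding test_fun_def by blast
  have "compact ({a..b} \<times> {c..d})" by (intro compact_Times) auto
  moreover have "{a..b} \<times> {c..d} \<subseteq> plate l" using ab cd by (auto simp: plate_iff)
  moreover have "sep p q z = 0" if "z \<notin> {a..b} \<times> {c..d}" for z
    using that ab(3)[of "fst z"] cd(3)[of "snd z"] by (cases z) (auto simp: sep_def)
  moreover have "smooth p" "smooth q" using assms unfolding test_fun_def by blast+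
  then have "\<forall>k. C_k k (sep p q)" by (intro allI C_k_sep)
  ultimately show ?thesis
    unfolding test_function_def by blast
qed

lemma weak_partial_sep_test:
  assumes w: "has_weak_partial (plate l) i j w g" and p: "test_fun 0 pi p" and q: "test_fun (-l) l q"
  shows "plate_int l w ((deriv ^^ i) p) ((deriv ^^ j) q) = (-1) ^ (i + j) * plate_int l g p q"
proof -
  have sm: "smooth p" "smooth q" using p q unfolding test_fun_def by blast+
  have "(LINT z|plate_measure l. w z * sep ((deriv ^^ i) p) ((deriv ^^ j) q) z)
      = (-1) ^ (i + j) * (LINT z|plate_measure l. g z * sep p q z)"
    using w test_function_sep[OF p q]
    unfolding has_weak_partial_def funpow_partial_sep[OF sm, symmetric] by blast
  then show ?thesis by (simp add: plate_int_def sep_def)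
qed

lemma test_fun_deriv:
  assumes "test_fun c d p" shows "test_fun c d (deriv p)"
proof -
  obtain a b where ab: "c < a" "b < d" "\<And>t. p t \<noteq> 0 \<Longrightarrow> a \<le> t \<and> t \<le> b"
    using assms unfolding test_fun_def by blast
  have "deriv p t = 0" if "\<not> (a \<le> t \<and> t \<le> b)" for t
  proof -
    have "t \<in> {..<a} \<union> {b<..}" using that by auto
    then have "eventually (\<lambda>s. s \<in> {..<a} \<union> {b<..}) (nhds t)"
      by (intro eventually_nhds_in_open) auto
    then have "eventually (\<lambda>s. p s = 0) (nhds t)"
      by eventually_elim (use ab(3) in fastforce)
    then show ?thesis by (subst deriv_cong_ev[where g = "\<lambda>_. 0"]) auto
  qed
  then show ?thesis using assms ab unfolding test_fun_def by (meson smooth_deriv)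
qed

subsection \<open>Integration by parts against arbitrary test functions\<close>

lemma test_function_partial:
  assumes \<phi>: "test_function \<Omega> \<phi>"
  shows "test_function \<Omega> (partial_x \<phi>)" "test_function \<Omega> (partial_y \<phi>)"
proof -
  obtain K where K: "compact K" "K \<subseteq> \<Omega>" "\<And>z. z \<notin> K \<Longrightarrow> \<phi> z = 0"
    using \<phi> unfolding test_function_def by blast
  have C: "C_k (Suc k) \<phi>" for k using \<phi> unfolding test_function_def by blast
  have open_slice: "open {t. (t, y) \<notin> K}" "open {t. (x, t) \<notin> K}" for x y :: real
  proof -
    have "open ((\<lambda>t. (t, y)) -` (- K))" "open ((\<lambda>t. (x, t)) -` (- K))"
      using K(1) by (auto intro!: open_vimage continuous_intros compact_imp_closed)
    then show "open {t. (t, y) \<notin> K}" "open {t. (x, t) \<notin> K}" by (simp_all add: vimage_def)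
  qed
  have "partial_x \<phi> (x, y) = 0 \<and> partial_y \<phi> (x, y) = 0" if "(x, y) \<notin> K" for x y
  proof -
    have "eventually (\<lambda>t. \<phi> (t, y) = 0) (nhds x)" "eventually (\<lambda>t. \<phi> (x, t) = 0) (nhds y)"
      using eventually_nhds_in_open[OF open_slice(1), of x y] eventually_nhds_in_open[OF open_slice(2), of y x] that
      by (auto elim!: eventually_mono simp: K(3))
    then show ?thesis
      by (simp add: partial_x_def partial_y_def deriv_cong_ev[where g = "\<lambda>_. 0"])
  qed
  then have "\<forall>z. z \<notin> K \<longrightarrow> partial_x \<phi> z = 0" "\<forall>z. z \<notin> K \<longrightarrow> partial_y \<phi> z = 0" by auto
  then show "test_function \<Omega> (partial_x \<phi>)" "test_function \<Omega> (partial_y \<phi>)"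
    using C K(1,2) unfolding test_function_def C_k.simps by blast+
qed

lemma test_functionD:
  assumes "test_function \<Omega> \<phi>"
  shows "continuous_on A \<phi>" "continuous_on A (partial_x \<phi>)" "continuous_on A (partial_y \<phi>)"
    "((\<lambda>t. \<phi> (t, y)) has_real_derivative partial_x \<phi> (x, y)) (at x)"
    "((\<lambda>t. \<phi> (x, t)) has_real_derivative partial_y \<phi> (x, y)) (at y)"
    "z \<notin> \<Omega> \<Longrightarrow> \<phi> z = 0"
proof -
  have "C_k (Suc 0) \<phi>" using assms unfolding test_function_def by blast
  then have *: "continuous_on UNIV \<phi>" "continuous_on UNIV (partial_x \<phi>)" "continuous_on UNIV (partial_y \<phi>)"
    "(\<lambda>t. \<phi> (t, y)) differentiable (at x)" "(\<lambda>t. \<phi> (x, t)) differentiable (at y)" by auto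
  then show "continuous_on A \<phi>" "continuous_on A (partial_x \<phi>)" "continuous_on A (partial_y \<phi>)"
    using continuous_on_subset by blast+
  show "((\<lambda>t. \<phi> (t, y)) has_real_derivative partial_x \<phi> (x, y)) (at x)"
    "((\<lambda>t. \<phi> (x, t)) has_real_derivative partial_y \<phi> (x, y)) (at y)"
    using *(4,5) by (simp_all add: partial_x_def partial_y_def DERIV_deriv_iff_real_differentiable)
  show "z \<notin> \<Omega> \<Longrightarrow> \<phi> z = 0" using assms unfolding test_function_def by blast
qed

lemma plate_integral_eq_lborel:
  assumes "continuous_on UNIV h" "\<And>z. z \<notin> plate l \<Longrightarrow> h z = 0"
  shows "(LINT z|plate_measure l. h z) = (LINT z|lborel. h z :: real)"
proof -
  have "(LINT z|plate_measure l. h z) = (LINT z|lebesgue. indicator (plate l) z *\<^sub>R h z)"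
    by (rule integral_restrict_space) auto
  also have "\<dots> = (LINT z|lebesgue. h z)"
    by (intro Bochner_Integration.integral_cong) (auto simp: assms(2) indicator_def)
  also have "\<dots> = (LINT z|lborel. h z)"
    by (rule integral_completion) (simp add: borel_measurable_continuous_onI[OF assms(1)])
  finally show ?thesis .
qed

lemma continuous_plate_integrable:
  assumes "continuous_on UNIV h" "\<And>z. z \<notin> plate l \<Longrightarrow> h z = 0"
  shows "integrable lborel (h :: _ \<Rightarrow> real)"
proof -
  have "integrable lborel (\<lambda>z. indicator (closure (plate l)) z *\<^sub>R h z)"
    using plate_bounded continuous_on_subset[OF assms(1)] by (intro borel_integrable_compact) (auto simp: compact_closure)
  moreover have "(\<lambda>z. indicator (closure (plate l)) z *\<^sub>R h z) = h"
    using assms(2) closure_subset[of "plate l"] by (auto simp: indicator_def fun_eq_iff)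
  ultimately show ?thesis by simp
qed

lemma integral_x_derivative_zero:
  assumes h: "continuous_on UNIV h" "\<And>z. z \<notin> plate l \<Longrightarrow> h z = 0"
    and F: "\<And>x y. ((\<lambda>t. F (t, y)) has_real_derivative h (x, y)) (at x)" "\<And>z. z \<notin> plate l \<Longrightarrow> F z = 0"
  shows "(LINT z|plate_measure l. h z) = (0 :: real)"
proof -
  have i: "integrable (lborel \<Otimes>\<^sub>M lborel) (\<lambda>(x, y). h (x, y))"
    using continuous_plate_integrable[OF h] by (simp add: lborel_prod)
  have "(LINT x|lborel. h (x, y)) = 0" for y
  proof -
    have "(LINT x|lborel. h (x, y)) = (LINT x|lborel. h (x, y) * indicator {0..pi} x)"
    proof (intro Bochner_Integration.integral_cong refl)
      show "h (x, y) = h (x, y) * indicator {0..pi} x" for x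
        using h(2)[of "(x, y)"] by (cases "x \<in> {0..pi}") (auto simp: plate_iff)
    qed
    also have "\<dots> = F (pi, y) - F (0, y)"
    proof (rule integral_FTC_Icc_real)
      show "continuous (at x) (\<lambda>x. h (x, y))" for x
      proof -
        have "continuous_on UNIV (\<lambda>x. h (x, y))"
          by (rule continuous_on_compose2[OF h(1)]) (auto intro!: continuous_intros)
        then show ?thesis by (simp add: continuous_on_eq_continuous_at)
      qed
    qed (use F(1) in auto)
    also have "\<dots> = 0" by (simp add: F(2) plate_iff)
    finally show ?thesis .
  qed
  then have "integral\<^sup>L (lborel \<Otimes>\<^sub>M lborel) (\<lambda>(x, y). h (x, y)) = 0"
    by (subst lborel_pair.integral_snd[OF i, symmetric]) simp
  then show ?thesis
    using plate_integral_eq_lborel[OF h] by (simp add: lborel_prod)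
qed

lemma integral_y_derivative_zero:
  assumes h: "continuous_on UNIV h" "\<And>z. z \<notin> plate l \<Longrightarrow> h z = 0" and l: "l > 0"
    and F: "\<And>x y. ((\<lambda>t. F (x, t)) has_real_derivative h (x, y)) (at y)" "\<And>z. z \<notin> plate l \<Longrightarrow> F z = 0"
  shows "(LINT z|plate_measure l. h z) = (0 :: real)"
proof -
  have i: "integrable (lborel \<Otimes>\<^sub>M lborel) (\<lambda>(x, y). h (x, y))"
    using continuous_plate_integrable[OF h] by (simp add: lborel_prod)
  have "(LINT y|lborel. h (x, y)) = 0" for x
  proof -
    have "(LINT y|lborel. h (x, y)) = (LINT y|lborel. h (x, y) * indicator {-l..l} y)"
    proof (intro Bochner_Integration.integral_cong refl)
      show "h (x, y) = h (x, y) * indicator {-l..l} y" for y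
        using h(2)[of "(x, y)"] by (cases "y \<in> {-l..l}") (auto simp: plate_iff)
    qed
    also have "\<dots> = F (x, l) - F (x, -l)"
    proof (rule integral_FTC_Icc_real)
      show "continuous (at y) (\<lambda>y. h (x, y))" for y
      proof -
        have "continuous_on UNIV (\<lambda>y. h (x, y))"
          by (rule continuous_on_compose2[OF h(1)]) (auto intro!: continuous_intros)
        then show ?thesis by (simp add: continuous_on_eq_continuous_at)
      qed
    qed (use F(1) l in auto)
    also have "\<dots> = 0" by (simp add: F(2) plate_iff)
    finally show ?thesis .
  qed
  then have "integral\<^sup>L (lborel \<Otimes>\<^sub>M lborel) (\<lambda>(x, y). h (x, y)) = 0"
    by (subst lborel_pair.integral_fst'[OF i, symmetric]) simp
  then show ?thesis
    using plate_integral_eq_lborel[OF h] by (simp add: lborel_prod)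
qed

lemma continuous_times_test_integrable:
  assumes "continuous_on UNIV h" "test_function (plate l) \<phi>"
  shows "integrable (plate_measure l) (\<lambda>z. h z * \<phi> z :: real)"
proof -
  have "continuous_on UNIV (\<lambda>z. h z * \<phi> z)"
    by (intro continuous_on_mult assms(1) test_functionD(1)[OF assms(2)])
  then have "integrable lborel (\<lambda>z. h z * \<phi> z)"
    by (rule continuous_plate_integrable[where l = l]) (simp add: test_functionD(6)[OF assms(2)])
  then have "integrable lebesgue (\<lambda>z. h z * \<phi> z)"
    by (subst integrable_completion) auto
  then show ?thesis
    by (subst integrable_restrict_space) (simp, rule integrable_mult_indicator[OF plate_lebesgue])
qed

lemma sep_parts_x:
  assumes p: "smooth p" and q: "smooth q" and \<phi>: "test_function (plate l) \<phi>"
  shows "(LINT z|plate_measure l. sep p q z * partial_x \<phi> z) = - (LINT z|plate_measure l. sep (deriv p) q z * \<phi> z)"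
proof -
  note \<phi>x = test_function_partial(1)[OF \<phi>]
  have "(LINT z|plate_measure l. sep (deriv p) q z * \<phi> z + sep p q z * partial_x \<phi> z) = 0"
  proof (rule integral_x_derivative_zero[where F = "\<lambda>z. sep p q z * \<phi> z"])
    show "continuous_on UNIV (\<lambda>z. sep (deriv p) q z * \<phi> z + sep p q z * partial_x \<phi> z)"
      by (intro continuous_on_add continuous_on_mult continuous_on_sep smooth_deriv p q test_functionD(1)[OF \<phi>] test_functionD(1)[OF \<phi>x])
    show "((\<lambda>t. sep p q (t, y) * \<phi> (t, y)) has_real_derivative
        sep (deriv p) q (x, y) * \<phi> (x, y) + sep p q (x, y) * partial_x \<phi> (x, y)) (at x)" for x y
      using DERIV_mult[OF DERIV_cmult_right[OF smooth_has_deriv[OF p], of "q y"] test_functionD(4)[OF \<phi>]]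
      by (simp add: sep_def mult_ac add_ac)
  qed (simp_all add: test_functionD(6)[OF \<phi>] test_functionD(6)[OF \<phi>x])
  then show ?thesis
    by (subst (asm) Bochner_Integration.integral_add)
      (auto intro!: continuous_times_test_integrable continuous_on_sep p q \<phi> \<phi>x smooth_deriv)
qed

lemma sep_parts_y:
  assumes p: "smooth p" and q: "smooth q" and \<phi>: "test_function (plate l) \<phi>" and l: "l > 0"
  shows "(LINT z|plate_measure l. sep p q z * partial_y \<phi> z) = - (LINT z|plate_measure l. sep p (deriv q) z * \<phi> z)"
proof -
  note \<phi>y = test_function_partial(2)[OF \<phi>]
  have "(LINT z|plate_measure l. sep p (deriv q) z * \<phi> z + sep p q z * partial_y \<phi> z) = 0"
  proof (rule integral_y_derivative_zero[where F = "\<lambda>z. sep p q z * \<phi> z"])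
    show "continuous_on UNIV (\<lambda>z. sep p (deriv q) z * \<phi> z + sep p q z * partial_y \<phi> z)"
      by (intro continuous_on_add continuous_on_mult continuous_on_sep smooth_deriv p q test_functionD(1)[OF \<phi>] test_functionD(1)[OF \<phi>y])
    show "((\<lambda>t. sep p q (x, t) * \<phi> (x, t)) has_real_derivative
        sep p (deriv q) (x, y) * \<phi> (x, y) + sep p q (x, y) * partial_y \<phi> (x, y)) (at y)" for x y
      using DERIV_mult[OF DERIV_cmult[OF smooth_has_deriv[OF q], of "p x"] test_functionD(5)[OF \<phi>]]
      by (simp add: sep_def mult_ac add_ac)
  qed (use l in \<open>simp_all add: test_functionD(6)[OF \<phi>] test_functionD(6)[OF \<phi>y]\<close>)
  then show ?thesis
    by (subst (asm) Bochner_Integration.integral_add)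
      (auto intro!: continuous_times_test_integrable continuous_on_sep p q \<phi> \<phi>y smooth_deriv)
qed

lemma test_function_funpow:
  "test_function \<Omega> \<phi> \<Longrightarrow> test_function \<Omega> ((partial_x ^^ i) \<phi>)"
  "test_function \<Omega> \<phi> \<Longrightarrow> test_function \<Omega> ((partial_y ^^ i) \<phi>)"
  by (induction i) (auto intro: test_function_partial)

text \<open>Partial derivatives of a test function are test functions, so the identity follows by moving
  one derivative at a time.\<close>

lemma sep_has_weak_partial:
  assumes p: "smooth p" and q: "smooth q" and l: "l > 0"
  shows "has_weak_partial (plate l) i j (sep p q) (sep ((deriv ^^ i) p) ((deriv ^^ j) q))"
proof -
  have y: "(LINT z|plate_measure l. sep p q z * (partial_y ^^ j) \<phi> z)
      = (-1) ^ j * (LINT z|plate_measure l. sep p ((deriv ^^ j) q) z * \<phi> z)"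
    if "test_function (plate l) \<phi>" "smooth p" "smooth q" for p q \<phi>
    using that(3)
  proof (induction j arbitrary: q)
    case (Suc j)
    have "(LINT z|plate_measure l. sep p q z * (partial_y ^^ Suc j) \<phi> z)
        = - (LINT z|plate_measure l. sep p (deriv q) z * (partial_y ^^ j) \<phi> z)"
      using sep_parts_y[OF that(2) Suc.prems test_function_funpow(2)[OF that(1)] l] by simp
    also have "\<dots> = (-1) ^ Suc j * (LINT z|plate_measure l. sep p ((deriv ^^ Suc j) q) z * \<phi> z)"
      using Suc.IH[OF smooth_deriv[OF Suc.prems]] by (simp add: funpow_swap1)
    finally show ?case .
  qed simp
  have x: "(LINT z|plate_measure l. sep p q z * (partial_x ^^ i) \<phi> z)
      = (-1) ^ i * (LINT z|plate_measure l. sep ((deriv ^^ i) p) q z * \<phi> z)"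
    if "test_function (plate l) \<phi>" "smooth p" "smooth q" for p q \<phi>
    using that(2)
  proof (induction i arbitrary: p)
    case (Suc i)
    have "(LINT z|plate_measure l. sep p q z * (partial_x ^^ Suc i) \<phi> z)
        = - (LINT z|plate_measure l. sep (deriv p) q z * (partial_x ^^ i) \<phi> z)"
      using sep_parts_x[OF Suc.prems that(3) test_function_funpow(1)[OF that(1)]] by simp
    also have "\<dots> = (-1) ^ Suc i * (LINT z|plate_measure l. sep ((deriv ^^ Suc i) p) q z * \<phi> z)"
      using Suc.IH[OF smooth_deriv[OF Suc.prems]] by (simp add: funpow_swap1)
    finally show ?case .
  qed simp
  show ?thesis unfolding has_weak_partial_def
    using x[OF test_function_funpow(2) p q] y[OF _ smooth_funpow_deriv[OF p] q]
    by (simp add: power_add)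
qed

section \<open>The Green identity for separable functions\<close>

lemma L2_on_integrable:
  assumes "L2_on (plate l) u" shows "integrable (plate_measure l) u"
proof (rule Bochner_Integration.integrable_bound)
  show "integrable (plate_measure l) (\<lambda>z. 1 + (u z)\<^sup>2)"
    using assms finite_measure.integrable_const[OF finite_measure_plate, of l "1::real"]
    by (auto simp: L2_on_def)
  show "u \<in> borel_measurable (plate_measure l)" using assms by (simp add: L2_on_def)
  have "\<bar>x\<bar> \<le> 1 + x\<^sup>2" for x :: real
    using zero_le_power2[of "\<bar>x\<bar> - 1"] by (simp add: power2_diff)
  then have "norm (u z) \<le> norm (1 + (u z)\<^sup>2)" for z
    using abs_of_nonneg[of "1 + (u z)\<^sup>2"] by simp
  then show "AE z in plate_measure l. norm (u z) \<le> norm (1 + (u z)\<^sup>2)" by simp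
qed

lemma L2_on_bounded:
  assumes "u \<in> borel_measurable (plate_measure l)" "\<And>z. z \<in> plate l \<Longrightarrow> \<bar>u z\<bar> \<le> C"
  shows "L2_on (plate l) u"
  unfolding L2_on_def
proof
  show "integrable (plate_measure l) (\<lambda>z. (u z)\<^sup>2)"
  proof (rule bounded_plate_integrable)
    show "\<bar>(u z)\<^sup>2\<bar> \<le> C\<^sup>2" if "z \<in> plate l" for z
      using power_mono[OF assms(2)[OF that], of 2] by simp
    show "(\<lambda>z. (u z)\<^sup>2) \<in> borel_measurable (plate_measure l)"
      by (rule borel_measurable_power[OF assms(1)])
  qed
qed (rule assms(1))

lemma L2_on_sep:
  assumes "smooth p" "smooth q" shows "L2_on (plate l) (sep p q)"
proof -
  obtain C where C: "C \<ge> 0" "\<And>t. t \<in> {0..pi} \<Longrightarrow> \<bar>p t\<bar> \<le> C"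
    using smooth_bounded_on[OF assms(1)] by blast
  obtain D where D: "D \<ge> 0" "\<And>t. t \<in> {-l..l} \<Longrightarrow> \<bar>q t\<bar> \<le> D"
    using smooth_bounded_on[OF assms(2)] by blast
  show ?thesis
  proof (rule L2_on_bounded)
    show "sep p q \<in> borel_measurable (plate_measure l)"
      unfolding sep_def[abs_def] by (rule smooth_prod_measurable[OF assms])
    show "\<bar>sep p q z\<bar> \<le> C * D" if "z \<in> plate l" for z
      unfolding sep_def abs_mult using that C D by (intro mult_mono) (auto simp: plate_iff)
  qed
qed

lemma plate_int_cong_AE:
  assumes "integrable (plate_measure l) V" "integrable (plate_measure l) W" "AE z in plate_measure l. V z = W z"
    "smooth p" "smooth q"
  shows "plate_int l V p q = plate_int l W p q"
  unfolding plate_int_def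
proof (rule integral_cong_AE)
  show "AE z in plate_measure l. V z * (p (fst z) * q (snd z)) = W z * (p (fst z) * q (snd z))"
    using assms(3) by eventually_elim simp
qed (use plate_int_integrable assms in blast)+

lemma plate_int_diff_left:
  assumes "integrable (plate_measure l) V" "integrable (plate_measure l) W" "smooth p" "smooth q"
  shows "plate_int l (\<lambda>z. V z - W z) p q = plate_int l V p q - plate_int l W p q"
  unfolding plate_int_def left_diff_distrib
  by (rule Bochner_Integration.integral_diff; rule plate_int_integrable; rule assms)

lemma plate_int_add_right:
  assumes "integrable (plate_measure l) W" "smooth p" "smooth q" "smooth r"
  shows "plate_int l W p (\<lambda>t. q t + r t) = plate_int l W p q + plate_int l W p r"
proof -
  have "plate_int l W p (\<lambda>t. q t + r t) =
      (LINT z|plate_measure l. W z * (p (fst z) * q (snd z)) + W z * (p (fst z) * r (snd z)))"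
    unfolding plate_int_def by (simp add: algebra_simps)
  also have "\<dots> = plate_int l W p q + plate_int l W p r"
    unfolding plate_int_def
    by (rule Bochner_Integration.integral_add; rule plate_int_integrable; rule assms)
  finally show ?thesis .
qed

lemma plate_int_cmult_right: "plate_int l W p (\<lambda>t. c * q t) = c * plate_int l W p q"
  unfolding plate_int_def
  by (subst integral_mult_right_zero[symmetric]) (simp add: mult_ac)

lemma plate_int_cmult_left: "plate_int l W (\<lambda>t. c * p t) q = c * plate_int l W p q"
  unfolding plate_int_def
  by (subst integral_mult_right_zero[symmetric]) (simp add: mult_ac)

lemma plate_int_lincomb_right:
  assumes "integrable (plate_measure l) W" "smooth p" "smooth q" "smooth r"
  shows "plate_int l W p (\<lambda>t. a * q t + b * r t) = a * plate_int l W p q + b * plate_int l W p r"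
  using plate_int_add_right[OF assms(1,2) smooth_mult[OF smooth_const assms(3)] smooth_mult[OF smooth_const assms(4)]]
  by (simp add: plate_int_cmult_right)

lemma weak_partial_unique:
  assumes "L2_on (plate l) g" "L2_on (plate l) h"
    "has_weak_partial (plate l) i j w g" "has_weak_partial (plate l) i j w h"
  shows "AE z in plate_measure l. g z = h z"
proof -
  have i: "integrable (plate_measure l) g" "integrable (plate_measure l) h"
    using assms(1,2) by (auto intro: L2_on_integrable)
  have "AE z in plate_measure l. g z - h z = 0"
  proof (rule plate_test_zero_imp_AE_zero)
    show "integrable (plate_measure l) (\<lambda>z. g z - h z)" using i by simp
    fix p q assume pq: "test_fun 0 pi p" "test_fun (-l) l q"
    then have sm: "smooth p" "smooth q" unfolding test_fun_def by blast+
    have "(-1) ^ (i + j) * plate_int l g p q = (-1) ^ (i + j) * plate_int l h p q"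
      using weak_partial_sep_test[OF assms(3) pq] weak_partial_sep_test[OF assms(4) pq] by simp
    then show "plate_int l (\<lambda>z. g z - h z) p q = 0"
      by (simp add: plate_int_diff_left[OF i sm])
  qed
  then show ?thesis by eventually_elim simp
qed

lemma weak_partial_props:
  assumes "H2_on (plate l) w" "i + j \<le> 2"
  shows "L2_on (plate l) (weak_partial (plate l) i j w)"
    "has_weak_partial (plate l) i j w (weak_partial (plate l) i j w)"
proof -
  have "\<exists>g. L2_on (plate l) g \<and> has_weak_partial (plate l) i j w g"
    using assms by (auto simp: H2_on_def)
  from someI_ex[OF this] show "L2_on (plate l) (weak_partial (plate l) i j w)"
    "has_weak_partial (plate l) i j w (weak_partial (plate l) i j w)"
    unfolding weak_partial_def by blast+
qed

lemma H2_on_sep: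
  assumes "smooth p" "smooth q" "l > 0" shows "H2_on (plate l) (sep p q)"
  unfolding H2_on_def using sep_has_weak_partial[OF assms] L2_on_sep
  by (meson assms smooth_funpow_deriv)

lemma weak_partial_sep:
  assumes "smooth p" "smooth q" "l > 0" "i + j \<le> 2"
  shows "AE z in plate_measure l. weak_partial (plate l) i j (sep p q) z = sep ((deriv ^^ i) p) ((deriv ^^ j) q) z"
  by (rule weak_partial_unique[OF _ _ weak_partial_props(2) sep_has_weak_partial])
    (use assms in \<open>auto intro!: weak_partial_props H2_on_sep L2_on_sep smooth_funpow_deriv\<close>)

lemma H2_star_sep:
  assumes "smooth p" "smooth q" "l > 0" "p 0 = 0" "p pi = 0"
  shows "H2_star l (sep p q)"
  unfolding H2_star_def
proof (intro conjI exI[of _ "sep p q"])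
  show "\<forall>z\<in>{0, pi} \<times> {-l<..<l}. sep p q z = 0" using assms(4,5) by (auto simp: sep_def)
qed (use assms in \<open>auto intro: H2_on_sep continuous_on_sep\<close>)

subsection \<open>The longitudinal modes\<close>

definition sine :: "nat \<Rightarrow> real \<Rightarrow> real" where "sine m x = sin (real m * x)"
definition cosine :: "nat \<Rightarrow> real \<Rightarrow> real" where "cosine m x = cos (real m * x)"

lemma sine_cosine_has_deriv:
  "(sine m has_real_derivative real m * cosine m x) (at x)"
  "(cosine m has_real_derivative - real m * sine m x) (at x)"
  unfolding sine_def[abs_def] cosine_def[abs_def]
  by (auto intro!: derivative_eq_intros)

lemma smooth_sine: "smooth (sine m)" and smooth_cosine: "smooth (cosine m)"
proof -
  define X where "X f \<longleftrightarrow> (\<exists>a b. f = (\<lambda>x. a * sine m x + b * cosine m x))" for f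
  have sm: "smooth f" if "X f" for f
    using that
  proof (rule smooth_coinduct[where X = X])
    fix f assume "X f"
    then obtain a b where f: "f = (\<lambda>x. a * sine m x + b * cosine m x)" unfolding X_def by blast
    have "(f has_real_derivative (- real m * b) * sine m x + (real m * a) * cosine m x) (at x)" for x
      unfolding f by (auto intro!: derivative_eq_intros sine_cosine_has_deriv)
    moreover have "X (\<lambda>x. (- real m * b) * sine m x + (real m * a) * cosine m x)"
      unfolding X_def by blast
    ultimately show "\<exists>g. (\<forall>t. (f has_real_derivative g t) (at t)) \<and> X g"
      by (intro exI[of _ "\<lambda>x. (- real m * b) * sine m x + (real m * a) * cosine m x"]) auto
  qed
  have "sine m = (\<lambda>x. 1 * sine m x + 0 * cosine m x)" "cosine m = (\<lambda>x. 0 * sine m x + 1 * cosine m x)" by auto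
  then have "X (sine m)" "X (cosine m)" unfolding X_def by blast+
  then show "smooth (sine m)" "smooth (cosine m)" by (auto intro: sm)
qed

lemma deriv_sine: "deriv (sine m) = (\<lambda>x. real m * cosine m x)"
  and deriv_cosine: "deriv (cosine m) = (\<lambda>x. - real m * sine m x)"
  using DERIV_imp_deriv[OF sine_cosine_has_deriv(1)] DERIV_imp_deriv[OF sine_cosine_has_deriv(2)] by auto

lemma sine_0: "sine m 0 = 0" and sine_pi: "sine m pi = 0"
  by (simp_all add: sine_def)

lemma tower_funpow_deriv: "tower F \<Longrightarrow> (deriv ^^ k) (F j) = F (k + j)"
  by (induction k) (auto simp: tower_deriv)

text \<open>The conditions \<open>u\<^sub>y\<^sub>y + \<nu> u\<^sub>x\<^sub>x = 0\<close> and \<open>u\<^sub>y\<^sub>y\<^sub>y + (2 - \<nu>) u\<^sub>x\<^sub>x\<^sub>y = 0\<close> for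
  \<open>u = F 0 (y) sin (m x)\<close> and \<open>M = m\<^sup>2\<close>.\<close>

definition free_edge :: "real \<Rightarrow> real \<Rightarrow> (nat \<Rightarrow> real \<Rightarrow> real) \<Rightarrow> real \<Rightarrow> bool" where
  "free_edge \<nu> M F y \<longleftrightarrow> F 2 y = \<nu> * M * F 0 y \<and> F 3 y = (2 - \<nu>) * M * F 1 y"

text \<open>Moving all derivatives to the smooth factor: in \<open>y\<close> direction the boundary terms cancel by the
  free edge conditions, in \<open>x\<close> direction by the hinge. Only first derivatives of \<open>w\<close> ever have to
  be integrated by parts against functions that do not vanish on the short edges; there the trace
  of \<open>w\<close> itself is used.\<close>

lemma plate_form_mode:
  assumes l: "l > 0" and F: "tower F" and w: "H2_star l w"
    and bc: "free_edge \<nu> ((real m)\<^sup>2) F l" "free_edge \<nu> ((real m)\<^sup>2) F (-l)"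
  shows "plate_form l \<nu> \<kappa> (sep (sine m) (F 0)) w =
    plate_int l w (sine m) (\<lambda>y. F 4 y - 2 * (real m)\<^sup>2 * F 2 y + (1 + \<kappa>) * real m ^ 4 * F 0 y)"
proof -
  define W where "W i j = weak_partial (plate l) i j w" for i j
  have H2: "H2_on (plate l) w" using w by (simp add: H2_star_def)
  obtain w0 where w0: "continuous_on (closure (plate l)) w0" "AE z in plate_measure l. w z = w0 z"
      "\<And>z. z \<in> {0, pi} \<times> {-l<..<l} \<Longrightarrow> w0 z = 0"
    using w unfolding H2_star_def by blast
  have WL: "L2_on (plate l) (W i j)" "has_weak_partial (plate l) i j w (W i j)" if "i + j \<le> 2" for i j
    using weak_partial_props[OF H2 that] by (simp_all add: W_def)
  have Wi: "integrable (plate_measure l) (W i j)" if "i + j \<le> 2" for i j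
    using L2_on_integrable WL(1)[OF that] by blast
  have wi: "integrable (plate_measure l) w" using H2 by (auto simp: H2_on_def intro: L2_on_integrable)
  have t: "plate_int l w ((deriv ^^ i) p) ((deriv ^^ j) q) = (-1) ^ (i + j) * plate_int l (W i j) p q"
    if "test_fun 0 pi p" "test_fun (-l) l q" "i + j \<le> 2" for i j p q
    using weak_partial_sep_test[OF WL(2)] that by blast
  have x1: "x_deriv_pair l w (W 1 0)"
    unfolding x_deriv_pair_def using t[of _ _ 1 0] wi Wi by simp
  have x2: "x_deriv_pair l (W 1 0) (W 2 0)"
    unfolding x_deriv_pair_def
  proof (intro conjI allI impI)
    fix p q assume pq: "test_fun 0 pi p" "test_fun (-l) l q"
    show "plate_int l (W 1 0) (deriv p) q = - plate_int l (W 2 0) p q"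
      using t[OF test_fun_deriv[OF pq(1)] pq(2), of 1 0] t[OF pq, of 2 0] by (simp add: numeral_2_eq_2)
  qed (simp_all add: Wi)
  have y1: "y_deriv_pair l w (W 0 1)"
    unfolding y_deriv_pair_def using t[of _ _ 0 1] wi Wi by simp
  have y2: "y_deriv_pair l (W 0 1) (W 0 2)"
    unfolding y_deriv_pair_def
  proof (intro conjI allI impI)
    fix p q assume pq: "test_fun 0 pi p" "test_fun (-l) l q"
    show "plate_int l (W 0 1) p (deriv q) = - plate_int l (W 0 2) p q"
      using t[OF pq(1) test_fun_deriv[OF pq(2)], of 0 1] t[OF pq, of 0 2] by (simp add: numeral_2_eq_2)
  qed (simp_all add: Wi)
  have y3: "y_deriv_pair l (W 1 0) (W 1 1)"
    unfolding y_deriv_pair_def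
  proof (intro conjI allI impI)
    fix p q assume pq: "test_fun 0 pi p" "test_fun (-l) l q"
    show "plate_int l (W 1 0) p (deriv q) = - plate_int l (W 1 1) p q"
      using t[OF pq(1) test_fun_deriv[OF pq(2)], of 1 0] t[OF pq, of 1 1] by (simp add: numeral_2_eq_2)
  qed (simp_all add: Wi)
  have trace: "plate_int l w (deriv p) q = - plate_int l (W 1 0) p q" if "smooth p" "smooth q" for p q
    by (rule x_deriv_pair_trace[OF x1 l w0(1,2) _ that]) (rule w0(3))
  have I20: "plate_int l (W 2 0) (sine m) q = - (real m)\<^sup>2 * plate_int l w (sine m) q" if q: "smooth q" for q
  proof -
    have "plate_int l (W 2 0) (sine m) q = - (real m * plate_int l (W 1 0) (cosine m) q)"
      using x_deriv_pair_vanishing[OF x2 smooth_sine sine_0 sine_pi q, of m]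
      by (simp add: deriv_sine plate_int_cmult_left)
    also have "plate_int l (W 1 0) (cosine m) q = real m * plate_int l w (sine m) q"
      using trace[OF smooth_cosine q, of m] plate_int_cmult_left[of l w "- real m" "sine m" q] by (simp add: deriv_cosine)
    finally show ?thesis by (simp add: power2_eq_square)
  qed
  have I10: "plate_int l (W 1 0) (cosine m) q = real m * plate_int l w (sine m) q" if q: "smooth q" for q
    using trace[OF smooth_cosine q, of m] plate_int_cmult_left[of l w "- real m" "sine m" q] by (simp add: deriv_cosine)
  have I11: "plate_int l (W 1 1) (cosine m) q = real m * plate_int l (W 0 1) (sine m) q" if q: "smooth q" for q
  proof -
    \<comment> \<open>both sides are limits along cutoffs of \<open>q\<close>, for which the boundary terms in \<open>y\<close> are absent\<close>
    define Q where "Q n t = cutoff (-l) l n t * q t" for n t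
    obtain C where C: "\<And>n t. t \<in> {-l<..<l} \<Longrightarrow> \<bar>Q n t\<bar> \<le> C"
      using cutoff_mult_bounded[OF q, of "-l" l] unfolding Q_def by blast
    have sQ: "smooth (Q n)" for n unfolding Q_def[abs_def] by (rule smooth_cutoff_mult[OF q])
    have Q0: "Q n (-l) = 0" "Q n l = 0" for n by (simp_all add: Q_def cutoff_outside)
    have eq: "plate_int l (W 1 1) (cosine m) (Q n) = real m * plate_int l (W 0 1) (sine m) (Q n)" for n
      using y_deriv_pair_vanishing[OF y3 l sQ Q0 smooth_cosine, of m n]
        y_deriv_pair_vanishing[OF y1 l sQ Q0 smooth_sine, of m n]
        I10[OF smooth_deriv[OF sQ], of n] by simp
    have lim: "(\<lambda>n. plate_int l V p (Q n)) \<longlonglongrightarrow> plate_int l V p q"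
      if V: "integrable (plate_measure l) V" and p: "smooth p" for V p
    proof -
      obtain B where B: "\<And>t. t \<in> {0..pi} \<Longrightarrow> \<bar>p t\<bar> \<le> B" using smooth_bounded_on[OF p] by blast
      show ?thesis
        by (rule plate_int_tendsto[OF V, where C = B and D = C])
          (auto intro!: sQ p q B C, auto simp: Q_def intro!: cutoff_mult_tendsto)
    qed
    have "(\<lambda>n. plate_int l (W 1 1) (cosine m) (Q n)) \<longlonglongrightarrow> plate_int l (W 1 1) (cosine m) q"
      by (rule lim[OF Wi smooth_cosine]) simp
    moreover have "(\<lambda>n. plate_int l (W 1 1) (cosine m) (Q n)) \<longlonglongrightarrow> real m * plate_int l (W 0 1) (sine m) q"
      unfolding eq by (intro tendsto_mult_left lim[OF Wi smooth_sine]) simp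
    ultimately show ?thesis by (rule LIMSEQ_unique)
  qed
  define M where "M = (real m)\<^sup>2"
  have M4: "real m ^ 4 = M * M" by (simp add: M_def power2_eq_square power4_eq_xxxx)
  note sF = tower_smooth[OF F] and dF = tower_has_deriv[OF F]
  have lin: "smooth (\<lambda>t. a * F i t + b * F j t)" for a b i j
    by (intro smooth_add smooth_mult smooth_const sF)
  have dlin: "deriv (\<lambda>t. a * F i t + b * F j t) = (\<lambda>t. a * F (Suc i) t + b * F (Suc j) t)" for a b i j
    by (rule ext, rule DERIV_imp_deriv, intro DERIV_add DERIV_cmult dF)
  have I02: "plate_int l (W 0 2) (sine m) (\<lambda>t. 1 * F 2 t + (- \<nu> * M) * F 0 t)
      = - plate_int l (W 0 1) (sine m) (\<lambda>t. 1 * F 3 t + (- \<nu> * M) * F 1 t)"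
  proof -
    have "deriv (\<lambda>t. 1 * F 2 t + (- \<nu> * M) * F 0 t) = (\<lambda>t. 1 * F 3 t + (- \<nu> * M) * F 1 t)"
      unfolding dlin by simp
    moreover have "plate_int l (W 0 1) (sine m) (deriv (\<lambda>t. 1 * F 2 t + (- \<nu> * M) * F 0 t))
        = - plate_int l (W 0 2) (sine m) (\<lambda>t. 1 * F 2 t + (- \<nu> * M) * F 0 t)"
      by (rule y_deriv_pair_vanishing[OF y2 l lin _ _ smooth_sine])
        (use bc in \<open>simp_all add: free_edge_def M_def\<close>)
    ultimately show ?thesis by simp
  qed
  have I01: "plate_int l (W 0 1) (sine m) (\<lambda>t. ((2 - \<nu>) * M) * F 1 t + (-1) * F 3 t)
      = - plate_int l w (sine m) (\<lambda>t. ((2 - \<nu>) * M) * F 2 t + (-1) * F 4 t)"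
  proof -
    have "deriv (\<lambda>t. ((2 - \<nu>) * M) * F 1 t + (-1) * F 3 t) = (\<lambda>t. ((2 - \<nu>) * M) * F 2 t + (-1) * F 4 t)"
      unfolding dlin by (simp add: numeral_2_eq_2 numeral_3_eq_3 eval_nat_numeral)
    moreover have "plate_int l w (sine m) (deriv (\<lambda>t. ((2 - \<nu>) * M) * F 1 t + (-1) * F 3 t))
        = - plate_int l (W 0 1) (sine m) (\<lambda>t. ((2 - \<nu>) * M) * F 1 t + (-1) * F 3 t)"
      by (rule y_deriv_pair_vanishing[OF y1 l lin _ _ smooth_sine])
        (use bc in \<open>simp_all add: free_edge_def M_def\<close>)
    ultimately show ?thesis by simp
  qed
  define A where "A t = (- (1 + \<kappa>) * M) * F 0 t + \<nu> * F 2 t" for t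
  have sA: "smooth A" unfolding A_def[abs_def] by (rule lin)
  have s2: "deriv (deriv (sine m)) = (\<lambda>x. - M * sine m x)"
  proof
    show "deriv (deriv (sine m)) x = - M * sine m x" for x
      unfolding deriv_sine using DERIV_cmult[OF sine_cosine_has_deriv(2), of "real m" m x]
      by (intro DERIV_imp_deriv) (simp add: M_def power2_eq_square mult.assoc)
  qed
  have "plate_form l \<nu> \<kappa> (sep (sine m) (F 0)) w =
    (LINT z|plate_measure l. W 2 0 z * (sine m (fst z) * A (snd z))
      + W 1 1 z * (cosine m (fst z) * (2 * (1 - \<nu>) * real m * F 1 (snd z)))
      + W 0 2 z * (sine m (fst z) * (1 * F 2 (snd z) + (- \<nu> * M) * F 0 (snd z))))"
    unfolding plate_form_def Let_def
  proof (rule integral_cong_AE)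
    let ?D = "weak_partial (plate l)"
    have "AE z in plate_measure l. ?D 2 0 (sep (sine m) (F 0)) z = - M * sine m (fst z) * F 0 (snd z)"
      using weak_partial_sep[OF smooth_sine sF l, of 2 0 m 0] by (simp add: sep_def s2 numeral_2_eq_2)
    moreover have "AE z in plate_measure l. ?D 0 2 (sep (sine m) (F 0)) z = sine m (fst z) * F 2 (snd z)"
      using weak_partial_sep[OF smooth_sine sF l, of 0 2 m 0] by (simp add: sep_def tower_funpow_deriv[OF F])
    moreover have "AE z in plate_measure l. ?D 1 1 (sep (sine m) (F 0)) z = real m * cosine m (fst z) * F 1 (snd z)"
      using weak_partial_sep[OF smooth_sine sF l, of 1 1 m 0] by (simp add: sep_def deriv_sine tower_deriv[OF F])
    ultimately show "AE z in plate_measure l.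
        \<nu> * ((?D 2 0 (sep (sine m) (F 0)) z + ?D 0 2 (sep (sine m) (F 0)) z) * (?D 2 0 w z + ?D 0 2 w z))
        + (1 - \<nu>) * (?D 2 0 (sep (sine m) (F 0)) z * ?D 2 0 w z + 2 * (?D 1 1 (sep (sine m) (F 0)) z * ?D 1 1 w z)
           + ?D 0 2 (sep (sine m) (F 0)) z * ?D 0 2 w z)
        + \<kappa> * (?D 2 0 (sep (sine m) (F 0)) z * ?D 2 0 w z) =
        W 2 0 z * (sine m (fst z) * A (snd z))
      + W 1 1 z * (cosine m (fst z) * (2 * (1 - \<nu>) * real m * F 1 (snd z)))
      + W 0 2 z * (sine m (fst z) * (1 * F 2 (snd z) + (- \<nu> * M) * F 0 (snd z)))"
      by eventually_elim (simp add: A_def W_def algebra_simps)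
    have m: "weak_partial (plate l) i j v \<in> borel_measurable (plate_measure l)" if "H2_on (plate l) v" "i + j \<le> 2" for i j v
      using weak_partial_props(1)[OF that] by (simp add: L2_on_def)
    have m1: "?D i j w \<in> borel_measurable (plate_measure l)" "?D i j (sep (sine m) (F 0)) \<in> borel_measurable (plate_measure l)"
      if "i + j \<le> 2" for i j
      using m[OF H2 that] m[OF H2_on_sep[OF smooth_sine sF l] that] by auto
    show "(\<lambda>z. \<nu> * ((?D 2 0 (sep (sine m) (F 0)) z + ?D 0 2 (sep (sine m) (F 0)) z) * (?D 2 0 w z + ?D 0 2 w z))
        + (1 - \<nu>) * (?D 2 0 (sep (sine m) (F 0)) z * ?D 2 0 w z + 2 * (?D 1 1 (sep (sine m) (F 0)) z * ?D 1 1 w z)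
           + ?D 0 2 (sep (sine m) (F 0)) z * ?D 0 2 w z)
        + \<kappa> * (?D 2 0 (sep (sine m) (F 0)) z * ?D 2 0 w z)) \<in> borel_measurable (plate_measure l)"
      by (intro borel_measurable_add borel_measurable_times borel_measurable_const m1) simp_all
    show "(\<lambda>z. W 2 0 z * (sine m (fst z) * A (snd z))
      + W 1 1 z * (cosine m (fst z) * (2 * (1 - \<nu>) * real m * F 1 (snd z)))
      + W 0 2 z * (sine m (fst z) * (1 * F 2 (snd z) + (- \<nu> * M) * F 0 (snd z)))) \<in> borel_measurable (plate_measure l)"
      by (intro borel_measurable_add borel_measurable_times borel_measurable_const
          borel_measurable_plate[OF smooth_fst_borel] borel_measurable_plate[OF smooth_snd_borel]
          smooth_sine smooth_cosine sA sF m1[folded W_def]) simp_all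
  qed
  also have "\<dots> = plate_int l (W 2 0) (sine m) A + plate_int l (W 1 1) (cosine m) (\<lambda>t. (2 * (1 - \<nu>) * real m) * F 1 t)
      + plate_int l (W 0 2) (sine m) (\<lambda>t. 1 * F 2 t + (- \<nu> * M) * F 0 t)"
  proof -
    have i1: "integrable (plate_measure l) (\<lambda>z. W 2 0 z * (sine m (fst z) * A (snd z)))"
      by (intro plate_int_integrable Wi smooth_sine sA) simp
    have i2: "integrable (plate_measure l) (\<lambda>z. W 1 1 z * (cosine m (fst z) * (2 * (1 - \<nu>) * real m * F 1 (snd z))))"
      by (rule plate_int_integrable[OF Wi smooth_cosine smooth_mult[OF smooth_const sF]]) simp
    have i3: "integrable (plate_measure l) (\<lambda>z. W 0 2 z * (sine m (fst z) * (1 * F 2 (snd z) + (- \<nu> * M) * F 0 (snd z))))"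
      by (rule plate_int_integrable[OF Wi smooth_sine lin]) simp
    show ?thesis unfolding plate_int_def
      by (simp only: Bochner_Integration.integral_add[OF Bochner_Integration.integrable_add[OF i1 i2] i3]
          Bochner_Integration.integral_add[OF i1 i2])
  qed
  also have "plate_int l (W 1 1) (cosine m) (\<lambda>t. (2 * (1 - \<nu>) * real m) * F 1 t) =
      2 * (1 - \<nu>) * M * plate_int l (W 0 1) (sine m) (F 1)"
    unfolding plate_int_cmult_right I11[OF sF] by (simp add: M_def power2_eq_square)
  also have "plate_int l (W 2 0) (sine m) A = - M * plate_int l w (sine m) A"
    by (simp add: I20[OF sA] M_def)
  also have "- M * plate_int l w (sine m) A + 2 * (1 - \<nu>) * M * plate_int l (W 0 1) (sine m) (F 1)
      + plate_int l (W 0 2) (sine m) (\<lambda>t. 1 * F 2 t + (- \<nu> * M) * F 0 t)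
    = - M * plate_int l w (sine m) A + plate_int l (W 0 1) (sine m) (\<lambda>t. ((2 - \<nu>) * M) * F 1 t + (-1) * F 3 t)"
  proof -
    have add: "plate_int l (W 0 1) (sine m) (\<lambda>t. a * F i t + b * F j t)
        = a * plate_int l (W 0 1) (sine m) (F i) + b * plate_int l (W 0 1) (sine m) (F j)" for a b i j
      by (rule plate_int_lincomb_right[OF Wi smooth_sine sF sF]) simp
    show ?thesis unfolding I02 add by (simp add: algebra_simps)
  qed
  also have "\<dots> = plate_int l w (sine m) (\<lambda>y. F 4 y - 2 * (real m)\<^sup>2 * F 2 y + (1 + \<kappa>) * real m ^ 4 * F 0 y)"
  proof -
    have "- M * plate_int l w (sine m) A + - plate_int l w (sine m) (\<lambda>t. ((2 - \<nu>) * M) * F 2 t + (-1) * F 4 t)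
       = plate_int l w (sine m) (\<lambda>t. (- M) * A t + (-1) * (((2 - \<nu>) * M) * F 2 t + (-1) * F 4 t))"
      unfolding plate_int_lincomb_right[OF wi smooth_sine sA lin] by simp
    also have "(\<lambda>t. (- M) * A t + (-1) * (((2 - \<nu>) * M) * F 2 t + (-1) * F 4 t)) =
        (\<lambda>y. F 4 y - 2 * (real m)\<^sup>2 * F 2 y + (1 + \<kappa>) * real m ^ 4 * F 0 y)"
      by (rule ext) (simp add: A_def M4 M_def[symmetric] algebra_simps)
    finally show ?thesis unfolding I01 .
  qed
  finally show ?thesis .
qed

section \<open>The transverse boundary value problem\<close>

text \<open>The equation \<open>(d\<^sup>2/dy\<^sup>2 - M)\<^sup>2 F = \<rho> F + f\<close>, where \<open>M = m\<^sup>2\<close> and \<open>\<rho> = \<mu> - \<kappa> m\<^sup>4\<close>.\<close>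

definition mode_ode :: "real \<Rightarrow> real \<Rightarrow> (real \<Rightarrow> real) \<Rightarrow> (nat \<Rightarrow> real \<Rightarrow> real) \<Rightarrow> bool" where
  "mode_ode M \<rho> f F \<longleftrightarrow> tower F \<and> (\<forall>y. F 4 y - 2 * M * F 2 y + (M\<^sup>2 - \<rho>) * F 0 y = f y)"

lemma mode_odeD:
  assumes "mode_ode M \<rho> f F"
  shows "tower F" "F 4 y = f y + 2 * M * F 2 y - (M\<^sup>2 - \<rho>) * F 0 y"
    "(F 0 has_real_derivative F 1 y) (at y)" "(F 1 has_real_derivative F 2 y) (at y)"
    "(F 2 has_real_derivative F 3 y) (at y)" "(F 3 has_real_derivative F 4 y) (at y)"
proof -
  show t: "tower F" using assms by (simp add: mode_ode_def)
  have "F 4 y - 2 * M * F 2 y + (M\<^sup>2 - \<rho>) * F 0 y = f y" using assms by (simp add: mode_ode_def)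
  then show "F 4 y = f y + 2 * M * F 2 y - (M\<^sup>2 - \<rho>) * F 0 y" by (simp add: algebra_simps)
  show "(F 0 has_real_derivative F 1 y) (at y)" "(F 1 has_real_derivative F 2 y) (at y)"
    "(F 2 has_real_derivative F 3 y) (at y)" "(F 3 has_real_derivative F 4 y) (at y)"
    using tower_has_deriv[OF t, of 0 y] tower_has_deriv[OF t, of 1 y] tower_has_deriv[OF t, of 2 y]
      tower_has_deriv[OF t, of 3 y] by (simp_all add: eval_nat_numeral)
qed

lemma tower_lincomb: "tower F \<Longrightarrow> tower G \<Longrightarrow> tower (\<lambda>k y. a * F k y + b * G k y)"
  unfolding tower_def by (intro allI DERIV_add DERIV_cmult) auto

lemma mode_ode_lincomb:
  assumes "mode_ode M \<rho> f F" "mode_ode M \<rho> g G"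
  shows "mode_ode M \<rho> (\<lambda>y. a * f y + b * g y) (\<lambda>k y. a * F k y + b * G k y)"
  unfolding mode_ode_def
proof (intro conjI allI)
  show "tower (\<lambda>k y. a * F k y + b * G k y)"
    by (intro tower_lincomb mode_odeD(1)[OF assms(1)] mode_odeD(1)[OF assms(2)])
  show "a * F 4 y + b * G 4 y - 2 * M * (a * F 2 y + b * G 2 y) + (M\<^sup>2 - \<rho>) * (a * F 0 y + b * G 0 y)
      = a * f y + b * g y" for y
    unfolding mode_odeD(2)[OF assms(1)] mode_odeD(2)[OF assms(2)] by (simp add: algebra_simps)
qed

lemma free_edge_lincomb:
  assumes "free_edge \<nu> M F y" "free_edge \<nu> M G y"
  shows "free_edge \<nu> M (\<lambda>k y. a * F k y + b * G k y) y"
proof -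
  have e: "F 2 y = \<nu> * M * F 0 y" "F 3 y = (2 - \<nu>) * M * F 1 y"
    "G 2 y = \<nu> * M * G 0 y" "G 3 y = (2 - \<nu>) * M * G 1 y"
    using assms by (auto simp: free_edge_def)
  show ?thesis unfolding free_edge_def e by (simp add: algebra_simps)
qed

subsection \<open>Solutions by power series\<close>

text \<open>In this normalisation of the coefficients, differentiation is a shift.\<close>

definition exp_series :: "(nat \<Rightarrow> real) \<Rightarrow> real \<Rightarrow> real" where
  "exp_series b t = (\<Sum>n. b n / fact n * t ^ n)"

lemma exp_type_summable:
  assumes b: "\<And>n. \<bar>b n\<bar> \<le> C * R ^ n"
  shows "summable (\<lambda>n. b n / fact n * t ^ n :: real)"
proof (rule summable_comparison_test')
  show "summable (\<lambda>n. C * ((R * \<bar>t\<bar>) ^ n / fact n))"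
    using summable_exp[of "R * \<bar>t\<bar>"] by (intro summable_mult) (simp add: divide_inverse mult.commute)
  fix n :: nat
  have "norm (b n / fact n * t ^ n) = \<bar>b n\<bar> * (\<bar>t\<bar> ^ n / fact n)"
    by (simp add: abs_mult power_abs)
  also have "\<dots> \<le> (C * R ^ n) * (\<bar>t\<bar> ^ n / fact n)"
    by (intro mult_right_mono b) auto
  finally show "norm (b n / fact n * t ^ n) \<le> C * ((R * \<bar>t\<bar>) ^ n / fact n)"
    by (simp add: power_mult_distrib)
qed

lemma exp_series_tower:
  assumes b: "\<And>n. \<bar>b n\<bar> \<le> C * R ^ n"
  shows "tower (\<lambda>k t. exp_series (\<lambda>n. b (n + k)) (t - t0))"
  unfolding tower_def
proof (intro allI)
  fix k t
  have b': "\<bar>b (n + k)\<bar> \<le> (C * R ^ k) * R ^ n" for n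
    using b[of "n + k"] by (simp add: power_add mult_ac)
  have "((\<lambda>x. \<Sum>n. b (n + k) / fact n * x ^ n) has_field_derivative
      (\<Sum>n. diffs (\<lambda>n. b (n + k) / fact n) n * x ^ n)) (at x)" for x
    by (rule termdiffs_strong_converges_everywhere) (rule exp_type_summable[OF b'])
  moreover have "diffs (\<lambda>n. b (n + k) / fact n) = (\<lambda>n. b (n + Suc k) / fact n)"
    by (rule ext) (simp add: diffs_def field_simps del: of_nat_Suc)
  ultimately have "(exp_series (\<lambda>n. b (n + k)) has_real_derivative exp_series (\<lambda>n. b (n + Suc k)) x) (at x)" for x
    unfolding exp_series_def[abs_def] by simp
  moreover have "((\<lambda>t. t - t0) has_real_derivative 1) (at t)" by (auto intro!: derivative_eq_intros)
  ultimately have "((\<lambda>t. exp_series (\<lambda>n. b (n + k)) (t - t0)) has_real_derivative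
      exp_series (\<lambda>n. b (n + Suc k)) (t - t0) * 1) (at t)"
    by (rule DERIV_chain2[where f = "exp_series (\<lambda>n. b (n + k))" and g = "\<lambda>t. t - t0"])
  then show "((\<lambda>t. exp_series (\<lambda>n. b (n + k)) (t - t0)) has_real_derivative exp_series (\<lambda>n. b (n + Suc k)) (t - t0)) (at t)"
    by simp
qed

lemma exp_series_0: "exp_series b 0 = b 0"
  unfolding exp_series_def by (subst powser_zero) simp

fun ode_coeff :: "real \<Rightarrow> real \<Rightarrow> (nat \<Rightarrow> real) \<Rightarrow> (nat \<Rightarrow> real) \<Rightarrow> nat \<Rightarrow> real" where
  "ode_coeff p q b d 0 = b 0"
| "ode_coeff p q b d (Suc 0) = b 1"
| "ode_coeff p q b d (Suc (Suc 0)) = b 2"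
| "ode_coeff p q b d (Suc (Suc (Suc 0))) = b 3"
| "ode_coeff p q b d (Suc (Suc (Suc (Suc n)))) =
    p * ode_coeff p q b d (Suc (Suc n)) + q * ode_coeff p q b d n + d n"

lemma ode_coeff_bound:
  assumes d: "\<And>n. \<bar>d n\<bar> \<le> D"
  shows "\<bar>ode_coeff p q b d n\<bar> \<le> (\<bar>b 0\<bar> + \<bar>b 1\<bar> + \<bar>b 2\<bar> + \<bar>b 3\<bar> + D) * (1 + \<bar>p\<bar> + \<bar>q\<bar>) ^ n"
proof -
  define C where "C = \<bar>b 0\<bar> + \<bar>b 1\<bar> + \<bar>b 2\<bar> + \<bar>b 3\<bar> + D"
  define R where "R = 1 + \<bar>p\<bar> + \<bar>q\<bar>"
  have D: "D \<ge> 0" using d[of 0] by linarith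
  have C: "C \<ge> 0" "\<bar>b 0\<bar> \<le> C" "\<bar>b 1\<bar> \<le> C" "\<bar>b 2\<bar> \<le> C" "\<bar>b 3\<bar> \<le> C" "D \<le> C"
    using D by (auto simp: C_def)
  have R: "R \<ge> 1" by (simp add: R_def)
  have base: "\<bar>x\<bar> \<le> C * R ^ n" if "\<bar>x\<bar> \<le> C" for x n
    using mult_mono[OF that one_le_power[OF R, of n] C(1)] by simp
  have "\<bar>ode_coeff p q b d n\<bar> \<le> C * R ^ n"
  proof (induction n rule: less_induct)
    case (less n)
    have "n = 0 \<or> n = 1 \<or> n = 2 \<or> n = 3 \<or> (\<exists>k. n = Suc (Suc (Suc (Suc k))))"
      by presburger
    then consider "n = 0" | "n = 1" | "n = 2" | "n = 3" | k where "n = Suc (Suc (Suc (Suc k)))"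
      by blast
    then show ?case
    proof cases
      case 5
      define X where "X = C * R ^ (k + 3)"
      have X: "C * R ^ j \<le> X" if "j \<le> k + 3" for j
        unfolding X_def using C(1) R that by (intro mult_left_mono power_increasing)
      have 1: "\<bar>ode_coeff p q b d (Suc (Suc k))\<bar> \<le> X"
        using less.IH[of "Suc (Suc k)"] X[of "Suc (Suc k)"] 5 by linarith
      have 2: "\<bar>ode_coeff p q b d k\<bar> \<le> X"
        using less.IH[of k] X[of k] 5 by linarith
      have 3: "\<bar>d k\<bar> \<le> X" using d[of k] C(6) X[of 0] by simp
      have "\<bar>ode_coeff p q b d n\<bar> \<le> \<bar>p\<bar> * \<bar>ode_coeff p q b d (Suc (Suc k))\<bar> + \<bar>q\<bar> * \<bar>ode_coeff p q b d k\<bar> + \<bar>d k\<bar>"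
      proof -
        have "\<bar>x + y + z\<bar> \<le> \<bar>x\<bar> + \<bar>y\<bar> + \<bar>z\<bar>" for x y z :: real by linarith
        then show ?thesis unfolding 5 ode_coeff.simps(5) abs_mult[symmetric] .
      qed
      also have "\<dots> \<le> \<bar>p\<bar> * X + \<bar>q\<bar> * X + X"
        by (intro add_mono mult_left_mono 1 2 3) auto
      also have "\<dots> = C * R ^ n"
        by (simp add: X_def 5 R_def algebra_simps eval_nat_numeral)
      finally show ?thesis .
    next
      case 1
      then have "ode_coeff p q b d n = b 0" by simp
      then show ?thesis using base[OF C(2)] by simp
    next
      case 2
      then have "ode_coeff p q b d n = b 1" by simp
      then show ?thesis using base[OF C(3)] by simp
    next
      case 3
      then have "ode_coeff p q b d n = b 2" by (simp only: numeral_2_eq_2 ode_coeff.simps)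
      then show ?thesis using base[OF C(4)] by simp
    next
      case 4
      then have "ode_coeff p q b d n = b 3" by (simp only: numeral_3_eq_3 ode_coeff.simps)
      then show ?thesis using base[OF C(5)] by simp
    qed
  qed
  then show ?thesis by (simp add: C_def R_def)
qed

text \<open>The differential equation is a recursion for the Taylor coefficients at \<open>t0\<close>, whose solution
  grows at most geometrically. The monomial on the right-hand side enters in a single
  coefficient.\<close>

lemma mode_ode_exists:
  fixes b :: "nat \<Rightarrow> real"
  shows "\<exists>F c. F = (\<lambda>k t. exp_series (\<lambda>n. c (n + k)) (t - t0)) \<and>
    (\<forall>n. c (n + 4) = 2 * M * c (n + 2) + (\<rho> - M\<^sup>2) * c n + (if n = j then e * fact j else 0)) \<and>
    c 0 = b 0 \<and> c 1 = b 1 \<and> c 2 = b 2 \<and> c 3 = b 3 \<and>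
    (\<exists>C R. \<forall>n. \<bar>c n\<bar> \<le> C * R ^ n) \<and>
    mode_ode M \<rho> (\<lambda>y. e * (y - t0) ^ j) F"
proof -
  define d where "d n = (if n = j then e * fact j else 0)" for n
  define c where "c = ode_coeff (2 * M) (\<rho> - M\<^sup>2) b d"
  define F where "F = (\<lambda>k t. exp_series (\<lambda>n. c (n + k)) (t - t0))"
  have d: "\<bar>d n\<bar> \<le> \<bar>e * fact j\<bar>" for n by (simp add: d_def)
  obtain C R where b: "\<And>n. \<bar>c n\<bar> \<le> C * R ^ n"
    using ode_coeff_bound[of d "\<bar>e * fact j\<bar>" "2 * M" "\<rho> - M\<^sup>2" b] d unfolding c_def by blast
  have rec: "c (n + 4) = 2 * M * c (n + 2) + (\<rho> - M\<^sup>2) * c n + d n" for n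
    by (simp add: c_def eval_nat_numeral)
  have b': "\<bar>c (n + k)\<bar> \<le> (C * R ^ k) * R ^ n" for n k
    using b[of "n + k"] by (simp add: power_add mult_ac)
  have sm: "summable (\<lambda>n. c (n + k) / fact n * x ^ n)" for k x
    by (rule exp_type_summable[OF b'])
  have "tower F" unfolding F_def by (rule exp_series_tower[OF b])
  moreover have "F 4 y - 2 * M * F 2 y + (M\<^sup>2 - \<rho>) * F 0 y = e * (y - t0) ^ j" for y
  proof -
    let ?x = "y - t0"
    have S: "(\<lambda>n. c (n + k) / fact n * ?x ^ n) sums F k y" for k
      unfolding F_def exp_series_def by (rule summable_sums[OF sm])
    have s1: "(\<lambda>n. c (n + 4) / fact n * ?x ^ n - 2 * M * (c (n + 2) / fact n * ?x ^ n) + (M\<^sup>2 - \<rho>) * (c (n + 0) / fact n * ?x ^ n))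
        sums (F 4 y - 2 * M * F 2 y + (M\<^sup>2 - \<rho>) * F 0 y)"
      by (intro sums_add sums_diff sums_mult S)
    have s2: "(\<lambda>n. c (n + 4) / fact n * ?x ^ n - 2 * M * (c (n + 2) / fact n * ?x ^ n) + (M\<^sup>2 - \<rho>) * (c (n + 0) / fact n * ?x ^ n))
       = (\<lambda>n. if n = j then e * ?x ^ j else 0)"
      unfolding rec d_def by (rule ext) (simp add: field_simps)
    have s3: "(\<lambda>n. if n = j then e * ?x ^ j else 0) sums (e * ?x ^ j)"
      using sums_single[of j "\<lambda>n. e * ?x ^ n"] by (simp cong: if_cong)
    show ?thesis by (rule sums_unique2[OF s1[unfolded s2] s3])
  qed
  ultimately have "mode_ode M \<rho> (\<lambda>y. e * (y - t0) ^ j) F" by (simp add: mode_ode_def)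
  moreover have "c 0 = b 0" "c 1 = b 1" "c 2 = b 2" "c 3 = b 3"
    by (simp_all add: c_def eval_nat_numeral)
  ultimately show ?thesis using F_def rec[unfolded d_def] b by blast
qed

lemma mode_ivp_exists:
  "\<exists>F. mode_ode M \<rho> (\<lambda>y. e * (y - t0) ^ j) F \<and> F 0 t0 = b0 \<and> F 1 t0 = b1 \<and> F 2 t0 = b2 \<and> F 3 t0 = b3"
proof -
  define b where "b = (\<lambda>_::nat. 0::real)(0 := b0, 1 := b1, 2 := b2, 3 := b3)"
  obtain F c where cF: "F = (\<lambda>k t. exp_series (\<lambda>n. c (n + k)) (t - t0))"
    and rec: "\<forall>n. c (n + 4) = 2 * M * c (n + 2) + (\<rho> - M\<^sup>2) * c n + (if n = j then e * fact j else 0)"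
    and c: "c 0 = b 0" "c 1 = b 1" "c 2 = b 2" "c 3 = b 3"
    and bnd: "\<exists>C R. \<forall>n. \<bar>c n\<bar> \<le> C * R ^ n"
    and F: "mode_ode M \<rho> (\<lambda>y. e * (y - t0) ^ j) F"
    using mode_ode_exists[of t0 M \<rho> j e b] by blast
  have "F k t0 = c k" for k unfolding cF by (simp add: exp_series_0)
  then show ?thesis using c F by (intro exI[of _ F] conjI) (simp_all add: b_def)
qed

subsection \<open>The Lagrange bracket\<close>

text \<open>The boundary form of the symmetric operator \<open>d\<^sup>4/dy\<^sup>4 - 2 M d\<^sup>2/dy\<^sup>2\<close>.\<close>

definition bracket :: "real \<Rightarrow> (nat \<Rightarrow> real \<Rightarrow> real) \<Rightarrow> (nat \<Rightarrow> real \<Rightarrow> real) \<Rightarrow> real \<Rightarrow> real" where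
  "bracket M F G y = F 3 y * G 0 y - F 2 y * G 1 y + F 1 y * G 2 y - F 0 y * G 3 y
     - 2 * M * (F 1 y * G 0 y - F 0 y * G 1 y)"

lemma bracket_has_deriv:
  assumes F: "mode_ode M \<rho> f F" and G: "mode_ode M \<rho> g G"
  shows "(bracket M F G has_real_derivative f y * G 0 y - F 0 y * g y) (at y)"
proof -
  note d = mode_odeD(3-6)[OF F, of y] mode_odeD(3-6)[OF G, of y]
  have "(bracket M F G has_real_derivative
    (F 4 y * G 0 y + G 1 y * F 3 y) - (F 3 y * G 1 y + G 2 y * F 2 y) + (F 2 y * G 2 y + G 3 y * F 1 y)
     - (F 1 y * G 3 y + G 4 y * F 0 y)
     - 2 * M * ((F 2 y * G 0 y + G 1 y * F 1 y) - (F 1 y * G 1 y + G 2 y * F 0 y))) (at y)"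
    unfolding bracket_def[abs_def]
    by (intro DERIV_add DERIV_diff DERIV_mult DERIV_cmult d)
  also have "(F 4 y * G 0 y + G 1 y * F 3 y) - (F 3 y * G 1 y + G 2 y * F 2 y) + (F 2 y * G 2 y + G 3 y * F 1 y)
     - (F 1 y * G 3 y + G 4 y * F 0 y)
     - 2 * M * ((F 2 y * G 0 y + G 1 y * F 1 y) - (F 1 y * G 1 y + G 2 y * F 0 y))
     = f y * G 0 y - F 0 y * g y"
    unfolding mode_odeD(2)[OF F] mode_odeD(2)[OF G] by (simp add: algebra_simps)
  finally show ?thesis .
qed

text \<open>Uniqueness for the initial value problem: the bracket of two solutions is constant, and the
  bracket with the solution that has data \<open>(0, 0, 0, 1)\<close> at \<open>t1\<close> is minus the value at \<open>t1\<close>.\<close>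

lemma mode_ode_zero:
  assumes F: "mode_ode M \<rho> (\<lambda>_. 0) F" and z: "F 0 t0 = 0" "F 1 t0 = 0" "F 2 t0 = 0" "F 3 t0 = 0"
  shows "F 0 t1 = 0"
proof -
  obtain G where G: "mode_ode M \<rho> (\<lambda>_. 0) G" "G 0 t1 = 0" "G 1 t1 = 0" "G 2 t1 = 0" "G 3 t1 = 1"
    using mode_ivp_exists[of M \<rho> 0 t1 0 0 0 0 1] by auto
  have "(bracket M F G has_real_derivative 0) (at y)" for y
    using bracket_has_deriv[OF F G(1), of y] by simp
  then have "bracket M F G t1 = bracket M F G t0"
    using DERIV_isconst_all by blast
  then show ?thesis using z G by (simp add: bracket_def)
qed

lemma mode_ode_unique:
  assumes F: "mode_ode M \<rho> f F" and G: "mode_ode M \<rho> f G"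
    and z: "F 0 t0 = G 0 t0" "F 1 t0 = G 1 t0" "F 2 t0 = G 2 t0" "F 3 t0 = G 3 t0"
  shows "F 0 = G 0"
proof
  fix y
  have "mode_ode M \<rho> (\<lambda>_. 0) (\<lambda>k y. 1 * F k y + (-1) * G k y)"
  proof -
    have "(\<lambda>y. 1 * f y + (-1) * f y) = (\<lambda>_. 0)" by simp
    with mode_ode_lincomb[OF F G, of 1 "-1"] show ?thesis by (simp only:)
  qed
  from mode_ode_zero[OF this, of t0 y] z have "1 * F 0 y + (-1) * G 0 y = 0" by auto
  then show "F 0 y = G 0 y" by simp
qed

lemma tower_eq:
  assumes "tower F" "tower G" "F 0 = G 0"
  shows "F k = G k"
proof -
  have "F k = (deriv ^^ k) (F 0)" using tower_funpow_deriv[OF assms(1), of k 0] by simp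
  also have "\<dots> = G k" unfolding assms(3) using tower_funpow_deriv[OF assms(2), of k 0] by simp
  finally show ?thesis .
qed

text \<open>Bending moment and shear force of \<open>F 0 (y) sin (m x)\<close> on a line parallel to the long edges.
  They are linear in \<open>F\<close>, which shooting relies on.\<close>

definition edge_moment :: "real \<Rightarrow> real \<Rightarrow> (nat \<Rightarrow> real \<Rightarrow> real) \<Rightarrow> real \<Rightarrow> real" where
  "edge_moment \<nu> M F y = F 2 y - \<nu> * M * F 0 y"

definition edge_force :: "real \<Rightarrow> real \<Rightarrow> (nat \<Rightarrow> real \<Rightarrow> real) \<Rightarrow> real \<Rightarrow> real" where
  "edge_force \<nu> M F y = F 3 y - (2 - \<nu>) * M * F 1 y"

lemma free_edge_iff: "free_edge \<nu> M F y \<longleftrightarrow> edge_moment \<nu> M F y = 0 \<and> edge_force \<nu> M F y = 0"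
  by (simp add: free_edge_def edge_moment_def edge_force_def)

lemma bracket_free_edge:
  assumes "free_edge \<nu> M G y"
  shows "bracket M F G y = edge_force \<nu> M F y * G 0 y - edge_moment \<nu> M F y * G 1 y"
proof -
  have e: "G 2 y = \<nu> * M * G 0 y" "G 3 y = (2 - \<nu>) * M * G 1 y"
    using assms by (auto simp: free_edge_def)
  show ?thesis unfolding bracket_def edge_force_def edge_moment_def e by (simp add: algebra_simps)
qed

definition mode_eigen :: "real \<Rightarrow> real \<Rightarrow> real \<Rightarrow> real \<Rightarrow> (nat \<Rightarrow> real \<Rightarrow> real) \<Rightarrow> bool" where
  "mode_eigen l \<nu> M \<rho> F \<longleftrightarrow> mode_ode M \<rho> (\<lambda>_. 0) F \<and> free_edge \<nu> M F (-l) \<and> free_edge \<nu> M F l \<and>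
     (\<exists>y. F 0 y \<noteq> 0)"

lemma derivs_zero_on_interval:
  assumes F: "tower F" and l: "l > 0" and z: "\<And>y. y \<in> {-l<..<l} \<Longrightarrow> F k y = 0"
  shows "y \<in> {-l<..<l} \<Longrightarrow> F (Suc k) y = 0"
proof -
  assume y: "y \<in> {-l<..<l}"
  have "eventually (\<lambda>s. F k s = 0) (nhds y)"
    using eventually_nhds_in_open[of "{-l<..<l}" y] y by (auto elim!: eventually_mono simp: z)
  then have "deriv (F k) y = deriv (\<lambda>_. 0) y" by (rule deriv_cong_ev) simp
  then show ?thesis by (simp add: tower_deriv[OF F])
qed

text \<open>Energy estimate: the function \<open>G\<close> below vanishes at both edges by the boundary conditions, and
  its derivative is minus a sum of squares when \<open>\<rho> \<le> (1 - \<nu>\<^sup>2) M\<^sup>2\<close>; so each of the squares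
  vanishes.\<close>

lemma mode_eigen_lower_bound:
  assumes F: "mode_eigen l \<nu> M \<rho> F" and l: "l > 0" and M: "M > 0" and \<nu>: "0 < \<nu>" "\<nu> < 1"
  shows "\<rho> > (1 - \<nu>\<^sup>2) * M\<^sup>2"
proof (rule ccontr)
  assume "\<not> ?thesis"
  then have \<rho>: "\<rho> - (1 - \<nu>\<^sup>2) * M\<^sup>2 \<le> 0" by simp
  have ode: "mode_ode M \<rho> (\<lambda>_. 0) F" and bc: "free_edge \<nu> M F (-l)" "free_edge \<nu> M F l"
    and nz: "\<exists>y. F 0 y \<noteq> 0"
    using F unfolding mode_eigen_def by blast+
  note t = mode_odeD(1)[OF ode] and d = mode_odeD(3-6)[OF ode]
  define G where "G y = F 0 y * F 3 y - F 1 y * F 2 y - (2 - 2 * \<nu>) * M * (F 1 y * F 0 y)" for y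
  define g where "g y = (\<rho> - (1 - \<nu>\<^sup>2) * M\<^sup>2) * (F 0 y)\<^sup>2 - (F 2 y - \<nu> * M * F 0 y)\<^sup>2 - 2 * (1 - \<nu>) * M * (F 1 y)\<^sup>2" for y
  have Gd: "(G has_real_derivative g y) (at y)" for y
  proof -
    have "(G has_real_derivative (F 1 y * F 3 y + F 4 y * F 0 y) - (F 2 y * F 2 y + F 3 y * F 1 y)
       - (2 - 2 * \<nu>) * M * (F 2 y * F 0 y + F 1 y * F 1 y)) (at y)"
      unfolding G_def[abs_def] by (intro DERIV_diff DERIV_mult DERIV_cmult d)
    also have "(F 1 y * F 3 y + F 4 y * F 0 y) - (F 2 y * F 2 y + F 3 y * F 1 y)
       - (2 - 2 * \<nu>) * M * (F 2 y * F 0 y + F 1 y * F 1 y) = g y"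
      unfolding mode_odeD(2)[OF ode] g_def by (simp add: algebra_simps power2_eq_square)
    finally show ?thesis .
  qed
  have G0: "G y = 0" if "free_edge \<nu> M F y" for y
  proof -
    have e: "F 2 y = \<nu> * M * F 0 y" "F 3 y = (2 - \<nu>) * M * F 1 y" using that by (auto simp: free_edge_def)
    show ?thesis unfolding G_def e by (simp add: algebra_simps)
  qed
  have g1: "(\<rho> - (1 - \<nu>\<^sup>2) * M\<^sup>2) * (F 0 y)\<^sup>2 \<le> 0" for y
    using \<rho> by (intro mult_nonpos_nonneg) auto
  have g2: "0 \<le> 2 * (1 - \<nu>) * M * (F 1 y)\<^sup>2" for y
    using \<nu> M by (intro mult_nonneg_nonneg) auto
  have g0: "g y \<le> 0" for y
    unfolding g_def using g1[of y] g2[of y] zero_le_power2[of "F 2 y - \<nu> * M * F 0 y"] by linarith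
  have anti: "G y \<le> G x" if "x \<le> y" for x y
    using DERIV_nonpos_imp_nonincreasing[OF that, of G] Gd g0 by blast
  have Gz: "G y = 0" if "y \<in> {-l<..<l}" for y
    using anti[of "-l" y] anti[of y l] that G0[OF bc(1)] G0[OF bc(2)] by auto
  have gz: "g y = 0" if y: "y \<in> {-l<..<l}" for y
  proof -
    have "eventually (\<lambda>s. G s = 0) (nhds y)"
      using eventually_nhds_in_open[of "{-l<..<l}" y] y by (auto elim!: eventually_mono simp: Gz)
    then have "deriv G y = deriv (\<lambda>_. 0) y" by (rule deriv_cong_ev) simp
    then show ?thesis using DERIV_imp_deriv[OF Gd] by simp
  qed
  have z1: "F 1 y = 0" and z0: "F 2 y = \<nu> * M * F 0 y" if y: "y \<in> {-l<..<l}" for y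
  proof -
    have "2 * (1 - \<nu>) * M * (F 1 y)\<^sup>2 = 0" "(F 2 y - \<nu> * M * F 0 y)\<^sup>2 = 0"
      using gz[OF y] g1[of y] g2[of y] zero_le_power2[of "F 2 y - \<nu> * M * F 0 y"] unfolding g_def by linarith+
    then show "F 1 y = 0" "F 2 y = \<nu> * M * F 0 y" using \<nu> M by auto
  qed
  have z2: "F 2 y = 0" if "y \<in> {-l<..<l}" for y
    using derivs_zero_on_interval[OF t l, of 1 y] z1 that by (simp add: numeral_2_eq_2)
  have z3: "F 3 y = 0" if "y \<in> {-l<..<l}" for y
    using derivs_zero_on_interval[OF t l, of 2 y] z2 that by (simp add: numeral_3_eq_3 numeral_2_eq_2)
  have z: "(0::real) \<in> {-l<..<l}" using l by simp
  have "F 0 0 = 0" using z0[OF z] z2[OF z] \<nu> M by simp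
  then have "F 0 y = 0" for y
    using mode_ode_zero[OF ode, of 0 y] z1[OF z] z2[OF z] z3[OF z] by simp
  then show False using nz by blast
qed

text \<open>The solution \<open>H\<close> that starts at an edge with value \<open>0\<close> and slope \<open>1\<close> and satisfies the free
  edge conditions there never satisfies them at a second edge, which makes transverse
  eigenfunctions unique up to a factor: both \<open>H\<close> and \<open>H'' - M H\<close> have nonnegative Taylor
  coefficients, so the bending moment stays positive.\<close>

lemma pinned_start_solution:
  assumes M: "M > 0" and \<nu>: "0 < \<nu>" "\<nu> < 1" and \<rho>: "\<rho> \<ge> 0"
  obtains H where "mode_ode M \<rho> (\<lambda>_. 0) H" "H 0 t0 = 0" "H 1 t0 = 1" "free_edge \<nu> M H t0"
    "\<And>y. y > t0 \<Longrightarrow> edge_moment \<nu> M H y > 0"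
proof -
  define b where "b = (\<lambda>_::nat. 0::real)(1 := 1, 3 := (2 - \<nu>) * M)"
  obtain F c where cF: "F = (\<lambda>k t. exp_series (\<lambda>n. c (n + k)) (t - t0))"
    and rec: "\<forall>n. c (n + 4) = 2 * M * c (n + 2) + (\<rho> - M\<^sup>2) * c n + (if n = 0 then 0 * fact 0 else 0)"
    and c: "c 0 = b 0" "c 1 = b 1" "c 2 = b 2" "c 3 = b 3"
    and bnd: "\<exists>C R. \<forall>n. \<bar>c n\<bar> \<le> C * R ^ n"
    and F: "mode_ode M \<rho> (\<lambda>y. 0 * (y - t0) ^ 0) F"
    using mode_ode_exists[of t0 M \<rho> 0 0 b] by blast
  obtain C R where CR: "\<And>n. \<bar>c n\<bar> \<le> C * R ^ n" using bnd by blast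
  have F0: "F k t0 = c k" for k unfolding cF by (simp add: exp_series_0)
  have c': "c 0 = 0" "c 1 = 1" "c 2 = 0" "c 3 = (2 - \<nu>) * M" using c by (simp_all add: b_def)
  have pos: "c n \<ge> 0 \<and> c (Suc n) \<ge> 0 \<and> c (Suc (Suc n)) - M * c n \<ge> 0 \<and> c (Suc (Suc (Suc n))) - M * c (Suc n) \<ge> 0" for n
  proof (induction n)
    case 0
    have "c (Suc (Suc (Suc 0))) - M * c (Suc 0) = (1 - \<nu>) * M"
      using c' by (simp add: numeral_3_eq_3 algebra_simps)
    then show ?case using c' M \<nu> by (simp add: numeral_2_eq_2)
  next
    case (Suc n)
    have "c (Suc (Suc (Suc (Suc n)))) - M * c (Suc (Suc n)) = M * (c (Suc (Suc n)) - M * c n) + \<rho> * c n"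
      using rec[rule_format, of n] by (simp add: eval_nat_numeral algebra_simps)
    moreover have "\<dots> \<ge> 0" using Suc M \<rho> by (intro add_nonneg_nonneg mult_nonneg_nonneg) auto
    moreover have "M * c n \<ge> 0" using Suc M by simp
    ultimately show ?case using Suc by linarith
  qed
  have b': "\<bar>c (n + k)\<bar> \<le> (C * R ^ k) * R ^ n" for n k
    using CR[of "n + k"] by (simp add: power_add mult_ac)
  have sm: "summable (\<lambda>n. c (n + k) / fact n * x ^ n)" for k x
    by (rule exp_type_summable[OF b'])
  show thesis
  proof
    show "mode_ode M \<rho> (\<lambda>_. 0) F" using F by simp
    show "F 0 t0 = 0" "F 1 t0 = 1" using F0 c' by auto
    show "free_edge \<nu> M F t0" using F0 c' by (simp add: free_edge_def)
    fix y assume y: "y > t0"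
    let ?x = "y - t0"
    let ?a = "\<lambda>n. c (n + 2) / fact n * ?x ^ n - \<nu> * M * (c (n + 0) / fact n * ?x ^ n)"
    have S: "(\<lambda>n. c (n + k) / fact n * ?x ^ n) sums F k y" for k
      unfolding cF exp_series_def by (rule summable_sums[OF sm])
    have s: "?a sums edge_moment \<nu> M F y"
      unfolding edge_moment_def by (intro sums_diff sums_mult S)
    have a: "?a n = (c (n + 2) - \<nu> * M * c n) / fact n * ?x ^ n" for n
      by (simp add: algebra_simps diff_divide_distrib)
    have an: "c (n + 2) - \<nu> * M * c n \<ge> 0" for n
    proof -
      have "\<nu> * (M * c n) \<le> 1 * (M * c n)" using pos[of n] M \<nu> by (intro mult_right_mono) auto
      then show ?thesis using pos[of n] by (simp add: numeral_2_eq_2)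
    qed
    have "0 < (\<Sum>n. ?a n)"
    proof (rule suminf_pos2[of _ 1])
      show "summable ?a" using s by (rule sums_summable)
      show "0 \<le> ?a n" for n unfolding a using an y by (intro mult_nonneg_nonneg divide_nonneg_pos) auto
      have "c (1 + 2) - \<nu> * M * c 1 = 2 * (1 - \<nu>) * M" using c' by (simp add: numeral_3_eq_3 algebra_simps)
      then show "0 < ?a 1" unfolding a using y M \<nu> by simp
    qed
    then show "edge_moment \<nu> M F y > 0" using sums_unique[OF s] by simp
  qed
qed

lemma eigen_lower_bound_pos:
  assumes "mode_eigen l \<nu> M \<rho> F" "l > 0" "M > 0" "0 < \<nu>" "\<nu> < 1"
  shows "\<rho> > 0"
proof -
  have "\<nu>\<^sup>2 \<le> 1" using assms by (simp add: power_le_one)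
  then have "0 \<le> (1 - \<nu>\<^sup>2) * M\<^sup>2" by simp
  then show ?thesis using mode_eigen_lower_bound[OF assms] by linarith
qed

text \<open>An eigenfunction vanishing at the left edge would be a multiple of the solution from
  \<open>pinned_start_solution\<close>, whose moment at the right edge is positive.\<close>

lemma mode_eigen_edge_nonzero:
  assumes F: "mode_eigen l \<nu> M \<rho> F" and l: "l > 0" and M: "M > 0" and \<nu>: "0 < \<nu>" "\<nu> < 1"
  shows "F 0 (-l) \<noteq> 0"
proof
  assume z: "F 0 (-l) = 0"
  have ode: "mode_ode M \<rho> (\<lambda>_. 0) F" and bc: "free_edge \<nu> M F (-l)" "free_edge \<nu> M F l"
    and nz: "\<exists>y. F 0 y \<noteq> 0"
    using F unfolding mode_eigen_def by blast+
  obtain H where H: "mode_ode M \<rho> (\<lambda>_. 0) H" "H 0 (-l) = 0" "H 1 (-l) = 1" "free_edge \<nu> M H (-l)"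
    "\<And>y. y > -l \<Longrightarrow> edge_moment \<nu> M H y > 0"
    using pinned_start_solution[OF M \<nu> less_imp_le[OF eigen_lower_bound_pos[OF F l M \<nu>]], of "-l"] by blast
  define c where "c = F 1 (-l)"
  define K where "K = (\<lambda>k y. 1 * F k y + (- c) * H k y)"
  have K: "mode_ode M \<rho> (\<lambda>_. 0) K"
    using mode_ode_lincomb[OF ode H(1), of 1 "-c"] by (simp add: K_def)
  have "K 0 (-l) = 0" "K 1 (-l) = 0" using z H by (simp_all add: K_def c_def)
  moreover have "free_edge \<nu> M K (-l)" unfolding K_def by (rule free_edge_lincomb[OF bc(1) H(4)])
  ultimately have "K 2 (-l) = 0" "K 3 (-l) = 0" by (simp_all add: free_edge_def)
  with \<open>K 0 (-l) = 0\<close> \<open>K 1 (-l) = 0\<close> have K0: "K 0 y = 0" for y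
    using mode_ode_zero[OF K, of "-l" y] by blast
  have F0: "F 0 y = c * H 0 y" for y using K0[of y] by (simp add: K_def)
  have "K 0 = (\<lambda>_. 0)" using K0 by blast
  moreover have "tower (\<lambda>k y. 0)" by (simp add: tower_def)
  ultimately have "K 2 = (\<lambda>_. 0)" using tower_eq[OF mode_odeD(1)[OF K], of "\<lambda>k y. 0" 2] by simp
  then have "K 2 l = 0" by simp
  then have "F 2 l = c * H 2 l" by (simp add: K_def)
  then have "edge_moment \<nu> M F l = c * edge_moment \<nu> M H l"
    using F0[of l] by (simp add: edge_moment_def algebra_simps)
  then have "c = 0" using bc(2) H(5)[of l] l by (simp add: free_edge_iff)
  then show False using F0 nz by simp
qed

subsection \<open>Solvability\<close>

lemma lincomb_edge:
  "edge_moment \<nu> M (\<lambda>k y. a * F k y + b * G k y) y = a * edge_moment \<nu> M F y + b * edge_moment \<nu> M G y"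
  "edge_force \<nu> M (\<lambda>k y. a * F k y + b * G k y) y = a * edge_force \<nu> M F y + b * edge_force \<nu> M G y"
  by (simp_all add: edge_moment_def edge_force_def algebra_simps)

text \<open>At a free edge the second and third derivative are determined by the value and the slope.\<close>

lemma left_edge_solution:
  "\<exists>F. mode_ode M \<rho> (\<lambda>y. e * (y + l) ^ j) F \<and> F 0 (-l) = a \<and> F 1 (-l) = b \<and> free_edge \<nu> M F (-l)"
  using mode_ivp_exists[of M \<rho> e "-l" j a b "\<nu> * M * a" "(2 - \<nu>) * M * b"]
  by (auto simp: free_edge_def)

text \<open>Shooting from the left edge leaves two linear conditions for two parameters at the right edge.
  They are solvable for every right-hand side unless an eigenfunction exists.\<close>

lemma nonresonant_solvable:
  assumes no: "\<not> (\<exists>F. mode_eigen l \<nu> M \<rho> F)"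
  shows "\<exists>F. mode_ode M \<rho> (\<lambda>y. (y + l) ^ j) F \<and> free_edge \<nu> M F (-l) \<and> free_edge \<nu> M F l"
proof -
  obtain P where P: "mode_ode M \<rho> (\<lambda>y. (y + l) ^ j) P" "free_edge \<nu> M P (-l)"
    using left_edge_solution[of M \<rho> 1 l j 0 0 \<nu>] by auto
  obtain H1 where H1: "mode_ode M \<rho> (\<lambda>_. 0) H1" "H1 0 (-l) = 1" "H1 1 (-l) = 0" "free_edge \<nu> M H1 (-l)"
    using left_edge_solution[of M \<rho> 0 l 0 1 0 \<nu>] by auto
  obtain H2 where H2: "mode_ode M \<rho> (\<lambda>_. 0) H2" "H2 0 (-l) = 0" "H2 1 (-l) = 1" "free_edge \<nu> M H2 (-l)"
    using left_edge_solution[of M \<rho> 0 l 0 0 1 \<nu>] by auto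
  define A B C D where "A = edge_moment \<nu> M H1 l" and "B = edge_moment \<nu> M H2 l"
    and "C = edge_force \<nu> M H1 l" and "D = edge_force \<nu> M H2 l"
  have hom: "a = 0 \<and> b = 0" if "a * A + b * B = 0" "a * C + b * D = 0" for a b
  proof -
    define F where "F = (\<lambda>k y. a * H1 k y + b * H2 k y)"
    have F: "mode_ode M \<rho> (\<lambda>_. 0) F"
      using mode_ode_lincomb[OF H1(1) H2(1), of a b] by (simp add: F_def)
    have "free_edge \<nu> M F (-l)" unfolding F_def by (intro free_edge_lincomb H1 H2)
    moreover have "free_edge \<nu> M F l"
      unfolding free_edge_iff F_def lincomb_edge using that by (simp add: A_def B_def C_def D_def)
    ultimately have "\<not> (\<exists>y. F 0 y \<noteq> 0)" using no F unfolding mode_eigen_def by blast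
    then have F0: "F 0 = (\<lambda>_. 0)" by blast
    moreover have "tower (\<lambda>k y. 0)" by (simp add: tower_def)
    ultimately have F1: "F 1 = (\<lambda>_. 0)" using tower_eq[OF mode_odeD(1)[OF F], of "\<lambda>k y. 0" 1] by simp
    have "F 0 (-l) = a" "F 1 (-l) = b" using H1(2,3) H2(2,3) by (simp_all add: F_def)
    then show ?thesis using F0 F1 by simp
  qed
  have det: "A * D - B * C \<noteq> 0"
  proof
    assume d: "A * D - B * C = 0"
    have "D = 0 \<and> - C = 0" by (rule hom) (use d in \<open>auto simp: algebra_simps\<close>)
    moreover have "- B = 0 \<and> A = 0" by (rule hom) (use d in \<open>auto simp: algebra_simps\<close>)
    ultimately show False using hom[of 1 0] by simp
  qed
  define p q where "p = edge_moment \<nu> M P l" and "q = edge_force \<nu> M P l"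
  define E where "E = A * D - B * C"
  define a b where "a = (B * q - D * p) / E" and "b = (C * p - A * q) / E"
  define H where "H = (\<lambda>k y. a * H1 k y + b * H2 k y)"
  define F where "F = (\<lambda>k y. 1 * P k y + 1 * H k y)"
  have H: "mode_ode M \<rho> (\<lambda>_. 0) H"
    using mode_ode_lincomb[OF H1(1) H2(1), of a b] by (simp add: H_def)
  have "mode_ode M \<rho> (\<lambda>y. (y + l) ^ j) F"
    using mode_ode_lincomb[OF P(1) H, of 1 1] by (simp add: F_def)
  moreover have "free_edge \<nu> M H (-l)" unfolding H_def by (intro free_edge_lincomb H1 H2)
  then have "free_edge \<nu> M F (-l)" unfolding F_def by (intro free_edge_lincomb P)
  moreover have "edge_moment \<nu> M F l = p + (a * A + b * B)" "edge_force \<nu> M F l = q + (a * C + b * D)"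
    unfolding F_def H_def lincomb_edge by (simp_all add: A_def B_def C_def D_def p_def q_def)
  moreover have "a * A + b * B = - p"
  proof -
    have "a * A + b * B = ((B * q - D * p) * A + (C * p - A * q) * B) / E"
      by (simp add: a_def b_def add_divide_distrib)
    also have "(B * q - D * p) * A + (C * p - A * q) * B = - p * E" by (simp add: E_def algebra_simps)
    finally show ?thesis using det by (simp add: E_def[symmetric])
  qed
  moreover have "a * C + b * D = - q"
  proof -
    have "a * C + b * D = ((B * q - D * p) * C + (C * p - A * q) * D) / E"
      by (simp add: a_def b_def add_divide_distrib)
    also have "(B * q - D * p) * C + (C * p - A * q) * D = - q * E" by (simp add: E_def algebra_simps)
    finally show ?thesis using det by (simp add: E_def[symmetric])
  qed
  ultimately show ?thesis by (intro exI[of _ F]) (simp add: free_edge_iff)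
qed

text \<open>The bracket vanishes at the left edge; at the right edge only the shear force of \<open>F\<close> is left.\<close>

lemma bracket_integral:
  assumes F: "mode_ode M \<rho> f F" and G: "mode_ode M \<rho> (\<lambda>_. 0) G" and l: "l > 0"
    and bc: "free_edge \<nu> M F (-l)" "free_edge \<nu> M G (-l)" "free_edge \<nu> M G l"
    and m: "edge_moment \<nu> M F l = 0"
  shows "((\<lambda>y. f y * G 0 y) has_integral (edge_force \<nu> M F l * G 0 l)) {-l..l}"
proof -
  have "((\<lambda>y. f y * G 0 y - F 0 y * 0) has_integral (bracket M F G l - bracket M F G (-l))) {-l..l}"
  proof (rule fundamental_theorem_of_calculus)
    show "(bracket M F G has_vector_derivative f y * G 0 y - F 0 y * 0) (at y within {-l..l})" for y
      by (rule has_vector_derivative_at_within)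
        (rule bracket_has_deriv[OF F G, unfolded has_real_derivative_iff_has_vector_derivative])
  qed (use l in simp)
  moreover have "bracket M F G (-l) = 0"
    using bracket_free_edge[OF bc(2), of F] bc(1) by (simp add: free_edge_iff)
  moreover have "bracket M F G l = edge_force \<nu> M F l * G 0 l"
    using bracket_free_edge[OF bc(3), of F] m by simp
  ultimately show ?thesis by simp
qed

text \<open>When an eigenfunction \<open>G\<close> exists, the moment at the right edge can still be removed by a
  homogeneous solution. The remaining shear force is the obstruction to solvability, namely the
  scalar product of the right-hand side with \<open>G\<close>.\<close>

lemma resonant_almost_solvable:
  assumes G: "mode_eigen l \<nu> M \<rho> G" and l: "l > 0" and M: "M > 0" and \<nu>: "0 < \<nu>" "\<nu> < 1"
  shows "\<exists>F. mode_ode M \<rho> (\<lambda>y. (y + l) ^ j) F \<and> free_edge \<nu> M F (-l) \<and> edge_moment \<nu> M F l = 0 \<and>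
    ((\<lambda>y. (y + l) ^ j * G 0 y) has_integral (edge_force \<nu> M F l * G 0 l)) {-l..l}"
proof -
  obtain P where P: "mode_ode M \<rho> (\<lambda>y. (y + l) ^ j) P" "free_edge \<nu> M P (-l)"
    using left_edge_solution[of M \<rho> 1 l j 0 0 \<nu>] by auto
  obtain H where H: "mode_ode M \<rho> (\<lambda>_. 0) H" "H 0 (-l) = 0" "H 1 (-l) = 1" "free_edge \<nu> M H (-l)"
    "\<And>y. y > -l \<Longrightarrow> edge_moment \<nu> M H y > 0"
    using pinned_start_solution[OF M \<nu> less_imp_le[OF eigen_lower_bound_pos[OF G l M \<nu>]], of "-l"] by blast
  have Hl: "edge_moment \<nu> M H l \<noteq> 0" using H(5)[of l] l by simp
  define c where "c = - edge_moment \<nu> M P l / edge_moment \<nu> M H l"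
  define F where "F = (\<lambda>k y. 1 * P k y + c * H k y)"
  have F: "mode_ode M \<rho> (\<lambda>y. (y + l) ^ j) F"
    using mode_ode_lincomb[OF P(1) H(1), of 1 c] by (simp add: F_def)
  moreover have bc: "free_edge \<nu> M F (-l)" unfolding F_def by (intro free_edge_lincomb P H)
  moreover have m: "edge_moment \<nu> M F l = 0" unfolding F_def lincomb_edge using Hl by (simp add: c_def)
  moreover have "((\<lambda>y. (y + l) ^ j * G 0 y) has_integral (edge_force \<nu> M F l * G 0 l)) {-l..l}"
    using bracket_integral[OF F _ l bc _ _ m] G unfolding mode_eigen_def by blast
  ultimately show ?thesis by blast
qed

section \<open>Completeness of the modes\<close>

lemma smooth_ident: "smooth (\<lambda>t. t)"
  by (rule smooth.intros[of _ "\<lambda>_. 1"]) (auto intro: smooth_const)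

lemma smooth_shift_power: "smooth (\<lambda>y. (y + l) ^ j)"
proof (induction j)
  case (Suc j)
  then show ?case using smooth_mult[OF smooth_add[OF smooth_ident smooth_const[of l]] Suc] by simp
qed (simp add: smooth_const)

definition annihilates_modes :: "real \<Rightarrow> (real \<times> real \<Rightarrow> real) \<Rightarrow> bool" where
  "annihilates_modes l h \<longleftrightarrow> integrable (plate_measure l) h \<and>
     (\<forall>k\<ge>1. \<forall>j. plate_int l h (sine k) (\<lambda>y. (y + l) ^ j) = 0)"

text \<open>The multipliers form an algebra. It contains \<open>cos x\<close> because \<open>2 cos x sin k x\<close> is a sum of two
  sines, and the coordinate \<open>y\<close>, hence all polynomials in these two functions.\<close>

definition mode_multiplier :: "real \<Rightarrow> (real \<times> real \<Rightarrow> real) \<Rightarrow> bool" where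
  "mode_multiplier l g \<longleftrightarrow> (\<forall>h. annihilates_modes l h \<longrightarrow> annihilates_modes l (\<lambda>z. h z * g z))"

lemma sep_mult_integrable:
  assumes "integrable (plate_measure l) h" "smooth p" "smooth q"
  shows "integrable (plate_measure l) (\<lambda>z. h z * sep p q z)"
  using plate_int_integrable[OF assms] by (simp add: sep_def)

lemma plate_int_mult_sep: "plate_int l (\<lambda>z. h z * sep p q z) p' q' = plate_int l h (\<lambda>t. p t * p' t) (\<lambda>t. q t * q' t)"
  unfolding plate_int_def sep_def by (simp add: mult_ac)

lemma plate_int_add_left_fun:
  assumes "integrable (plate_measure l) V" "integrable (plate_measure l) W" "smooth p" "smooth q"
  shows "plate_int l (\<lambda>z. V z + W z) p q = plate_int l V p q + plate_int l W p q"
  unfolding plate_int_def distrib_right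
  by (rule Bochner_Integration.integral_add; rule plate_int_integrable; rule assms)

lemma plate_int_cmult_fun: "plate_int l (\<lambda>z. V z * c) p q = plate_int l V p q * c"
  unfolding plate_int_def
  by (subst integral_mult_left_zero[symmetric]) (simp add: mult_ac)

lemma mode_multiplier_const: "mode_multiplier l (\<lambda>_. c)"
  unfolding mode_multiplier_def annihilates_modes_def by (simp add: plate_int_cmult_fun)

lemma mode_multiplier_mult:
  assumes "mode_multiplier l f" "mode_multiplier l g" shows "mode_multiplier l (\<lambda>z. f z * g z)"
  unfolding mode_multiplier_def
proof (intro allI impI)
  fix h assume h: "annihilates_modes l h"
  then have "annihilates_modes l (\<lambda>z. h z * f z)" using assms(1) unfolding mode_multiplier_def by blast
  then have "annihilates_modes l (\<lambda>z. (h z * f z) * g z)" using assms(2) unfolding mode_multiplier_def by blast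
  then show "annihilates_modes l (\<lambda>z. h z * (f z * g z))" by (simp add: mult.assoc)
qed

lemma mode_multiplier_add:
  assumes "mode_multiplier l f" "mode_multiplier l g" shows "mode_multiplier l (\<lambda>z. f z + g z)"
  unfolding mode_multiplier_def
proof (intro allI impI)
  fix h assume h: "annihilates_modes l h"
  have f: "annihilates_modes l (\<lambda>z. h z * f z)" and g: "annihilates_modes l (\<lambda>z. h z * g z)"
    using assms h unfolding mode_multiplier_def by blast+
  then show "annihilates_modes l (\<lambda>z. h z * (f z + g z))"
    unfolding annihilates_modes_def
    by (simp add: distrib_left plate_int_add_left_fun smooth_sine smooth_shift_power)
qed

lemma mode_multiplier_cos: "mode_multiplier l (\<lambda>z. cos (fst z))"
  unfolding mode_multiplier_def
proof (intro allI impI)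
  fix h assume h: "annihilates_modes l h"
  then have hi: "integrable (plate_measure l) h" by (simp add: annihilates_modes_def)
  have c: "(\<lambda>z. h z * cos (fst z)) = (\<lambda>z. h z * sep (cosine 1) (\<lambda>_. 1) z)"
    by (simp add: sep_def cosine_def)
  show "annihilates_modes l (\<lambda>z. h z * cos (fst z))"
    unfolding annihilates_modes_def c
  proof (intro conjI allI impI)
    show "integrable (plate_measure l) (\<lambda>z. h z * sep (cosine 1) (\<lambda>_. 1) z)"
      by (rule sep_mult_integrable[OF hi smooth_cosine smooth_const])
    fix k j :: nat assume k: "k \<ge> 1"
    let ?q = "\<lambda>y. (y + l) ^ j"
    have e: "(\<lambda>t. cosine 1 t * sine k t) = (\<lambda>t. (1/2) * sine (k + 1) t + (1/2) * sine (k - 1) t)"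
    proof
      fix t
      have s: "sine (k + 1) t = sin (real k * t + t)" "sine (k - 1) t = sin (real k * t - t)"
        using k by (simp_all add: sine_def algebra_simps of_nat_diff)
      show "cosine 1 t * sine k t = (1/2) * sine (k + 1) t + (1/2) * sine (k - 1) t"
        unfolding s sin_add sin_diff by (simp add: cosine_def sine_def add_divide_distrib diff_divide_distrib)
    qed
    have z: "plate_int l h (sine n) ?q = 0" for n
    proof (cases "n = 0")
      case True
      then show ?thesis by (simp add: plate_int_def sine_def)
    next
      case False
      then show ?thesis using h by (simp add: annihilates_modes_def)
    qed
    have "plate_int l (\<lambda>z. h z * sep (cosine 1) (\<lambda>_. 1) z) (sine k) ?q
        = plate_int l h (\<lambda>t. (1/2) * sine (k + 1) t + (1/2) * sine (k - 1) t) ?q"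
      unfolding plate_int_mult_sep e by simp
    also have "\<dots> = (1/2) * plate_int l h (sine (k + 1)) ?q + (1/2) * plate_int l h (sine (k - 1)) ?q"
      using plate_int_add2[OF hi smooth_mult[OF smooth_const smooth_sine] smooth_shift_power smooth_mult[OF smooth_const smooth_sine]]
      by (simp only: plate_int_cmult_left)
    finally show "plate_int l (\<lambda>z. h z * sep (cosine 1) (\<lambda>_. 1) z) (sine k) ?q = 0" by (simp add: z)
  qed
qed

lemma mode_multiplier_snd: "mode_multiplier l snd"
  unfolding mode_multiplier_def
proof (intro allI impI)
  fix h assume h: "annihilates_modes l h"
  then have hi: "integrable (plate_measure l) h" by (simp add: annihilates_modes_def)
  have c: "(\<lambda>z. h z * snd z) = (\<lambda>z. h z * sep (\<lambda>_. 1) (\<lambda>t. t) z)" by (simp add: sep_def)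
  show "annihilates_modes l (\<lambda>z. h z * snd z)"
    unfolding annihilates_modes_def c
  proof (intro conjI allI impI)
    show "integrable (plate_measure l) (\<lambda>z. h z * sep (\<lambda>_. 1) (\<lambda>t. t) z)"
      by (rule sep_mult_integrable[OF hi smooth_const smooth_ident])
    fix k j :: nat assume k: "k \<ge> 1"
    have "(\<lambda>t. t * (t + l) ^ j) = (\<lambda>t. 1 * (t + l) ^ Suc j + (- l) * (t + l) ^ j)"
      by (rule ext) (simp add: algebra_simps)
    then have "plate_int l (\<lambda>z. h z * sep (\<lambda>_. 1) (\<lambda>t. t) z) (sine k) (\<lambda>y. (y + l) ^ j)
        = 1 * plate_int l h (sine k) (\<lambda>t. (t + l) ^ Suc j) + (- l) * plate_int l h (sine k) (\<lambda>t. (t + l) ^ j)"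
      unfolding plate_int_mult_sep
      using plate_int_lincomb_right[OF hi smooth_sine smooth_shift_power smooth_shift_power, of k 1 l "Suc j" "-l" l j] by simp
    moreover have "plate_int l h (sine k) (\<lambda>y. (y + l) ^ i) = 0" for i
      using h k unfolding annihilates_modes_def by blast
    ultimately show "plate_int l (\<lambda>z. h z * sep (\<lambda>_. 1) (\<lambda>t. t) z) (sine k) (\<lambda>y. (y + l) ^ j) = 0"
      by (simp only: mult_zero_right add_0_right)
  qed
qed

lemma mode_multiplier_polynomial:
  assumes "real_polynomial_function P"
  shows "mode_multiplier l (\<lambda>z. P (cos (fst z), snd z))"
  using assms
proof (induction rule: real_polynomial_function.induct)
  case (linear f)
  have "f (a, b) = f (1, 0) * a + f (0, 1) * b" for a b
  proof -
    interpret bounded_linear f by fact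
    have "f (a *\<^sub>R (1, 0) + b *\<^sub>R (0, 1)) = a *\<^sub>R f (1, 0) + b *\<^sub>R f (0, 1)" by (simp only: add scaleR)
    then show ?thesis by (simp add: mult.commute)
  qed
  then have e: "(\<lambda>z. f (cos (fst z), snd z)) = (\<lambda>z. f (1, 0) * cos (fst z) + f (0, 1) * snd z)" by blast
  show ?case unfolding e
    by (intro mode_multiplier_add mode_multiplier_mult mode_multiplier_const mode_multiplier_cos mode_multiplier_snd)
next
  case (const c)
  then show ?case by (rule mode_multiplier_const)
next
  case (add f g)
  then show ?case by (intro mode_multiplier_add)
next
  case (mult f g)
  then show ?case by (intro mode_multiplier_mult)
qed

text \<open>The functions \<open>sin k x\<close> span \<open>sin x\<close> times the polynomials in \<open>cos x\<close>, so the Weierstrass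
  theorem in the variables \<open>(cos x, y)\<close> yields completeness.\<close>

lemma annihilates_modes_imp_AE_zero:
  assumes h: "annihilates_modes l h"
  shows "AE z in plate_measure l. h z = 0"
proof -
  have hi: "integrable (plate_measure l) h" using h by (simp add: annihilates_modes_def)
  have hs: "integrable (plate_measure l) (\<lambda>z. h z * sep (sine 1) (\<lambda>_. 1) z)"
    by (rule sep_mult_integrable[OF hi smooth_sine smooth_const])
  have "AE z in plate_measure l. h z * sep (sine 1) (\<lambda>_. 1) z = 0"
  proof (rule plate_test_zero_imp_AE_zero[OF hs])
    fix p q assume "test_fun 0 pi p" "test_fun (-l) l q"
    then have sm: "smooth p" "smooth q" unfolding test_fun_def by blast+
    let ?S = "{-1..1} \<times> {-l..l} :: (real \<times> real) set"
    define G where "G z = p (arccos (fst z)) * q (snd z)" for z :: "real \<times> real"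
    have "continuous_on ?S (\<lambda>z. arccos (fst z))"
      by (rule continuous_on_arccos) (auto intro!: continuous_intros)
    then have c1: "continuous_on ?S (\<lambda>z. p (arccos (fst z)))"
      by (rule continuous_on_compose2[OF smooth_continuous_on[OF sm(1), of UNIV]]) simp
    have "continuous_on ?S (\<lambda>z. q (snd z))"
      by (rule continuous_on_compose2[OF smooth_continuous_on[OF sm(2), of UNIV] continuous_on_snd[OF continuous_on_id]]) simp
    with c1 have cG: "continuous_on ?S G" unfolding G_def[abs_def] by (rule continuous_on_mult)
    have cS: "compact ?S" by (intro compact_Times) auto
    define N where "N = (LINT z|plate_measure l. \<bar>h z\<bar>)"
    have N: "N \<ge> 0" unfolding N_def by (rule integral_nonneg_AE) simp
    have bound: "\<bar>plate_int l (\<lambda>z. h z * sep (sine 1) (\<lambda>_. 1) z) p q\<bar> \<le> e * N" if e: "e > 0" for e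
    proof -
      obtain P where P: "real_polynomial_function P" "\<And>z. z \<in> ?S \<Longrightarrow> \<bar>G z - P z\<bar> < e"
        using Stone_Weierstrass_real_polynomial_function[OF cS cG e] by blast
      define Q where "Q z = P (cos (fst z), snd z)" for z :: "real \<times> real"
      have cP: "continuous_on UNIV P"
        using P(1) by (simp add: continuous_on_polymonial_function real_polynomial_function_eq)
      have "continuous_on UNIV Q" unfolding Q_def[abs_def]
        by (rule continuous_on_compose2[OF cP]) (auto intro!: continuous_intros)
      then have Qm: "Q \<in> borel_measurable borel" by (rule borel_measurable_continuous_onI)
      have hQ: "annihilates_modes l (\<lambda>z. h z * Q z)"
        using mode_multiplier_polynomial[OF P(1), of l] h unfolding mode_multiplier_def Q_def by blast
      then have hQi: "integrable (plate_measure l) (\<lambda>z. h z * Q z)" by (simp add: annihilates_modes_def)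
      have hQs: "integrable (plate_measure l) (\<lambda>z. h z * Q z * sine 1 (fst z))"
        using sep_mult_integrable[OF hQi smooth_sine smooth_const[of 1], of 1] by (simp add: sep_def)
      have "plate_int l (\<lambda>z. h z * Q z) (sine k) (\<lambda>y. (y + l) ^ j) = 0" if "k \<ge> 1" for k j
        using hQ that unfolding annihilates_modes_def by blast
      from this[of 1 0] have hQ0: "(LINT z|plate_measure l. h z * Q z * sine 1 (fst z)) = 0"
        by (simp add: plate_int_def)
      have i1: "integrable (plate_measure l) (\<lambda>z. h z * sep (sine 1) (\<lambda>_. 1) z * (p (fst z) * q (snd z)))"
        by (rule plate_int_integrable[OF hs sm])
      define D where "D z = h z * sep (sine 1) (\<lambda>_. 1) z * (p (fst z) * q (snd z)) - h z * Q z * sine 1 (fst z)" for z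
      have iD: "integrable (plate_measure l) D"
        unfolding D_def[abs_def] by (rule Bochner_Integration.integrable_diff[OF i1 hQs])
      have Dh: "\<bar>D z\<bar> \<le> e * \<bar>h z\<bar>" if z: "z \<in> plate l" for z
      proof -
        have "(cos (fst z), snd z) \<in> ?S" using z by (auto simp: plate_iff)
        from P(2)[OF this] have 1: "\<bar>p (fst z) * q (snd z) - Q z\<bar> \<le> e"
          using z by (simp add: G_def Q_def plate_iff arccos_cos)
        have "D z = h z * (sine 1 (fst z) * (p (fst z) * q (snd z) - Q z))"
          by (simp add: D_def sep_def algebra_simps)
        then have "\<bar>D z\<bar> = \<bar>h z\<bar> * (\<bar>sine 1 (fst z)\<bar> * \<bar>p (fst z) * q (snd z) - Q z\<bar>)"
          by (simp only: abs_mult)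
        also have "\<dots> \<le> \<bar>h z\<bar> * (1 * e)"
          using 1 by (intro mult_left_mono mult_mono) (auto simp: sine_def)
        finally show ?thesis by (simp only: mult_1 mult.commute)
      qed
      have "plate_int l (\<lambda>z. h z * sep (sine 1) (\<lambda>_. 1) z) p q = (LINT z|plate_measure l. D z)"
        unfolding plate_int_def D_def Bochner_Integration.integral_diff[OF i1 hQs] hQ0 by simp
      also have "\<bar>\<dots>\<bar> \<le> (LINT z|plate_measure l. \<bar>D z\<bar>)"
        by (rule integral_abs_bound)
      also have "\<dots> \<le> (LINT z|plate_measure l. e * \<bar>h z\<bar>)"
        by (rule integral_mono_AE[OF integrable_abs[OF iD] integrable_mult_right[OF integrable_abs[OF hi]]])
          (rule AE_plateI, rule Dh)
      also have "\<dots> = e * N" unfolding N_def by (rule integral_mult_right_zero)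
      finally show ?thesis .
    qed
    have "\<bar>plate_int l (\<lambda>z. h z * sep (sine 1) (\<lambda>_. 1) z) p q\<bar> \<le> 0"
    proof (rule field_le_epsilon)
      fix e :: real assume e: "e > 0"
      have "\<bar>plate_int l (\<lambda>z. h z * sep (sine 1) (\<lambda>_. 1) z) p q\<bar> \<le> e / (N + 1) * N"
        using bound[of "e / (N + 1)"] e N by simp
      also have "\<dots> \<le> e" using e N by (simp add: field_simps)
      finally show "\<bar>plate_int l (\<lambda>z. h z * sep (sine 1) (\<lambda>_. 1) z) p q\<bar> \<le> 0 + e" by simp
    qed
    then show "plate_int l (\<lambda>z. h z * sep (sine 1) (\<lambda>_. 1) z) p q = 0" by simp
  qed
  moreover have "AE z in plate_measure l. sep (sine 1) (\<lambda>_. 1) z \<noteq> 0"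
  proof (rule AE_plateI)
    fix z assume "z \<in> plate l"
    then have "sin (fst z) > 0" by (intro sin_gt_zero) (auto simp: plate_iff)
    then show "sep (sine 1) (\<lambda>_. 1) z \<noteq> 0" by (simp add: sep_def sine_def)
  qed
  ultimately show ?thesis by eventually_elim simp
qed

subsection \<open>Orthogonality of the modes\<close>

lemma lborel_integral_interval:
  assumes "smooth f" "a < b"
  shows "(LINT x|lborel. indicator {a<..<b} x * f x) = integral {a..b} f"
    "integrable lborel (\<lambda>x. indicator {a<..<b} x * f x)"
proof -
  have i: "integrable lborel (\<lambda>x. indicator {a..b} x *\<^sub>R f x)"
    by (rule borel_integrable_compact) (auto intro: smooth_continuous_on assms)
  have ae: "AE x in lborel. indicator {a<..<b} x * f x = indicator {a..b} x *\<^sub>R f x"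
  proof -
    have "AE x in lborel. x \<noteq> a" "AE x in lborel. x \<noteq> b" by (rule AE_lborel_singleton)+
    then show ?thesis by eventually_elim (auto simp: indicator_def)
  qed
  have m: "(\<lambda>x. indicator {a<..<b} x * f x) \<in> borel_measurable lborel"
    using smooth_borel[OF assms(1)] by (intro borel_measurable_times) auto
  show "integrable lborel (\<lambda>x. indicator {a<..<b} x * f x)"
    using integrable_cong_AE[OF m borel_measurable_integrable[OF i] ae] i by simp
  have "(LINT x|lborel. indicator {a<..<b} x * f x) = (LINT x|lborel. indicator {a..b} x *\<^sub>R f x)"
    by (rule integral_cong_AE[OF m borel_measurable_integrable[OF i] ae])
  also have "\<dots> = integral {a..b} f"
    using set_borel_integral_eq_integral(2)[of "{a..b}" f] i
    by (simp add: set_lebesgue_integral_def set_integrable_def)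
  finally show "(LINT x|lborel. indicator {a<..<b} x * f x) = integral {a..b} f" .
qed

lemma plate_int_sep:
  assumes sm: "smooth p" "smooth q" "smooth p'" "smooth q'" and l: "l > 0"
  shows "plate_int l (sep p q) p' q' = integral {0..pi} (\<lambda>x. p x * p' x) * integral {-l..l} (\<lambda>y. q y * q' y)"
proof -
  define f where "f x = indicator {0<..<pi} x * (p x * p' x)" for x
  define g where "g y = indicator {-l<..<l} y * (q y * q' y)" for y
  have s1: "smooth (\<lambda>x. p x * p' x)" and s2: "smooth (\<lambda>y. q y * q' y)" by (intro smooth_mult sm)+
  have f: "(LINT x|lborel. f x) = integral {0..pi} (\<lambda>x. p x * p' x)" "integrable lborel f"
    unfolding f_def[abs_def] by (rule lborel_integral_interval[OF s1]; simp)+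
  have g: "(LINT y|lborel. g y) = integral {-l..l} (\<lambda>y. q y * q' y)" "integrable lborel g"
    unfolding g_def[abs_def] by (rule lborel_integral_interval[OF s2]; use l in simp)+
  have ind: "indicator (plate l) z = indicator {0<..<pi} (fst z) * (indicator {-l<..<l} (snd z) :: real)" for z
    by (auto simp: indicator_def plate_iff)
  have m: "(\<lambda>(x, y). f x * g y) \<in> borel_measurable borel"
  proof -
    have "fst \<in> borel_measurable (borel :: (real \<times> real) measure)" "snd \<in> borel_measurable (borel :: (real \<times> real) measure)"
      by (rule borel_measurable_continuous_onI, simp add: continuous_on_fst continuous_on_snd)+
    moreover have "f \<in> borel_measurable borel" "g \<in> borel_measurable borel"
      using borel_measurable_integrable[OF f(2)] borel_measurable_integrable[OF g(2)] by simp_all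
    ultimately have "(\<lambda>z :: real \<times> real. f (fst z)) \<in> borel_measurable borel" "(\<lambda>z :: real \<times> real. g (snd z)) \<in> borel_measurable borel"
      by (auto intro: measurable_compose)
    then show ?thesis unfolding case_prod_unfold by (rule borel_measurable_times)
  qed
  have "plate_int l (sep p q) p' q' = (LINT z|lebesgue. indicator (plate l) z *\<^sub>R (sep p q z * (p' (fst z) * q' (snd z))))"
    unfolding plate_int_def by (rule integral_restrict_space) simp
  also have "\<dots> = (LINT z|lebesgue. (case z of (x, y) \<Rightarrow> f x * g y))"
    by (intro Bochner_Integration.integral_cong) (auto simp: ind f_def g_def sep_def mult_ac split: prod.splits)
  also have "\<dots> = (LINT z|lborel. (case z of (x, y) \<Rightarrow> f x * g y))"
    using m by (intro integral_completion) simp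
  also have "\<dots> = integral\<^sup>L (lborel \<Otimes>\<^sub>M lborel) (\<lambda>(x, y). f x * g y)"
    by (simp add: lborel_prod)
  also have "\<dots> = (LINT x|lborel. LINT y|lborel. f x * g y)"
  proof -
    have "integrable (lborel \<Otimes>\<^sub>M lborel) (\<lambda>(x, y). f x * g y)"
    proof (rule lborel_pair.Fubini_integrable)
      show "(\<lambda>(x, y). f x * g y) \<in> borel_measurable (lborel \<Otimes>\<^sub>M lborel)"
        using m unfolding lborel_prod by simp
      have "integrable lborel (\<lambda>x. \<bar>f x\<bar> * (LINT y|lborel. \<bar>g y\<bar>))"
        by (rule integrable_mult_left) (rule integrable_abs[OF f(2)])
      then show "integrable lborel (\<lambda>x. LINT y|lborel. norm (case (x, y) of (x, y) \<Rightarrow> f x * g y))"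
        by (simp add: abs_mult)
      have "integrable lborel (\<lambda>y. f x * g y)" for x
        by (rule integrable_mult_right[OF g(2)])
      then show "AE x in lborel. integrable lborel (\<lambda>y. case (x, y) of (x, y) \<Rightarrow> f x * g y)" by simp
    qed
    from lborel_pair.integral_fst'[OF this] show ?thesis by simp
  qed
  also have "\<dots> = (LINT x|lborel. f x) * (LINT y|lborel. g y)" by simp
  finally show ?thesis unfolding f(1) g(1) .
qed

lemma has_integral_of_derivative:
  assumes "\<And>x. (G has_real_derivative g x) (at x)" "a \<le> b"
  shows "(g has_integral (G b - G a)) {a..b}"
  by (rule fundamental_theorem_of_calculus[OF assms(2)])
    (rule has_vector_derivative_at_within, rule assms(1)[unfolded has_real_derivative_iff_has_vector_derivative])

lemma sine_orthogonal:
  assumes "m \<ge> 1" "k \<ge> 1"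
  shows "integral {0..pi} (\<lambda>x. sine m x * sine k x) = (if m = k then pi / 2 else 0)"
proof (cases "m = k")
  case True
  define G where "G x = x / 2 - sin (2 * real m * x) / (4 * real m)" for x
  have "(G has_real_derivative sine m x * sine k x) (at x)" for x
  proof -
    have "(G has_real_derivative 1 / 2 - cos (2 * real m * x) * (2 * real m) / (4 * real m)) (at x)"
      unfolding G_def[abs_def] by (auto intro!: derivative_eq_intros)
    also have "1 / 2 - cos (2 * real m * x) * (2 * real m) / (4 * real m) = sine m x * sine k x"
      using assms True cos_double_sin[of "real m * x"] by (simp add: sine_def power2_eq_square mult.assoc diff_divide_distrib)
    finally show ?thesis .
  qed
  then have "((\<lambda>x. sine m x * sine k x) has_integral (G pi - G 0)) {0..pi}"
    by (rule has_integral_of_derivative) simp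
  moreover have "sin (2 * real m * pi) = 0"
    using sin_npi[of "2 * m"] by (simp add: mult_ac)
  then have "G pi - G 0 = pi / 2" by (simp add: G_def)
  ultimately show ?thesis using True by (simp add: integral_unique)
next
  case False
  define a b where "a = real m - real k" and "b = real m + real k"
  have ab: "a \<noteq> 0" "b \<noteq> 0" using False assms by (auto simp: a_def b_def)
  define G where "G x = sin (a * x) / (2 * a) - sin (b * x) / (2 * b)" for x
  have "(G has_real_derivative sine m x * sine k x) (at x)" for x
  proof -
    have "(G has_real_derivative cos (a * x) * a / (2 * a) - cos (b * x) * b / (2 * b)) (at x)"
      unfolding G_def[abs_def] using ab by (auto intro!: derivative_eq_intros)
    also have "cos (a * x) * a / (2 * a) - cos (b * x) * b / (2 * b) = cos (a * x) / 2 - cos (b * x) / 2"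
      using ab by simp
    also have "\<dots> = sine m x * sine k x"
      by (simp add: a_def b_def sine_def distrib_right left_diff_distrib cos_add cos_diff add_divide_distrib diff_divide_distrib)
    finally show ?thesis .
  qed
  then have "((\<lambda>x. sine m x * sine k x) has_integral (G pi - G 0)) {0..pi}"
    by (rule has_integral_of_derivative) simp
  moreover have "sin (a * pi) = 0" "sin (b * pi) = 0"
    by (simp_all add: a_def b_def distrib_right left_diff_distrib sin_add sin_diff)
  then have "G pi - G 0 = 0" by (simp add: G_def)
  ultimately show ?thesis using False by (simp add: integral_unique)
qed

lemma AE_plate_slices:
  assumes "AE z in lborel. P z"
  shows "AE y in lborel. AE x in lborel. P (x :: real, y :: real)"
proof -
  obtain N where N: "N \<in> null_sets lborel" "{z. \<not> P z} \<subseteq> N"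
    using assms by (auto elim!: AE_E simp: null_sets_def)
  have Nb: "N \<in> sets (lborel \<Otimes>\<^sub>M lborel)" unfolding lborel_prod by (rule null_setsD2[OF N(1)])
  have "AE z in lborel \<Otimes>\<^sub>M lborel. z \<notin> N"
    unfolding lborel_prod by (rule AE_not_in[OF N(1)])
  then have "AE x in lborel. AE y in lborel. (x, y) \<notin> N"
    by (rule lborel_pair.AE_pair)
  moreover have "{z \<in> space (lborel \<Otimes>\<^sub>M lborel). (fst z, snd z) \<notin> N} \<in> sets (lborel \<Otimes>\<^sub>M lborel)"
  proof -
    have "{z \<in> space (lborel \<Otimes>\<^sub>M lborel). (fst z, snd z) \<notin> N} = space (lborel \<Otimes>\<^sub>M lborel) - N" by auto
    then show ?thesis using Nb by (simp only: sets.compl_sets)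
  qed
  ultimately have "AE y in lborel. AE x in lborel. (x, y) \<notin> N"
    using lborel_pair.AE_commute[of "\<lambda>x y. (x, y) \<notin> N"] by blast
  then show ?thesis
    by (rule AE_mp) (rule AE_I2, rule impI, erule AE_mp, rule AE_I2, use N(2) in blast)
qed

text \<open>The profile of \<open>u\<close> in its mode is an arbitrary function, not known to be measurable. On almost
  every line of constant \<open>y\<close> it is just a number, so the orthogonality of the sines is applied
  there and integrated afterwards.\<close>

lemma in_mode_orthogonal:
  assumes u: "integrable (plate_measure l) u" and mode: "in_mode l m u" and l: "l > 0"
    and mk: "m \<ge> 1" "k \<ge> 1" "k \<noteq> m" and q: "smooth q"
  shows "plate_int l u (sine k) q = 0"
proof -
  obtain \<phi> where \<phi>: "AE z in plate_measure l. u z = \<phi> (snd z) * sin (real m * fst z)"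
    using mode unfolding in_mode_def by blast
  obtain u' where u': "integrable lborel u'" "AE z in plate_measure l. u z = u' z"
    "\<And>z. z \<notin> plate l \<Longrightarrow> u' z = 0"
    "\<And>h. h \<in> borel_measurable borel \<Longrightarrow> (LINT z|plate_measure l. u z * h z) = (LINT z|lborel. u' z * h z)"
    using plate_borel_version[OF u] by blast
  have "AE z in plate_measure l. u' z = \<phi> (snd z) * sin (real m * fst z)"
    using \<phi> u'(2) by eventually_elim simp
  then have "AE z in lborel. z \<in> plate l \<longrightarrow> u' z = \<phi> (snd z) * sin (real m * fst z)"
    unfolding AE_plate_iff .
  from AE_plate_slices[OF this]
  have ae: "AE y in lborel. AE x in lborel. (x, y) \<in> plate l \<longrightarrow> u' (x, y) = \<phi> y * sin (real m * x)" by simp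
  define h where "h z = sine k (fst z) * q (snd z)" for z
  have hm: "h \<in> borel_measurable borel" unfolding h_def[abs_def] by (rule smooth_prod_borel[OF smooth_sine q])
  have int: "integrable lborel (\<lambda>z. u' z * h z)"
  proof -
    obtain D where D: "D \<ge> 0" "\<And>t. t \<in> {-l..l} \<Longrightarrow> \<bar>q t\<bar> \<le> D" using smooth_bounded_on[OF q] by blast
    show ?thesis
    proof (rule Bochner_Integration.integrable_bound[of _ "\<lambda>z. D * u' z"])
      show "integrable lborel (\<lambda>z. D * u' z)" using u'(1) by simp
      show "(\<lambda>z. u' z * h z) \<in> borel_measurable lborel"
        using borel_measurable_integrable[OF u'(1)] hm by (intro borel_measurable_times) auto
      have "norm (u' z * h z) \<le> norm (D * u' z)" for z
      proof (cases "z \<in> plate l")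
        case True
        have "\<bar>h z\<bar> \<le> 1 * D" unfolding h_def abs_mult using True D
          by (intro mult_mono) (auto simp: plate_iff sine_def)
        then show ?thesis using D(1) by (simp add: abs_mult mult.commute[of "\<bar>u' z\<bar>"] mult_right_mono)
      qed (simp add: u'(3))
      then show "AE z in lborel. norm (u' z * h z) \<le> norm (D * u' z)" by simp
    qed
  qed
  then have int2: "integrable (lborel \<Otimes>\<^sub>M lborel) (\<lambda>(x, y). u' (x, y) * h (x, y))"
    by (simp add: lborel_prod case_prod_unfold)
  have inner: "AE y in lborel. (LINT x|lborel. u' (x, y) * h (x, y)) = 0"
    using ae AE_space[of lborel] lborel_pair.AE_integrable_snd[OF int2]
  proof eventually_elim
    fix y assume a: "AE x in lborel. (x, y) \<in> plate l \<longrightarrow> u' (x, y) = \<phi> y * sin (real m * x)"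
      and i: "integrable lborel (\<lambda>x. u' (x, y) * h (x, y))"
    define c where "c = (if y \<in> {-l<..<l} then \<phi> y * q y else 0)"
    have s: "smooth (\<lambda>x. sine m x * sine k x)" by (intro smooth_mult smooth_sine)
    have "(LINT x|lborel. u' (x, y) * h (x, y)) = (LINT x|lborel. c * (indicator {0<..<pi} x * (sine m x * sine k x)))"
    proof (rule integral_cong_AE)
      show "(\<lambda>x. u' (x, y) * h (x, y)) \<in> borel_measurable lborel"
        using i by (rule borel_measurable_integrable)
      show "(\<lambda>x. c * (indicator {0<..<pi} x * (sine m x * sine k x))) \<in> borel_measurable lborel"
        using lborel_integral_interval(2)[OF s pi_gt_zero] by (intro borel_measurable_times borel_measurable_integrable) auto
      show "AE x in lborel. u' (x, y) * h (x, y) = c * (indicator {0<..<pi} x * (sine m x * sine k x))"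
        using a
      proof eventually_elim
        case (elim x)
        show ?case
        proof (cases "(x, y) \<in> plate l")
          case True
          then show ?thesis using elim by (simp add: c_def h_def sine_def plate_iff)
        next
          case False
          then show ?thesis using u'(3) by (auto simp: c_def plate_iff indicator_def)
        qed
      qed
    qed
    also have "\<dots> = c * integral {0..pi} (\<lambda>x. sine m x * sine k x)"
      by (simp add: lborel_integral_interval(1)[OF s pi_gt_zero])
    also have "\<dots> = 0" using sine_orthogonal[OF mk(1,2)] mk(3) by simp
    finally show "(LINT x|lborel. u' (x, y) * h (x, y)) = 0" .
  qed
  have "plate_int l u (sine k) q = (LINT z|lborel. u' z * h z)"
    unfolding plate_int_def using u'(4)[OF hm] by (simp add: h_def)
  also have "\<dots> = integral\<^sup>L (lborel \<Otimes>\<^sub>M lborel) (\<lambda>(x, y). u' (x, y) * h (x, y))"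
    by (simp add: lborel_prod case_prod_unfold)
  also have "\<dots> = (LINT y|lborel. (LINT x|lborel. u' (x, y) * h (x, y)))"
    by (rule lborel_pair.integral_snd[OF int2, symmetric])
  also have "\<dots> = (LINT (y::real)|lborel. 0 :: real)"
  proof (rule integral_cong_AE)
    show "(\<lambda>y. LINT x|lborel. u' (x, y) * h (x, y)) \<in> borel_measurable lborel"
      by (rule borel_measurable_integrable[OF lborel_pair.integrable_snd[OF int2]])
  qed (simp, rule inner)
  finally show ?thesis by simp
qed

section \<open>Eigenfunctions of the plate and eigenfunctions of the modes\<close>

lemma plate_form_commute: "plate_form l \<nu> \<kappa> u v = plate_form l \<nu> \<kappa> v u"
  unfolding plate_form_def Let_def by (simp add: mult.commute)

lemma mode_eigen_scale:
  assumes "mode_eigen l \<nu> M \<rho> F" "c \<noteq> 0"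
  shows "mode_eigen l \<nu> M \<rho> (\<lambda>k y. c * F k y)"
  using assms mode_ode_lincomb[of M \<rho> "\<lambda>_. 0" F "\<lambda>_. 0" F c 0] free_edge_lincomb[of \<nu> M F _ F c 0]
  unfolding mode_eigen_def by auto

text \<open>The reflection transfers statements about the left edge to the right edge.\<close>

lemma mode_eigen_reflect:
  assumes "mode_eigen l \<nu> M \<rho> F"
  shows "mode_eigen l \<nu> M \<rho> (\<lambda>k y. (-1) ^ k * F k (- y))"
proof -
  have ode: "mode_ode M \<rho> (\<lambda>_. 0) F" and bc: "free_edge \<nu> M F (-l)" "free_edge \<nu> M F l"
    and nz: "\<exists>y. F 0 y \<noteq> 0"
    using assms unfolding mode_eigen_def by blast+
  have "tower (\<lambda>k y. (-1) ^ k * F k (- y))"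
    unfolding tower_def
  proof (intro allI)
    fix k t
    have "((\<lambda>y. F k (- y)) has_real_derivative F (Suc k) (- t) * (- 1)) (at t)"
      by (rule DERIV_chain2[where f = "F k" and g = uminus])
        (use mode_odeD(1)[OF ode] in \<open>auto simp: tower_def intro!: derivative_eq_intros\<close>)
    from DERIV_cmult[OF this, of "(-1) ^ k"]
    show "((\<lambda>y. (-1) ^ k * F k (- y)) has_real_derivative (-1) ^ Suc k * F (Suc k) (- t)) (at t)"
      by simp
  qed
  moreover have "F 4 (- y) - 2 * M * F 2 (- y) + (M\<^sup>2 - \<rho>) * F 0 (- y) = 0" for y
    using ode unfolding mode_ode_def by blast
  moreover have "\<exists>y. F 0 (- y) \<noteq> 0" using nz by (metis minus_minus)
  ultimately show ?thesis
    using bc unfolding mode_eigen_def mode_ode_def free_edge_def by simp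
qed

lemma mode_eigen_right_edge_nonzero:
  assumes "mode_eigen l \<nu> M \<rho> F" "l > 0" "M > 0" "0 < \<nu>" "\<nu> < 1"
  shows "F 0 l \<noteq> 0"
  using mode_eigen_edge_nonzero[OF mode_eigen_reflect[OF assms(1)] assms(2-)] by simp

lemma mode_imp_eigenfunction:
  assumes F: "mode_eigen l \<nu> ((real m)\<^sup>2) \<rho> F" and l: "l > 0" and m: "m \<ge> 1" and \<nu>: "0 < \<nu>" "\<nu> < 1"
    and \<mu>: "\<mu> = \<kappa> * real m ^ 4 + \<rho>"
  shows "is_eigenfunction l \<nu> \<kappa> \<mu> (sep (sine m) (F 0))"
proof -
  let ?M = "(real m)\<^sup>2"
  have M: "?M > 0" using m by simp
  have ode: "mode_ode ?M \<rho> (\<lambda>_. 0) F" and bc: "free_edge \<nu> ?M F l" "free_edge \<nu> ?M F (-l)"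
    using F unfolding mode_eigen_def by blast+
  note t = mode_odeD(1)[OF ode]
  note sF = tower_smooth[OF t, of 0]
  show ?thesis unfolding is_eigenfunction_def
  proof (intro conjI allI impI)
    show "H2_star l (sep (sine m) (F 0))" by (rule H2_star_sep[OF smooth_sine sF l sine_0 sine_pi])
    show "\<not> (AE z in plate_measure l. sep (sine m) (F 0) z = 0)"
    proof
      assume ae: "AE z in plate_measure l. sep (sine m) (F 0) z = 0"
      have "plate_int l (sep (sine m) (F 0)) (sine m) (F 0) = plate_int l (\<lambda>_. 0) (sine m) (F 0)"
        using ae by (intro plate_int_cong_AE smooth_sine sF L2_on_integrable[OF L2_on_sep]) simp_all
      then have "integral {0..pi} (\<lambda>x. sine m x * sine m x) * integral {-l..l} (\<lambda>y. F 0 y * F 0 y) = 0"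
        unfolding plate_int_sep[OF smooth_sine sF smooth_sine sF l] by (simp add: plate_int_def)
      then have "integral {-l..l} (\<lambda>y. F 0 y * F 0 y) = 0"
        using sine_orthogonal[OF m m] by simp
      then have "\<forall>y\<in>{-l..l}. F 0 y * F 0 y = 0"
        using l smooth_continuous_on[OF smooth_mult[OF sF sF]] by (subst (asm) integral_eq_0_iff) auto
      then have "F 0 (-l) = 0" using l by simp
      then show False using mode_eigen_edge_nonzero[OF F l M \<nu>] by blast
    qed
    fix w assume w: "H2_star l w"
    have "F 4 y - 2 * ?M * F 2 y + (1 + \<kappa>) * real m ^ 4 * F 0 y = \<mu> * F 0 y" for y
      unfolding mode_odeD(2)[OF ode] \<mu> by (simp add: algebra_simps power_mult[symmetric])
    then have "plate_form l \<nu> \<kappa> (sep (sine m) (F 0)) w = \<mu> * plate_int l w (sine m) (F 0)"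
      unfolding plate_form_mode[OF l t w bc] by (simp add: plate_int_cmult_right)
    then show "plate_form l \<nu> \<kappa> (sep (sine m) (F 0)) w = \<mu> * (LINT p|plate_measure l. sep (sine m) (F 0) p * w p)"
      by (simp add: plate_int_def sep_def mult.commute)
  qed
qed

text \<open>The range of the transverse operator annihilates the coefficient of an eigenfunction: test the
  eigenvalue equation with a separable function.\<close>

lemma eigenfunction_orthogonal_range:
  assumes u: "is_eigenfunction l \<nu> \<kappa> \<mu> u" and F: "mode_ode ((real m)\<^sup>2) \<rho> f F" and l: "l > 0"
    and bc: "free_edge \<nu> ((real m)\<^sup>2) F (-l)" "free_edge \<nu> ((real m)\<^sup>2) F l"
    and \<mu>: "\<mu> = \<kappa> * real m ^ 4 + \<rho>" and f: "smooth f"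
  shows "plate_int l u (sine m) f = 0"
proof -
  let ?M = "(real m)\<^sup>2"
  note t = mode_odeD(1)[OF F]
  note sF = tower_smooth[OF t, of 0]
  have H: "H2_star l u" using u by (simp add: is_eigenfunction_def)
  then have ui: "integrable (plate_measure l) u"
    by (auto simp: H2_star_def H2_on_def intro: L2_on_integrable)
  have "F 4 y - 2 * ?M * F 2 y + (1 + \<kappa>) * real m ^ 4 * F 0 y = 1 * f y + \<mu> * F 0 y" for y
    unfolding mode_odeD(2)[OF F] \<mu> by (simp add: algebra_simps power_mult[symmetric])
  then have "plate_form l \<nu> \<kappa> (sep (sine m) (F 0)) u = plate_int l u (sine m) (\<lambda>y. 1 * f y + \<mu> * F 0 y)"
    unfolding plate_form_mode[OF l t H bc(2,1)] by simp
  also have "\<dots> = plate_int l u (sine m) f + \<mu> * plate_int l u (sine m) (F 0)"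
    using plate_int_lincomb_right[OF ui smooth_sine f sF, of m 1 \<mu>] by simp
  finally have "plate_form l \<nu> \<kappa> u (sep (sine m) (F 0)) = plate_int l u (sine m) f + \<mu> * plate_int l u (sine m) (F 0)"
    by (simp add: plate_form_commute)
  moreover have "plate_form l \<nu> \<kappa> u (sep (sine m) (F 0)) = \<mu> * plate_int l u (sine m) (F 0)"
    using u H2_star_sep[OF smooth_sine sF l sine_0 sine_pi, of m]
    by (simp add: is_eigenfunction_def plate_int_def sep_def)
  ultimately show ?thesis by simp
qed

lemma eigenfunction_integrable: "is_eigenfunction l \<nu> \<kappa> \<mu> u \<Longrightarrow> integrable (plate_measure l) u"
  by (auto simp: is_eigenfunction_def H2_star_def H2_on_def intro: L2_on_integrable)

text \<open>The coefficient annihilates the range of the transverse operator, which consists of the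
  functions orthogonal to \<open>G\<close>; this is tested on powers.\<close>

lemma eigenfunction_coefficient_resonant:
  assumes u: "is_eigenfunction l \<nu> \<kappa> \<mu> u" and G: "mode_eigen l \<nu> ((real m)\<^sup>2) \<rho> G" and l: "l > 0" and m: "m \<ge> 1"
    and \<nu>: "0 < \<nu>" "\<nu> < 1" and \<mu>: "\<mu> = \<kappa> * real m ^ 4 + \<rho>"
  shows "\<exists>c. \<forall>j. plate_int l u (sine m) (\<lambda>y. (y + l) ^ j) = c * integral {-l..l} (\<lambda>y. (y + l) ^ j * G 0 y)"
proof -
  let ?M = "(real m)\<^sup>2"
  have M: "?M > 0" using m by simp
  define f where "f j y = (y + l) ^ j" for j :: nat and y :: real
  have sf: "smooth (f j)" for j unfolding f_def[abs_def] by (rule smooth_shift_power)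
  have "\<exists>F. mode_ode ?M \<rho> (f j) F \<and> free_edge \<nu> ?M F (-l) \<and> edge_moment \<nu> ?M F l = 0 \<and>
    ((\<lambda>y. f j y * G 0 y) has_integral (edge_force \<nu> ?M F l * G 0 l)) {-l..l}" for j
    unfolding f_def[abs_def] by (rule resonant_almost_solvable[OF G l M \<nu>])
  then obtain F where F: "\<And>j. mode_ode ?M \<rho> (f j) (F j)" "\<And>j. free_edge \<nu> ?M (F j) (-l)"
    "\<And>j. edge_moment \<nu> ?M (F j) l = 0"
    "\<And>j. ((\<lambda>y. f j y * G 0 y) has_integral (edge_force \<nu> ?M (F j) l * G 0 l)) {-l..l}"
    by metis
  define \<tau> where "\<tau> j = edge_force \<nu> ?M (F j) l" for j
  define U where "U j = plate_int l u (sine m) (f j)" for j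
  have I: "integral {-l..l} (\<lambda>y. f j y * G 0 y) = \<tau> j * G 0 l" for j
    unfolding \<tau>_def by (rule integral_unique[OF F(4)])
  have Gl: "G 0 l \<noteq> 0" by (rule mode_eigen_right_edge_nonzero[OF G l M \<nu>])
  \<comment> \<open>the combination \<open>\<tau> i f j - \<tau> j f i\<close> is orthogonal to \<open>G\<close>, and the shear forces of its solution cancel\<close>
  have rel: "\<tau> i * U j = \<tau> j * U i" for i j
  proof -
    define K where "K = (\<lambda>k y. \<tau> i * F j k y + (- \<tau> j) * F i k y)"
    have "mode_ode ?M \<rho> (\<lambda>y. \<tau> i * f j y + (- \<tau> j) * f i y) K"
      unfolding K_def by (rule mode_ode_lincomb[OF F(1) F(1)])
    moreover have "free_edge \<nu> ?M K (-l)" unfolding K_def by (rule free_edge_lincomb[OF F(2) F(2)])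
    moreover have "free_edge \<nu> ?M K l"
      unfolding free_edge_iff K_def lincomb_edge F(3) \<tau>_def[symmetric] by simp
    moreover have "smooth (\<lambda>y. \<tau> i * f j y + (- \<tau> j) * f i y)"
      by (intro smooth_add smooth_mult smooth_const sf)
    ultimately have "plate_int l u (sine m) (\<lambda>y. \<tau> i * f j y + (- \<tau> j) * f i y) = 0"
      using eigenfunction_orthogonal_range[OF u _ l _ _ \<mu>] by blast
    then have "\<tau> i * U j + (- \<tau> j) * U i = 0"
      unfolding U_def plate_int_lincomb_right[OF eigenfunction_integrable[OF u] smooth_sine sf sf] .
    then show ?thesis by simp
  qed
  have "\<exists>c. \<forall>j. U j = c * (\<tau> j * G 0 l)"
  proof (cases "\<exists>i. \<tau> i \<noteq> 0")
    case True
    then obtain i where i: "\<tau> i \<noteq> 0" by blast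
    have "U j = (U i / (\<tau> i * G 0 l)) * (\<tau> j * G 0 l)" for j
      using rel[of i j] i Gl by (simp add: field_simps)
    then show ?thesis by blast
  next
    case False
    have "U j = 0" for j
    proof -
      have "free_edge \<nu> ?M (F j) l" using F(3) False by (simp add: free_edge_iff \<tau>_def)
      then show ?thesis unfolding U_def
        using eigenfunction_orthogonal_range[OF u F(1) l F(2) _ \<mu> sf] by blast
    qed
    then show ?thesis by auto
  qed
  then show ?thesis unfolding U_def I[symmetric] f_def .
qed

lemma eigenfunction_coefficient_nonresonant:
  assumes u: "is_eigenfunction l \<nu> \<kappa> \<mu> u" and no: "\<not> (\<exists>G. mode_eigen l \<nu> ((real m)\<^sup>2) \<rho> G)" and l: "l > 0"
    and \<mu>: "\<mu> = \<kappa> * real m ^ 4 + \<rho>"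
  shows "plate_int l u (sine m) (\<lambda>y. (y + l) ^ j) = 0"
proof -
  obtain F where F: "mode_ode ((real m)\<^sup>2) \<rho> (\<lambda>y. (y + l) ^ j) F"
    "free_edge \<nu> ((real m)\<^sup>2) F (-l)" "free_edge \<nu> ((real m)\<^sup>2) F l"
    using nonresonant_solvable[OF no] by blast
  show ?thesis by (rule eigenfunction_orthogonal_range[OF u F(1) l F(2,3) \<mu> smooth_shift_power])
qed

lemma plate_int_mode_component:
  assumes G: "smooth G" and l: "l > 0" and mk: "m \<ge> 1" "k \<ge> 1"
  shows "plate_int l (sep (sine m) (\<lambda>y. c * (2 / pi) * G y)) (sine k) (\<lambda>y. (y + l) ^ j) =
    (if m = k then c * integral {-l..l} (\<lambda>y. (y + l) ^ j * G y) else 0)"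
proof -
  have "integral {-l..l} (\<lambda>y. c * (2 / pi) * G y * (y + l) ^ j)
      = c * (2 / pi) * integral {-l..l} (\<lambda>y. (y + l) ^ j * G y)"
    using integral_mult_right[of "{-l..l}" "c * (2 / pi)" "\<lambda>y. (y + l) ^ j * G y"] by (simp add: mult_ac)
  then show ?thesis
    unfolding plate_int_sep[OF smooth_sine smooth_mult[OF smooth_const G] smooth_sine smooth_shift_power l] sine_orthogonal[OF mk]
    by simp
qed

lemma in_mode_sep: "in_mode l m (sep (sine m) q)"
  unfolding in_mode_def by (rule exI[of _ q]) (simp add: sep_def sine_def mult.commute)

lemma plate_int_sum_fun:
  assumes "finite A" "\<And>i. i \<in> A \<Longrightarrow> integrable (plate_measure l) (W i)" "smooth p" "smooth q"
  shows "plate_int l (\<lambda>z. \<Sum>i\<in>A. W i z) p q = (\<Sum>i\<in>A. plate_int l (W i) p q)"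
  unfolding plate_int_def sum_distrib_right
  by (rule Bochner_Integration.integral_sum) (intro plate_int_integrable assms)

text \<open>The multiple of the generator is chosen to match the coefficient in the mode itself; in all
  other modes both functions have coefficient zero, so completeness applies to the difference.\<close>

theorem mode_eigenfunctions_generated:
  assumes G: "mode_eigen l \<nu> ((real m)\<^sup>2) \<rho> G" and l: "l > 0" and m: "m \<ge> 1"
    and \<nu>: "0 < \<nu>" "\<nu> < 1" and \<mu>: "\<mu> = \<kappa> * real m ^ 4 + \<rho>"
  shows "eigenfunctions_generated_by l \<nu> \<kappa> m \<mu> (sep (sine m) (G 0))"
  unfolding eigenfunctions_generated_by_def
proof (intro conjI allI impI)
  show "is_eigenfunction l \<nu> \<kappa> \<mu> (sep (sine m) (G 0))"
    by (rule mode_imp_eigenfunction[OF G l m \<nu> \<mu>])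
  show "in_mode l m (sep (sine m) (G 0))" by (rule in_mode_sep)
  fix u assume "is_eigenfunction l \<nu> \<kappa> \<mu> u \<and> in_mode l m u"
  then have u: "is_eigenfunction l \<nu> \<kappa> \<mu> u" and um: "in_mode l m u" by blast+
  have ode: "mode_ode ((real m)\<^sup>2) \<rho> (\<lambda>_. 0) G" using G unfolding mode_eigen_def by blast
  have sG: "smooth (G 0)" by (rule tower_smooth[OF mode_odeD(1)[OF ode]])
  have ui: "integrable (plate_measure l) u" by (rule eigenfunction_integrable[OF u])
  obtain c where c: "\<And>j. plate_int l u (sine m) (\<lambda>y. (y + l) ^ j) = c * integral {-l..l} (\<lambda>y. (y + l) ^ j * G 0 y)"
    using eigenfunction_coefficient_resonant[OF u G l m \<nu> \<mu>] by blast
  define w where "w = sep (sine m) (\<lambda>y. c * (2 / pi) * G 0 y)"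
  have wi: "integrable (plate_measure l) w"
    unfolding w_def by (intro L2_on_integrable L2_on_sep smooth_sine smooth_mult smooth_const sG)
  have "annihilates_modes l (\<lambda>z. u z - w z)"
    unfolding annihilates_modes_def
  proof (intro conjI allI impI)
    show "integrable (plate_measure l) (\<lambda>z. u z - w z)" using ui wi by simp
    fix k j :: nat assume k: "k \<ge> 1"
    have "plate_int l u (sine k) (\<lambda>y. (y + l) ^ j) = plate_int l w (sine k) (\<lambda>y. (y + l) ^ j)"
      unfolding w_def plate_int_mode_component[OF sG l m k]
      using c in_mode_orthogonal[OF ui um l m k _ smooth_shift_power] by auto
    then show "plate_int l (\<lambda>z. u z - w z) (sine k) (\<lambda>y. (y + l) ^ j) = 0"
      by (simp add: plate_int_diff_left[OF ui wi smooth_sine smooth_shift_power])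
  qed
  from annihilates_modes_imp_AE_zero[OF this]
  have "AE z in plate_measure l. u z = (c * (2 / pi)) * sep (sine m) (G 0) z"
    by eventually_elim (simp add: w_def sep_def)
  then show "\<exists>c. AE z in plate_measure l. u z = c * sep (sine m) (G 0) z" by blast
qed

text \<open>A mode contributes only if \<open>\<kappa> m\<^sup>4 < \<mu>\<close>, because the transverse eigenvalue is positive. So the
  expansion in modes is a finite sum.\<close>

theorem eigenfunction_mode_decomposition:
  assumes u: "is_eigenfunction l \<nu> \<kappa> \<mu> u" and l: "l > 0" and \<nu>: "0 < \<nu>" "\<nu> < 1" and \<kappa>: "\<kappa> > 0"
  shows "\<exists>A w. finite A \<and>
    (\<forall>m\<in>A. m \<ge> 1 \<and> (\<exists>G. mode_eigen l \<nu> ((real m)\<^sup>2) (\<mu> - \<kappa> * real m ^ 4) G) \<and>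
       is_eigenfunction l \<nu> \<kappa> \<mu> (w m) \<and> in_mode l m (w m)) \<and>
    (AE z in plate_measure l. u z = (\<Sum>m\<in>A. w m z))"
proof -
  define E where "E m G \<longleftrightarrow> mode_eigen l \<nu> ((real m)\<^sup>2) (\<mu> - \<kappa> * real m ^ 4) G" for m G
  define B where "B = {m. m \<ge> 1 \<and> (\<exists>G. E m G)}"
  have ui: "integrable (plate_measure l) u" by (rule eigenfunction_integrable[OF u])
  have "finite B"
  proof (rule finite_subset)
    show "B \<subseteq> {..nat \<lceil>\<mu> / \<kappa>\<rceil>}"
    proof
      fix m assume "m \<in> B"
      then obtain G where m: "m \<ge> 1" and G: "mode_eigen l \<nu> ((real m)\<^sup>2) (\<mu> - \<kappa> * real m ^ 4) G"
        unfolding B_def E_def by blast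
      have "(real m)\<^sup>2 > 0" using m by simp
      from eigen_lower_bound_pos[OF G l this \<nu>] have "\<kappa> * real m ^ 4 < \<mu>" by simp
      moreover have "\<kappa> * real m \<le> \<kappa> * real m ^ 4"
        using m \<kappa> power_increasing[of 1 4 "real m"] by (intro mult_left_mono) auto
      ultimately have "\<kappa> * real m < \<mu>" by linarith
      then have "real m < \<mu> / \<kappa>" using \<kappa> by (simp add: pos_less_divide_eq mult.commute)
      then have "real m \<le> real_of_int \<lceil>\<mu> / \<kappa>\<rceil>" using le_of_int_ceiling[of "\<mu> / \<kappa>"] by linarith
      then show "m \<in> {..nat \<lceil>\<mu> / \<kappa>\<rceil>}" by (simp add: le_nat_iff)
    qed
  qed simp
  have "\<exists>G c. E m G \<and> (\<forall>j. plate_int l u (sine m) (\<lambda>y. (y + l) ^ j) = c * integral {-l..l} (\<lambda>y. (y + l) ^ j * G 0 y))"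
    if "m \<in> B" for m
  proof -
    have m: "m \<ge> 1" and "\<exists>G. E m G" using that unfolding B_def by simp_all
    then obtain G where G: "E m G" by (elim exE)
    have "\<exists>c. \<forall>j. plate_int l u (sine m) (\<lambda>y. (y + l) ^ j) = c * integral {-l..l} (\<lambda>y. (y + l) ^ j * G 0 y)"
      by (rule eigenfunction_coefficient_resonant[OF u G[unfolded E_def] l m \<nu>]) simp
    then show ?thesis using G by blast
  qed
  then obtain G c where G: "\<And>m. m \<in> B \<Longrightarrow> E m (G m)"
    and c: "\<And>m j. m \<in> B \<Longrightarrow> plate_int l u (sine m) (\<lambda>y. (y + l) ^ j) = c m * integral {-l..l} (\<lambda>y. (y + l) ^ j * G m 0 y)"
    by metis
  have sG: "smooth (G m 0)" if "m \<in> B" for m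
    using G[OF that] unfolding E_def mode_eigen_def by (auto intro: tower_smooth dest: mode_odeD(1))
  define w where "w m = sep (sine m) (\<lambda>y. c m * (2 / pi) * G m 0 y)" for m
  have wi: "integrable (plate_measure l) (w m)" if "m \<in> B" for m
    unfolding w_def by (intro L2_on_integrable L2_on_sep smooth_sine smooth_mult smooth_const sG that)
  have si: "integrable (plate_measure l) (\<lambda>z. \<Sum>m\<in>B. w m z)"
    by (rule Bochner_Integration.integrable_sum) (rule wi)
  have "annihilates_modes l (\<lambda>z. u z - (\<Sum>m\<in>B. w m z))"
    unfolding annihilates_modes_def
  proof (intro conjI allI impI)
    show "integrable (plate_measure l) (\<lambda>z. u z - (\<Sum>m\<in>B. w m z))" using ui si by simp
    fix k j :: nat assume k: "k \<ge> 1"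
    let ?q = "\<lambda>y. (y + l) ^ j"
    have "plate_int l (\<lambda>z. \<Sum>m\<in>B. w m z) (sine k) ?q = (\<Sum>m\<in>B. plate_int l (w m) (sine k) ?q)"
      by (rule plate_int_sum_fun[OF \<open>finite B\<close> wi smooth_sine smooth_shift_power])
    also have "\<dots> = (\<Sum>m\<in>B. if m = k then c m * integral {-l..l} (\<lambda>y. ?q y * G m 0 y) else 0)"
    proof (rule sum.cong)
      fix m assume m: "m \<in> B"
      then have "m \<ge> 1" by (simp add: B_def)
      then show "plate_int l (w m) (sine k) ?q = (if m = k then c m * integral {-l..l} (\<lambda>y. ?q y * G m 0 y) else 0)"
        unfolding w_def by (rule plate_int_mode_component[OF sG[OF m] l _ k])
    qed simp
    also have "\<dots> = (if k \<in> B then c k * integral {-l..l} (\<lambda>y. ?q y * G k 0 y) else 0)"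
      using \<open>finite B\<close> by (simp add: sum.delta')
    also have "\<dots> = plate_int l u (sine k) ?q"
    proof (cases "k \<in> B")
      case False
      then have "\<not> (\<exists>G. mode_eigen l \<nu> ((real k)\<^sup>2) (\<mu> - \<kappa> * real k ^ 4) G)" using k by (simp add: B_def E_def)
      then show ?thesis using False eigenfunction_coefficient_nonresonant[OF u _ l, of k "\<mu> - \<kappa> * real k ^ 4" j] by simp
    qed (simp add: c)
    finally show "plate_int l (\<lambda>z. u z - (\<Sum>m\<in>B. w m z)) (sine k) ?q = 0"
      by (simp add: plate_int_diff_left[OF ui si smooth_sine smooth_shift_power])
  qed
  from annihilates_modes_imp_AE_zero[OF this]
  have ae: "AE z in plate_measure l. u z = (\<Sum>m\<in>B. w m z)" by eventually_elim simp
  define A where "A = {m \<in> B. c m \<noteq> 0}"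
  have "(\<Sum>m\<in>B. w m z) = (\<Sum>m\<in>A. w m z)" for z
    unfolding A_def using \<open>finite B\<close>
    by (intro sum.mono_neutral_right) (auto simp: w_def sep_def)
  with ae have ae: "AE z in plate_measure l. u z = (\<Sum>m\<in>A. w m z)" by simp
  have "m \<ge> 1 \<and> (\<exists>G. mode_eigen l \<nu> ((real m)\<^sup>2) (\<mu> - \<kappa> * real m ^ 4) G) \<and>
       is_eigenfunction l \<nu> \<kappa> \<mu> (w m) \<and> in_mode l m (w m)" if m: "m \<in> A" for m
  proof -
    have mB: "m \<in> B" and cm: "c m * (2 / pi) \<noteq> 0" using m by (auto simp: A_def)
    then have m1: "m \<ge> 1" by (simp add: B_def)
    note Gm = G[OF mB, unfolded E_def]
    have "is_eigenfunction l \<nu> \<kappa> \<mu> (sep (sine m) ((\<lambda>k y. c m * (2 / pi) * G m k y) 0))"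
      by (rule mode_imp_eigenfunction[OF mode_eigen_scale[OF Gm cm] l m1 \<nu>]) simp
    then show ?thesis using m1 Gm by (auto simp: w_def in_mode_sep)
  qed
  moreover have "finite A" using \<open>finite B\<close> by (simp add: A_def)
  ultimately show ?thesis using ae by blast
qed

section \<open>Characteristic equations\<close>

text \<open>The solutions of \<open>g'' = \<theta> g\<close> with data \<open>(1, 0)\<close> and \<open>(0, 1)\<close>; in this form the solution is the
  same expression for positive, zero and negative \<open>\<theta>\<close>; with \<open>\<theta> = M - r\<close> these cases lie below, at and
  above the threshold.\<close>

definition gcosh :: "real \<Rightarrow> real \<Rightarrow> real" where
  "gcosh \<theta> y = (if \<theta> > 0 then cosh (sqrt \<theta> * y) else if \<theta> = 0 then 1 else cos (sqrt (- \<theta>) * y))"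

definition gsinh :: "real \<Rightarrow> real \<Rightarrow> real" where
  "gsinh \<theta> y = (if \<theta> > 0 then sinh (sqrt \<theta> * y) / sqrt \<theta> else if \<theta> = 0 then y
     else sin (sqrt (- \<theta>) * y) / sqrt (- \<theta>))"

lemma gcosh_has_deriv: "(gcosh \<theta> has_real_derivative \<theta> * gsinh \<theta> y) (at y)"
proof (cases \<theta> "0::real" rule: linorder_cases)
  case less
  have "((\<lambda>y. cos (sqrt (- \<theta>) * y)) has_real_derivative - sqrt (- \<theta>) * sin (sqrt (- \<theta>) * y)) (at y)"
    by (auto intro!: derivative_eq_intros)
  moreover have "- sqrt (- \<theta>) * s = \<theta> * (s / sqrt (- \<theta>))" for s
    using less by (simp add: field_simps)
  ultimately show ?thesis using less by (simp add: gcosh_def[abs_def] gsinh_def)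
next
  case greater
  have "((\<lambda>y. cosh (sqrt \<theta> * y)) has_real_derivative sqrt \<theta> * sinh (sqrt \<theta> * y)) (at y)"
    by (auto intro!: derivative_eq_intros)
  moreover have "sqrt \<theta> * s = \<theta> * (s / sqrt \<theta>)" for s
    using greater by (simp add: field_simps)
  ultimately show ?thesis using greater by (simp add: gcosh_def[abs_def] gsinh_def)
qed (simp add: gcosh_def[abs_def] gsinh_def)

lemma gsinh_has_deriv: "(gsinh \<theta> has_real_derivative gcosh \<theta> y) (at y)"
proof (cases \<theta> "0::real" rule: linorder_cases)
  case less
  define s where "s = sqrt (- \<theta>)"
  have "((\<lambda>y. sin (s * y) / s) has_real_derivative cos (s * y) * s / s) (at y)"
    by (auto intro!: derivative_eq_intros)
  moreover have "s \<noteq> 0" using less by (simp add: s_def)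
  ultimately have "((\<lambda>y. sin (sqrt (- \<theta>) * y) / sqrt (- \<theta>)) has_real_derivative cos (sqrt (- \<theta>) * y)) (at y)"
    unfolding s_def[symmetric] by simp
  then show ?thesis using less by (simp add: gcosh_def gsinh_def[abs_def])
next
  case greater
  define s where "s = sqrt \<theta>"
  have "((\<lambda>y. sinh (s * y) / s) has_real_derivative cosh (s * y) * s / s) (at y)"
    by (auto intro!: derivative_eq_intros)
  moreover have "s \<noteq> 0" using greater by (simp add: s_def)
  ultimately have "((\<lambda>y. sinh (sqrt \<theta> * y) / sqrt \<theta>) has_real_derivative cosh (sqrt \<theta> * y)) (at y)"
    unfolding s_def[symmetric] by simp
  then show ?thesis using greater by (simp add: gcosh_def gsinh_def[abs_def])
qed (simp add: gcosh_def gsinh_def[abs_def])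

lemma gcosh_0 [simp]: "gcosh \<theta> 0 = 1" and gsinh_0 [simp]: "gsinh \<theta> 0 = 0"
  by (simp_all add: gcosh_def gsinh_def)

lemma gcosh_minus: "gcosh \<theta> (- y) = gcosh \<theta> y" and gsinh_minus: "gsinh \<theta> (- y) = - gsinh \<theta> y"
  by (simp_all add: gcosh_def gsinh_def)

lemma gcosh_pos: "\<theta> \<ge> 0 \<Longrightarrow> gcosh \<theta> y > 0"
  by (auto simp: gcosh_def)

lemma gsinh_pos: "\<theta> \<ge> 0 \<Longrightarrow> y > 0 \<Longrightarrow> gsinh \<theta> y > 0"
  by (auto simp: gsinh_def)

definition gcosh_tower :: "real \<Rightarrow> nat \<Rightarrow> real \<Rightarrow> real" where
  "gcosh_tower \<theta> k y = \<theta> ^ ((k + 1) div 2) * (if even k then gcosh \<theta> y else gsinh \<theta> y)"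

definition gsinh_tower :: "real \<Rightarrow> nat \<Rightarrow> real \<Rightarrow> real" where
  "gsinh_tower \<theta> k y = \<theta> ^ (k div 2) * (if even k then gsinh \<theta> y else gcosh \<theta> y)"

lemma tower_gcosh: "tower (gcosh_tower \<theta>)"
  unfolding tower_def
proof (intro allI)
  fix k t
  show "(gcosh_tower \<theta> k has_real_derivative gcosh_tower \<theta> (Suc k) t) (at t)"
  proof (cases "even k")
    case True
    then show ?thesis using DERIV_cmult[OF gcosh_has_deriv, of "\<theta> ^ ((k + 1) div 2)" \<theta> t]
      by (auto simp: gcosh_tower_def[abs_def] elim!: evenE simp: mult_ac)
  next
    case False
    then show ?thesis using DERIV_cmult[OF gsinh_has_deriv, of "\<theta> ^ ((k + 1) div 2)" \<theta> t]
      by (auto simp: gcosh_tower_def[abs_def] elim!: oddE)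
  qed
qed

lemma tower_gsinh: "tower (gsinh_tower \<theta>)"
  unfolding tower_def
proof (intro allI)
  fix k t
  show "(gsinh_tower \<theta> k has_real_derivative gsinh_tower \<theta> (Suc k) t) (at t)"
  proof (cases "even k")
    case True
    then show ?thesis using DERIV_cmult[OF gsinh_has_deriv, of "\<theta> ^ (k div 2)" \<theta> t]
      by (auto simp: gsinh_tower_def[abs_def] elim!: evenE)
  next
    case False
    then show ?thesis using DERIV_cmult[OF gcosh_has_deriv, of "\<theta> ^ (k div 2)" \<theta> t]
      by (auto simp: gsinh_tower_def[abs_def] elim!: oddE simp: mult_ac)
  qed
qed

lemma gtower_values:
  "gcosh_tower \<theta> 0 y = gcosh \<theta> y" "gcosh_tower \<theta> 1 y = \<theta> * gsinh \<theta> y"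
  "gcosh_tower \<theta> 2 y = \<theta> * gcosh \<theta> y" "gcosh_tower \<theta> 3 y = \<theta>\<^sup>2 * gsinh \<theta> y"
  "gcosh_tower \<theta> 4 y = \<theta>\<^sup>2 * gcosh \<theta> y"
  "gsinh_tower \<theta> 0 y = gsinh \<theta> y" "gsinh_tower \<theta> 1 y = gcosh \<theta> y"
  "gsinh_tower \<theta> 2 y = \<theta> * gsinh \<theta> y" "gsinh_tower \<theta> 3 y = \<theta> * gcosh \<theta> y"
  "gsinh_tower \<theta> 4 y = \<theta>\<^sup>2 * gsinh \<theta> y"
  by (simp_all add: gcosh_tower_def gsinh_tower_def)

text \<open>The general solution for \<open>\<rho> = r\<^sup>2\<close>. The factors \<open>1\<close> make it literally a linear combination of
  two towers.\<close>

definition gsol :: "real \<Rightarrow> real \<Rightarrow> real \<Rightarrow> real \<Rightarrow> real \<Rightarrow> real \<Rightarrow> nat \<Rightarrow> real \<Rightarrow> real" where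
  "gsol M r A B C D = (\<lambda>k y. 1 * (A * gcosh_tower (M + r) k y + B * gsinh_tower (M + r) k y)
     + 1 * (C * gcosh_tower (M - r) k y + D * gsinh_tower (M - r) k y))"

lemma mode_ode_gsol: "mode_ode M (r\<^sup>2) (\<lambda>_. 0) (gsol M r A B C D)"
  unfolding mode_ode_def
proof (intro conjI allI)
  show "tower (gsol M r A B C D)" unfolding gsol_def
    by (intro tower_lincomb tower_gcosh tower_gsinh)
  show "gsol M r A B C D 4 y - 2 * M * gsol M r A B C D 2 y + (M\<^sup>2 - r\<^sup>2) * gsol M r A B C D 0 y = 0" for y
    unfolding gsol_def gtower_values by (simp add: power2_eq_square algebra_simps)
qed

lemma gsol_0: "gsol M r A B C D 0 y =
    A * gcosh (M + r) y + B * gsinh (M + r) y + (C * gcosh (M - r) y + D * gsinh (M - r) y)"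
  by (simp add: gsol_def gtower_values)

lemma mode_ode_is_gsol:
  assumes F: "mode_ode M (r\<^sup>2) (\<lambda>_. 0) F" and r: "r \<noteq> 0"
  shows "\<exists>A B C D. \<forall>k. F k = gsol M r A B C D k"
proof -
  define p q where "p = M + r" and "q = M - r"
  have pq: "p - q \<noteq> 0" using r by (simp add: p_def q_def)
  define A where "A = (F 2 0 - q * F 0 0) / (p - q)"
  define C where "C = (p * F 0 0 - F 2 0) / (p - q)"
  define B where "B = (F 3 0 - q * F 1 0) / (p - q)"
  define D where "D = (p * F 1 0 - F 3 0) / (p - q)"
  have e: "A + C = F 0 0" "p * A + q * C = F 2 0" "B + D = F 1 0" "p * B + q * D = F 3 0"
  proof -
    have k: "A * (p - q) = F 2 0 - q * F 0 0" "C * (p - q) = p * F 0 0 - F 2 0"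
      "B * (p - q) = F 3 0 - q * F 1 0" "D * (p - q) = p * F 1 0 - F 3 0"
      using pq by (simp_all add: A_def B_def C_def D_def)
    have c: "x = y" if "x * (p - q) = y * (p - q)" for x y using that pq by simp
    have "(A + C) * (p - q) = A * (p - q) + C * (p - q)" by (simp add: algebra_simps)
    also have "\<dots> = F 0 0 * (p - q)" unfolding k by (simp add: algebra_simps)
    finally show "A + C = F 0 0" by (rule c)
    have "(p * A + q * C) * (p - q) = p * (A * (p - q)) + q * (C * (p - q))" by (simp add: algebra_simps)
    also have "\<dots> = F 2 0 * (p - q)" unfolding k by (simp add: algebra_simps)
    finally show "p * A + q * C = F 2 0" by (rule c)
    have "(B + D) * (p - q) = B * (p - q) + D * (p - q)" by (simp add: algebra_simps)
    also have "\<dots> = F 1 0 * (p - q)" unfolding k by (simp add: algebra_simps)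
    finally show "B + D = F 1 0" by (rule c)
    have "(p * B + q * D) * (p - q) = p * (B * (p - q)) + q * (D * (p - q))" by (simp add: algebra_simps)
    also have "\<dots> = F 3 0 * (p - q)" unfolding k by (simp add: algebra_simps)
    finally show "p * B + q * D = F 3 0" by (rule c)
  qed
  have v: "gsol M r A B C D 0 0 = A + C" "gsol M r A B C D 1 0 = B + D"
    "gsol M r A B C D 2 0 = p * A + q * C" "gsol M r A B C D 3 0 = p * B + q * D"
    unfolding gsol_def gtower_values by (simp_all add: p_def q_def mult.commute)
  have "F 0 = gsol M r A B C D 0"
    by (rule mode_ode_unique[OF F mode_ode_gsol, of 0]) (simp_all only: v e)
  then have "F k = gsol M r A B C D k" for k
    by (rule tower_eq[OF mode_odeD(1)[OF F] mode_odeD(1)[OF mode_ode_gsol]])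
  then show ?thesis by blast
qed

text \<open>Up to sign, the determinants of the edge conditions on the even and on the odd solutions.\<close>

definition even_char :: "real \<Rightarrow> real \<Rightarrow> real \<Rightarrow> real \<Rightarrow> real" where
  "even_char l \<nu> M r = (r + (1 - \<nu>) * M)\<^sup>2 * ((M - r) * gsinh (M - r) l) * gcosh (M + r) l
     - (r - (1 - \<nu>) * M)\<^sup>2 * ((M + r) * gsinh (M + r) l) * gcosh (M - r) l"

definition odd_char :: "real \<Rightarrow> real \<Rightarrow> real \<Rightarrow> real \<Rightarrow> real" where
  "odd_char l \<nu> M r = (r + (1 - \<nu>) * M)\<^sup>2 * gcosh (M - r) l * gsinh (M + r) l
     - (r - (1 - \<nu>) * M)\<^sup>2 * gcosh (M + r) l * gsinh (M - r) l"

lemma gsol_edge: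
  "edge_moment \<nu> M (gsol M r A B C D) y =
     (r + (1 - \<nu>) * M) * (A * gcosh (M + r) y + B * gsinh (M + r) y)
     - (r - (1 - \<nu>) * M) * (C * gcosh (M - r) y + D * gsinh (M - r) y)"
  "edge_force \<nu> M (gsol M r A B C D) y =
     (r - (1 - \<nu>) * M) * (A * ((M + r) * gsinh (M + r) y) + B * gcosh (M + r) y)
     - (r + (1 - \<nu>) * M) * (C * ((M - r) * gsinh (M - r) y) + D * gcosh (M - r) y)"
  unfolding edge_moment_def edge_force_def gsol_def gtower_values
  by (simp_all add: algebra_simps power2_eq_square)

text \<open>The coefficients make the moment vanish; then the shear force at the edge is, up to sign, the
  determinant.\<close>

lemma even_eigen:
  assumes e: "even_char l \<nu> M r = 0" and l: "l > 0" and M: "M > 0" and r: "r > 0" and \<nu>: "\<nu> < 1"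
  shows "mode_eigen l \<nu> M (r\<^sup>2) (gsol M r ((r - (1 - \<nu>) * M) * gcosh (M - r) l) 0 ((r + (1 - \<nu>) * M) * gcosh (M + r) l) 0)"
    (is "mode_eigen l \<nu> M _ ?F")
  unfolding mode_eigen_def
proof (intro conjI)
  show ode: "mode_ode M (r\<^sup>2) (\<lambda>_. 0) ?F" by (rule mode_ode_gsol)
  have f: "edge_force \<nu> M ?F l = - even_char l \<nu> M r"
    unfolding gsol_edge even_char_def by (simp add: algebra_simps power2_eq_square)
  have m: "edge_moment \<nu> M ?F l = 0" unfolding gsol_edge by (simp add: algebra_simps)
  show "free_edge \<nu> M ?F l" unfolding free_edge_iff m f e by simp
  have "edge_moment \<nu> M ?F (-l) = edge_moment \<nu> M ?F l" "edge_force \<nu> M ?F (-l) = - edge_force \<nu> M ?F l"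
    unfolding gsol_edge gcosh_minus gsinh_minus by (simp_all add: algebra_simps)
  then show "free_edge \<nu> M ?F (-l)" unfolding free_edge_iff using m f e by simp
  show "\<exists>y. ?F 0 y \<noteq> 0"
  proof (rule ccontr)
    assume "\<not> ?thesis"
    then have z: "?F 0 = (\<lambda>_. 0)" by blast
    then have "?F 2 = (\<lambda>_. 0)"
      using tower_eq[OF mode_odeD(1)[OF ode], of "\<lambda>k y. 0" 2] by (simp add: tower_def)
    then have "?F 2 0 - (M + r) * ?F 0 0 = 0" using z by simp
    then have "r * ((r + (1 - \<nu>) * M) * gcosh (M + r) l) = 0"
      unfolding gsol_def gtower_values by (simp add: algebra_simps)
    moreover have "r + (1 - \<nu>) * M > 0" using r M \<nu> by (intro add_pos_pos mult_pos_pos) auto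
    ultimately show False using r M gcosh_pos[of "M + r" l] by simp
  qed
qed

lemma odd_eigen:
  assumes e: "odd_char l \<nu> M r = 0" and l: "l > 0" and M: "M > 0" and r: "r > 0" and \<nu>: "\<nu> < 1"
  shows "mode_eigen l \<nu> M (r\<^sup>2) (gsol M r 0 ((r - (1 - \<nu>) * M) * gsinh (M - r) l) 0 ((r + (1 - \<nu>) * M) * gsinh (M + r) l))"
    (is "mode_eigen l \<nu> M _ ?F")
  unfolding mode_eigen_def
proof (intro conjI)
  show ode: "mode_ode M (r\<^sup>2) (\<lambda>_. 0) ?F" by (rule mode_ode_gsol)
  have f: "edge_force \<nu> M ?F l = - odd_char l \<nu> M r"
    unfolding gsol_edge odd_char_def by (simp add: algebra_simps power2_eq_square)
  have m: "edge_moment \<nu> M ?F l = 0" unfolding gsol_edge by (simp add: algebra_simps)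
  show "free_edge \<nu> M ?F l" unfolding free_edge_iff m f e by simp
  have "edge_moment \<nu> M ?F (-l) = - edge_moment \<nu> M ?F l" "edge_force \<nu> M ?F (-l) = edge_force \<nu> M ?F l"
    unfolding gsol_edge gcosh_minus gsinh_minus by (simp_all add: algebra_simps)
  then show "free_edge \<nu> M ?F (-l)" unfolding free_edge_iff using m f e by simp
  show "\<exists>y. ?F 0 y \<noteq> 0"
  proof (rule ccontr)
    assume "\<not> ?thesis"
    then have z: "?F 0 = (\<lambda>_. 0)" by blast
    then have "?F k = (\<lambda>_. 0)" for k
      using tower_eq[OF mode_odeD(1)[OF ode], of "\<lambda>k y. 0" k] by (simp add: tower_def)
    then have "?F 3 0 - (M + r) * ?F 1 0 = 0" by simp
    then have "r * ((r + (1 - \<nu>) * M) * gsinh (M + r) l) = 0"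
      unfolding gsol_def gtower_values by (simp add: algebra_simps)
    moreover have "r + (1 - \<nu>) * M > 0" using r M \<nu> by (intro add_pos_pos mult_pos_pos) auto
    ultimately show False using r M l gsinh_pos[of "M + r" l] by simp
  qed
qed

lemma det2_zero:
  fixes a b c d x y :: real
  assumes "a * x + b * y = 0" "c * x + d * y = 0" "x \<noteq> 0 \<or> y \<noteq> 0"
  shows "a * d - b * c = 0"
proof -
  have "x * (a * d - b * c) = d * (a * x + b * y) - b * (c * x + d * y)"
    "y * (a * d - b * c) = a * (c * x + d * y) - c * (a * x + b * y)" by (simp_all add: algebra_simps)
  then show ?thesis using assms by auto
qed

text \<open>Sums and differences of the conditions at the two edges decouple the even from the odd
  coefficients, and one of the two pairs is nonzero.\<close>

lemma eigen_imp_char_zero: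
  assumes F: "mode_eigen l \<nu> M (r\<^sup>2) F" and r: "r > 0"
  shows "even_char l \<nu> M r = 0 \<or> odd_char l \<nu> M r = 0"
proof -
  have ode: "mode_ode M (r\<^sup>2) (\<lambda>_. 0) F" and bc: "free_edge \<nu> M F (-l)" "free_edge \<nu> M F l"
    and nz: "\<exists>y. F 0 y \<noteq> 0"
    using F unfolding mode_eigen_def by blast+
  obtain A B C D where FG: "\<And>k. F k = gsol M r A B C D k"
    using mode_ode_is_gsol[OF ode] r by blast
  then have FG': "F = gsol M r A B C D" by blast
  define s t where "s = r + (1 - \<nu>) * M" and "t = r - (1 - \<nu>) * M"
  let ?c1 = "gcosh (M + r) l" and ?s1 = "gsinh (M + r) l" and ?c2 = "gcosh (M - r) l" and ?s2 = "gsinh (M - r) l"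
  have m: "s * (A * ?c1 + B * ?s1) - t * (C * ?c2 + D * ?s2) = 0"
    "s * (A * ?c1 - B * ?s1) - t * (C * ?c2 - D * ?s2) = 0"
    using bc unfolding free_edge_iff FG' gsol_edge gcosh_minus gsinh_minus s_def t_def by simp_all
  have f: "t * (A * ((M + r) * ?s1) + B * ?c1) - s * (C * ((M - r) * ?s2) + D * ?c2) = 0"
    "t * (- (A * ((M + r) * ?s1)) + B * ?c1) - s * (- (C * ((M - r) * ?s2)) + D * ?c2) = 0"
    using bc unfolding free_edge_iff FG' gsol_edge gcosh_minus gsinh_minus s_def t_def by simp_all
  have e: "(s * ?c1) * A + (- t * ?c2) * C = 0" "(t * ((M + r) * ?s1)) * A + (- s * ((M - r) * ?s2)) * C = 0"
    and o: "(s * ?s1) * B + (- t * ?s2) * D = 0" "(t * ?c1) * B + (- s * ?c2) * D = 0"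
    using m f by (simp_all add: algebra_simps)
  have "A \<noteq> 0 \<or> C \<noteq> 0 \<or> B \<noteq> 0 \<or> D \<noteq> 0"
    using nz unfolding FG' gsol_0 by (metis add.right_neutral mult_zero_left)
  then show ?thesis
  proof (elim disjE)
    assume "B \<noteq> 0"
    with det2_zero[OF o] show ?thesis by (simp add: odd_char_def s_def t_def power2_eq_square algebra_simps)
  next
    assume "D \<noteq> 0"
    with det2_zero[OF o] show ?thesis by (simp add: odd_char_def s_def t_def power2_eq_square algebra_simps)
  next
    assume "A \<noteq> 0"
    with det2_zero[OF e] show ?thesis by (simp add: even_char_def s_def t_def power2_eq_square algebra_simps)
  next
    assume "C \<noteq> 0"
    with det2_zero[OF e] show ?thesis by (simp add: even_char_def s_def t_def power2_eq_square algebra_simps)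
  qed
qed

section \<open>Eigenvalues below the threshold\<close>

subsection \<open>Hyperbolic inequalities\<close>

lemma sinh_ge_self: "v \<ge> 0 \<Longrightarrow> v \<le> sinh (v::real)"
proof -
  assume v: "v \<ge> 0"
  have "sinh 0 - 0 \<le> sinh v - v"
  proof (rule DERIV_nonneg_imp_nondecreasing[OF v])
    fix x :: real
    show "\<exists>y. ((\<lambda>v. sinh v - v) has_real_derivative y) (at x) \<and> 0 \<le> y"
      by (rule exI[of _ "cosh x - 1"]) (auto intro!: derivative_eq_intros simp: cosh_real_ge_1)
  qed
  then show ?thesis by simp
qed

lemma sinh_cosh_gt_self: "v > 0 \<Longrightarrow> v < sinh v * cosh (v::real)"
proof -
  assume v: "v > 0"
  have "cosh v > 1" using v cosh_real_nonneg_less_iff[of 0 v] by simp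
  then have "sinh v * 1 < sinh v * cosh v" using v by (intro mult_strict_left_mono) auto
  then show ?thesis using sinh_ge_self[of v] v by linarith
qed

lemma one_minus_tanh_squared: "1 - (tanh v)\<^sup>2 = 1 / (cosh v)\<^sup>2" for v :: real
proof -
  have "(cosh v)\<^sup>2 - (sinh v)\<^sup>2 = 1" by (simp add: cosh_square_eq)
  moreover have "(cosh v)\<^sup>2 \<noteq> 0" by simp
  ultimately show ?thesis by (simp add: tanh_def power_divide divide_simps)
qed

lemma tanh_over_self_deriv:
  assumes "v > 0"
  shows "((\<lambda>v. tanh v / v) has_real_derivative (v * (1 - (tanh v)\<^sup>2) - tanh v) / v\<^sup>2) (at v)"
  using assms by (auto intro!: derivative_eq_intros simp: power2_eq_square mult.commute)

lemma tanh_gt_self_times: "v > 0 \<Longrightarrow> v * (1 - (tanh v)\<^sup>2) < tanh (v::real)"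
proof -
  assume v: "v > 0"
  have c: "(cosh v)\<^sup>2 > 0" by simp
  have "v / (cosh v)\<^sup>2 < (sinh v * cosh v) / (cosh v)\<^sup>2"
    using sinh_cosh_gt_self[OF v] c by (rule divide_strict_right_mono)
  also have "\<dots> = tanh v" by (simp add: tanh_def power2_eq_square)
  finally show ?thesis by (simp add: one_minus_tanh_squared)
qed

lemma tanh_over_self_strict_antimono:
  assumes "0 < u" "u < v"
  shows "tanh v / v < tanh u / (u::real)"
proof (rule DERIV_neg_imp_decreasing[OF assms(2)])
  fix x assume "u \<le> x" "x \<le> v"
  then have x: "x > 0" using assms by simp
  have "(x * (1 - (tanh x)\<^sup>2) - tanh x) / x\<^sup>2 < 0"
    using tanh_gt_self_times[OF x] x by (intro divide_neg_pos) auto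
  then show "\<exists>y. ((\<lambda>v. tanh v / v) has_real_derivative y) (at x) \<and> y < 0"
    using tanh_over_self_deriv[OF x] by blast
qed

text \<open>This inequality states that the derivative of \<open>\<surd>\<theta> coth (\<surd>\<theta> l)\<close> is decreasing in \<open>\<theta>\<close>. The
  difference of the two sides and its derivative vanish at zero, and its second derivative is
  nonnegative.\<close>

lemma sinh_squared_bound:
  assumes "v \<ge> 0"
  shows "2 * v\<^sup>2 \<le> (sinh v)\<^sup>2 + v * tanh (v::real)"
proof -
  define F where "F v = (sinh v)\<^sup>2 + v * tanh v - 2 * v\<^sup>2" for v :: real
  define F1 where "F1 v = 2 * sinh v * cosh v + (tanh v + v * (1 - (tanh v)\<^sup>2)) - 4 * v" for v :: real
  define F2 where "F2 v = 2 * ((cosh v)\<^sup>2 + (sinh v)\<^sup>2) + (2 * (1 - (tanh v)\<^sup>2) - 2 * v * tanh v * (1 - (tanh v)\<^sup>2)) - 4" for v :: real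
  have d1: "(F has_real_derivative F1 v) (at v)" for v
    unfolding F_def[abs_def] F1_def by (auto intro!: derivative_eq_intros simp: algebra_simps)
  have d2: "(F1 has_real_derivative F2 v) (at v)" for v
    unfolding F1_def[abs_def] F2_def by (auto intro!: derivative_eq_intros simp: algebra_simps power2_eq_square)
  have F2: "F2 v \<ge> 0" if v: "v \<ge> 0" for v
  proof -
    define s t where "s = sinh v" and "t = tanh v"
    have s: "0 \<le> v" "v \<le> s" "0 \<le> s" using v sinh_ge_self[OF v] by (auto simp: s_def)
    have t: "0 \<le> t" "t \<le> s" "0 \<le> 1 - t\<^sup>2" "1 - t\<^sup>2 \<le> 1"
    proof -
      show "0 \<le> t" using v by (simp add: t_def)
      have "sinh v / cosh v \<le> sinh v / 1" using v cosh_real_ge_1[of v] by (intro divide_left_mono) auto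
      then show "t \<le> s" by (simp add: s_def t_def tanh_def)
      show "0 \<le> 1 - t\<^sup>2" by (simp add: t_def one_minus_tanh_squared)
    qed simp
    have "v * t * (1 - t\<^sup>2) \<le> s * s * 1"
      using s t by (intro mult_mono) auto
    moreover have "t\<^sup>2 \<le> s\<^sup>2" using t by (intro power_mono) auto
    moreover have "F2 v = 4 * s\<^sup>2 - 2 * t\<^sup>2 - 2 * (v * t * (1 - t\<^sup>2))"
      unfolding F2_def s_def[symmetric] t_def[symmetric] cosh_square_eq by (simp add: s_def[symmetric] algebra_simps)
    ultimately show ?thesis by (simp add: power2_eq_square)
  qed
  have F1: "F1 v \<ge> 0" if v: "v \<ge> 0" for v
  proof -
    have "F1 0 \<le> F1 v"
    proof (rule DERIV_nonneg_imp_nondecreasing[OF v])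
      fix x assume "0 \<le> x" "x \<le> v"
      then show "\<exists>y. (F1 has_real_derivative y) (at x) \<and> 0 \<le> y" using d2 F2 by blast
    qed
    then show ?thesis by (simp add: F1_def)
  qed
  have "F 0 \<le> F v"
  proof (rule DERIV_nonneg_imp_nondecreasing[OF assms])
    fix x assume "0 \<le> x" "x \<le> v"
    then show "\<exists>y. (F has_real_derivative y) (at x) \<and> 0 \<le> y" using d1 F1 by blast
  qed
  then show ?thesis by (simp add: F_def)
qed

subsection \<open>Concave profiles\<close>

text \<open>Concavity in the form of decreasing increments.\<close>

definition concave_profile :: "(real \<Rightarrow> real) \<Rightarrow> bool" where
  "concave_profile g \<longleftrightarrow> continuous_on {0..} g \<and> g 0 \<ge> 0 \<and> (\<forall>x>0. g x > 0) \<and>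
     (\<forall>x y. 0 \<le> x \<longrightarrow> x \<le> y \<longrightarrow> g x \<le> g y) \<and>
     (\<forall>x y h. 0 \<le> x \<longrightarrow> x \<le> y \<longrightarrow> 0 \<le> h \<longrightarrow> g (y + h) - g y \<le> g (x + h) - g x)"

lemma concave_profileI:
  assumes c: "continuous_on {0..} g" and "g 0 \<ge> 0" and "\<And>x. x > 0 \<Longrightarrow> g x > 0"
    and d: "\<And>x. x > 0 \<Longrightarrow> (g has_real_derivative g' x) (at x)"
    and pos: "\<And>x. x > 0 \<Longrightarrow> g' x \<ge> 0"
    and anti: "\<And>x y. 0 < x \<Longrightarrow> x \<le> y \<Longrightarrow> g' y \<le> g' x"
  shows "concave_profile g"
proof -
  have "g x \<le> g y" if "0 \<le> x" "x \<le> y" for x y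
  proof (rule DERIV_nonneg_imp_increasing_open[OF that(2)])
    show "continuous_on {x..y} g" using that by (intro continuous_on_subset[OF c]) auto
    fix t assume "x < t" "t < y"
    then show "\<exists>z. (g has_real_derivative z) (at t) \<and> 0 \<le> z" using d[of t] pos[of t] that by auto
  qed
  moreover have "g (y + h) - g y \<le> g (x + h) - g x" if xy: "0 \<le> x" "x \<le> y" and h: "0 \<le> h" for x y h
  proof (rule DERIV_nonpos_imp_decreasing_open[OF xy(2), of "\<lambda>t. g (t + h) - g t"])
    show "continuous_on {x..y} (\<lambda>t. g (t + h) - g t)"
      using xy h by (intro continuous_on_diff continuous_on_compose2[OF c] continuous_on_subset[OF c] continuous_intros) auto
    fix t assume t: "x < t" "t < y"
    then have "((\<lambda>t. g (t + h) - g t) has_real_derivative g' (t + h) * 1 - g' t) (at t)"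
      using xy h by (intro DERIV_diff d DERIV_chain2[OF d]) (auto intro!: derivative_eq_intros)
    moreover have "g' (t + h) * 1 - g' t \<le> 0" using anti[of t "t + h"] t xy h by simp
    ultimately show "\<exists>z. ((\<lambda>t. g (t + h) - g t) has_real_derivative z) (at t) \<and> z \<le> 0" by blast
  qed
  ultimately show ?thesis using assms unfolding concave_profile_def by blast
qed

text \<open>The equation \<open>g (M - r) / g (M + r) = ((r - a M) / (r + a M))\<^sup>2\<close> cleared of denominators.\<close>

definition gap :: "real \<Rightarrow> (real \<Rightarrow> real) \<Rightarrow> real \<Rightarrow> real \<Rightarrow> real" where
  "gap a g M r = (r + a * M)\<^sup>2 * g (M - r) - (r - a * M)\<^sup>2 * g (M + r)"

text \<open>As \<open>r\<close> increases, \<open>g (M - r) / g (M + r)\<close> does not increase and \<open>(r - a M) / (r + a M)\<close>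
  strictly increases, so once the gap is nonpositive it is negative from there on.\<close>

lemma gap_decreasing:
  assumes g: "concave_profile g" and a: "a > 0" and M: "M > 0" and r: "a * M < r" "r < r'" "r' \<le> M"
    and z: "gap a g M r \<le> 0"
  shows "gap a g M r' < 0"
proof -
  have gp: "g (M - r) > 0" and gp': "g (M + r') > 0" and g1: "g (M - r') \<le> g (M - r)" and g2: "g (M + r) \<le> g (M + r')"
    using g a M r mult_pos_pos[OF a M] unfolding concave_profile_def by auto
  have aM: "a * M > 0" using a M by simp
  define X where "X = ((r - a * M) * (r' + a * M))\<^sup>2"
  define Y where "Y = ((r + a * M) * (r' - a * M))\<^sup>2"
  have "(r - a * M) * (r' + a * M) < (r + a * M) * (r' - a * M)"
  proof -
    have "(r + a * M) * (r' - a * M) - (r - a * M) * (r' + a * M) = 2 * ((a * M) * (r' - r))"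
      by (simp add: algebra_simps)
    moreover have "(a * M) * (r' - r) > 0" using aM r by simp
    ultimately show ?thesis by linarith
  qed
  moreover have "0 \<le> (r - a * M) * (r' + a * M)" using r aM by simp
  ultimately have XY: "X < Y" unfolding X_def Y_def by (intro power_strict_mono) auto
  have "(r - a * M)\<^sup>2 * ((r' + a * M)\<^sup>2 * g (M - r')) = X * g (M - r')" by (simp add: X_def power_mult_distrib)
  also have "\<dots> \<le> X * g (M - r)" using g1 by (intro mult_left_mono) (auto simp: X_def)
  also have "\<dots> < Y * g (M - r)" using XY gp by (rule mult_strict_right_mono)
  also have "\<dots> = (r' - a * M)\<^sup>2 * ((r + a * M)\<^sup>2 * g (M - r))" by (simp add: Y_def power_mult_distrib)
  also have "\<dots> \<le> (r' - a * M)\<^sup>2 * ((r - a * M)\<^sup>2 * g (M + r))"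
    using z by (intro mult_left_mono) (auto simp: gap_def)
  also have "\<dots> \<le> (r' - a * M)\<^sup>2 * ((r - a * M)\<^sup>2 * g (M + r'))"
    using g2 by (intro mult_left_mono) auto
  finally have "(r - a * M)\<^sup>2 * ((r' + a * M)\<^sup>2 * g (M - r')) < (r - a * M)\<^sup>2 * ((r' - a * M)\<^sup>2 * g (M + r'))"
    by (simp add: mult_ac)
  then have "(r' + a * M)\<^sup>2 * g (M - r') < (r' - a * M)\<^sup>2 * g (M + r')"
    using r by (simp add: mult_less_cancel_left_pos)
  then show ?thesis by (simp add: gap_def)
qed

lemma gap_root:
  assumes g: "concave_profile g" and a: "0 < a" "a < 1" and M: "M > 0" and z: "gap a g M M < 0"
  shows "\<exists>!r. a * M < r \<and> r < M \<and> gap a g M r = 0"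
proof -
  have aM: "0 < a * M" "a * M < M" using a M by auto
  have c: "continuous_on {0..} g" using g unfolding concave_profile_def by blast
  have "continuous_on {a * M..M} (gap a g M)"
    unfolding gap_def[abs_def] using aM
    by (intro continuous_on_diff continuous_on_mult continuous_on_compose2[OF c] continuous_intros) auto
  moreover have p: "gap a g M (a * M) > 0"
  proof -
    have "g (M - a * M) > 0" using g aM unfolding concave_profile_def by simp
    then have "(a * M + a * M)\<^sup>2 * g (M - a * M) > 0" using aM by (intro mult_pos_pos) auto
    moreover have "gap a g M (a * M) = (a * M + a * M)\<^sup>2 * g (M - a * M)" by (simp add: gap_def)
    ultimately show ?thesis by (simp only:)
  qed
  ultimately obtain r where r: "a * M \<le> r" "r \<le> M" "gap a g M r = 0"
    using IVT2'[of "gap a g M" M 0 "a * M"] aM a z by auto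
  have "r \<noteq> a * M" "r \<noteq> M" using r(3) p z by auto
  then have ex: "a * M < r \<and> r < M \<and> gap a g M r = 0" using r by auto
  moreover have "r' = r" if "a * M < r' \<and> r' < M \<and> gap a g M r' = 0" for r'
    using gap_decreasing[OF g a(1) M, of r r'] gap_decreasing[OF g a(1) M, of r' r] ex that
    by (cases r r' rule: linorder_cases) auto
  ultimately show ?thesis by blast
qed

lemma gap_no_root:
  assumes g: "concave_profile g" and a: "0 < a" and M: "M > 0" and z: "gap a g M M \<ge> 0"
    and r: "a * M < r" "r < M"
  shows "gap a g M r \<noteq> 0"
  using gap_decreasing[OF g a M r(1,2), of] z by auto

text \<open>Monotonicity of the root in \<open>M\<close>: for a positive increasing \<open>g\<close> with decreasing increments the
  quotient \<open>g (M - r) / g (M + r)\<close> grows with \<open>M\<close>, and so does \<open>(r + a M) / (r - a M)\<close>.\<close>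

lemma gap_root_increasing:
  assumes g: "concave_profile g" and a: "0 < a" "a < 1" and M: "0 < M" "M < M'"
    and r: "a * M < r" "r < M" "gap a g M r = 0"
    and r': "a * M' < r'" "r' < M'" "gap a g M' r' = 0"
  shows "r < r'"
proof (cases "r \<le> a * M'")
  case True
  then show ?thesis using r' by simp
next
  case False
  then have rM': "a * M' < r" by simp
  have aM: "a * M > 0" using a M by simp
  have mono: "g u \<le> g v" if "0 \<le> u" "u \<le> v" for u v
    using g that unfolding concave_profile_def by blast
  have conc: "g (v + h) - g v \<le> g (u + h) - g u" if "0 \<le> u" "u \<le> v" "0 \<le> h" for u v h
    using g that unfolding concave_profile_def by blast
  have posg: "g u > 0" if "u > 0" for u
    using g that unfolding concave_profile_def by blast
  have inc: "g (M + r + (M' - M)) - g (M + r) \<le> g (M - r + (M' - M)) - g (M - r)"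
    and nn: "g (M + r) \<le> g (M + r + (M' - M))" and le: "g (M - r) \<le> g (M + r)" and p1: "g (M - r) > 0" and p2: "g (M' - r) > 0" and p3: "g (M + r) > 0"
    by (rule conc mono posg; use M r aM in simp)+
  define x y d e where "x = g (M - r)" and "y = g (M + r)" and "d = g (M' - r) - x" and "e = g (M' + r) - y"
  have de: "0 \<le> e" "e \<le> d" "0 < x" "x \<le> y"
    using inc nn le p1 by (simp_all add: x_def y_def d_def e_def algebra_simps)
  have "x * e \<le> y * d" using de by (intro mult_mono) auto
  then have log: "x * (y + e) \<le> (x + d) * y" by (simp add: algebra_simps)
  have "(r + a * M) * (r - a * M') < (r + a * M') * (r - a * M)"
  proof -
    have "(r + a * M') * (r - a * M) - (r + a * M) * (r - a * M') = 2 * (a * (r * (M' - M)))"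
      by (simp add: algebra_simps)
    moreover have "a * (r * (M' - M)) > 0" using a r M aM by (intro mult_pos_pos) auto
    ultimately show ?thesis by linarith
  qed
  moreover have "0 \<le> (r + a * M) * (r - a * M')" using rM' r aM by simp
  ultimately have q: "((r + a * M) * (r - a * M'))\<^sup>2 < ((r + a * M') * (r - a * M))\<^sup>2"
    by (intro power_strict_mono) auto
  have root: "(r + a * M)\<^sup>2 * x = (r - a * M)\<^sup>2 * y" using r(3) by (simp add: gap_def x_def y_def)
  have "((r - a * M)\<^sup>2 * y) * ((r - a * M')\<^sup>2 * (y + e)) = ((r + a * M) * (r - a * M'))\<^sup>2 * (x * (y + e))"
    unfolding root[symmetric] by (simp add: power_mult_distrib mult_ac)
  also have "\<dots> \<le> ((r + a * M) * (r - a * M'))\<^sup>2 * ((x + d) * y)"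
    using log by (intro mult_left_mono) auto
  also have "\<dots> < ((r + a * M') * (r - a * M))\<^sup>2 * ((x + d) * y)"
    using q p2 p3 by (intro mult_strict_right_mono) (auto simp: x_def y_def d_def)
  also have "\<dots> = ((r - a * M)\<^sup>2 * y) * ((r + a * M')\<^sup>2 * (x + d))"
    by (simp add: power_mult_distrib mult_ac)
  finally have "(r - a * M')\<^sup>2 * (y + e) < (r + a * M')\<^sup>2 * (x + d)"
    using r p3 by (subst (asm) mult_less_cancel_left_pos) (auto simp: y_def)
  then have pos: "gap a g M' r > 0" by (simp add: gap_def x_def y_def d_def e_def)
  show ?thesis
  proof (rule ccontr)
    assume "\<not> r < r'"
    then consider "r' = r" | "r' < r" by linarith
    then show False
    proof cases
      case 1 then show False using pos r' by simp
    next
      case 2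
      then show False using gap_decreasing[OF g a(1) _ r'(1) 2, of] r r'(3) M pos by simp
    qed
  qed
qed

subsection \<open>The even and the odd profile\<close>

definition even_profile :: "real \<Rightarrow> real \<Rightarrow> real" where
  "even_profile l \<theta> = \<theta> * gsinh \<theta> l / gcosh \<theta> l"

definition odd_profile :: "real \<Rightarrow> real \<Rightarrow> real" where
  "odd_profile l \<theta> = gcosh \<theta> l / gsinh \<theta> l"

lemma even_profile_eq: "\<theta> \<ge> 0 \<Longrightarrow> even_profile l \<theta> = sqrt \<theta> * tanh (sqrt \<theta> * l)"
proof (cases "\<theta> = 0")
  case False
  assume "\<theta> \<ge> 0"
  with False have t: "\<theta> > 0" by simp
  then have "\<theta> * (x / sqrt \<theta>) = sqrt \<theta> * x" for x
    using real_sqrt_mult_self[of \<theta>] by (simp add: field_simps)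
  from this[of "sinh (sqrt \<theta> * l)"] show ?thesis using t
    by (simp add: even_profile_def gsinh_def gcosh_def tanh_def)
qed (simp add: even_profile_def)

lemma odd_profile_eq: "\<theta> > 0 \<Longrightarrow> odd_profile l \<theta> = sqrt \<theta> * (cosh (sqrt \<theta> * l) / sinh (sqrt \<theta> * l))"
  by (simp add: odd_profile_def gsinh_def gcosh_def)

lemma odd_profile_0: "odd_profile l 0 = 1 / l"
  by (simp add: odd_profile_def gsinh_def gcosh_def)

lemma concave_even_profile:
  assumes l: "l > 0" shows "concave_profile (even_profile l)"
proof (rule concave_profileI)
  define K where "K v = tanh v / v + (1 - (tanh v)\<^sup>2)" for v :: real
  have "continuous_on {0..} (\<lambda>\<theta>. sqrt \<theta> * tanh (sqrt \<theta> * l))"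
    by (intro continuous_intros) auto
  then show "continuous_on {0..} (even_profile l)"
    by (rule continuous_on_eq) (simp add: even_profile_eq)
  show "even_profile l 0 \<ge> 0" by (simp add: even_profile_def)
  show "even_profile l x > 0" if "x > 0" for x using that l by (simp add: even_profile_eq)
  show "(even_profile l has_real_derivative (l / 2) * K (sqrt x * l)) (at x)" if x: "x > 0" for x
  proof -
    define u where "u = sqrt x"
    have u: "u > 0" using x by (simp add: u_def)
    have "((\<lambda>\<theta>. sqrt \<theta> * tanh (sqrt \<theta> * l)) has_real_derivative
        (inverse u / 2) * tanh (u * l) + (1 - (tanh (u * l))\<^sup>2) * ((inverse u / 2) * l) * u) (at x)"
      unfolding u_def using x by (auto intro!: derivative_eq_intros)
    also have "(inverse u / 2) * tanh (u * l) + (1 - (tanh (u * l))\<^sup>2) * ((inverse u / 2) * l) * u = (l / 2) * K (u * l)"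
      using u l by (simp add: K_def field_simps)
    finally show ?thesis unfolding u_def
      by (rule DERIV_cong_ev[THEN iffD1, rotated 3, OF _ refl _ refl])
        (use x eventually_nhds_in_open[of "{0<..}" x] in \<open>auto simp: even_profile_eq elim!: eventually_mono\<close>)
  qed
  have anti: "K v \<le> K u" if "0 < u" "u \<le> v" for u v
  proof -
    have "tanh v / v \<le> tanh u / u"
      using that tanh_over_self_strict_antimono[of u v] by (cases "u = v") auto
    moreover have "(tanh u)\<^sup>2 \<le> (tanh v)\<^sup>2" using that by (intro power_mono) auto
    ultimately show ?thesis by (simp add: K_def)
  qed
  have "K v \<ge> 0" if "v > 0" for v
    using that by (simp add: K_def one_minus_tanh_squared)
  then show "(l / 2) * K (sqrt x * l) \<ge> 0" if "x > 0" for x using that l by simp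
  show "(l / 2) * K (sqrt y * l) \<le> (l / 2) * K (sqrt x * l)" if "0 < x" "x \<le> y" for x y
    using that l by (intro mult_left_mono anti) auto
qed

lemma odd_profile_continuous_at_0:
  assumes l: "l > 0" shows "(odd_profile l \<longlongrightarrow> odd_profile l 0) (at_right 0)"
proof -
  have "((\<lambda>u. sinh (u * l)) has_real_derivative l) (at 0)" by (auto intro!: derivative_eq_intros)
  then have "((\<lambda>u. sinh (u * l) / u) \<longlongrightarrow> l) (at 0)" by (simp add: DERIV_def)
  then have "((\<lambda>u. cosh (u * l) / (sinh (u * l) / u)) \<longlongrightarrow> cosh (0 * l) / l) (at 0)"
    using l by (intro tendsto_intros) auto
  then have lim: "((\<lambda>u. cosh (u * l) / (sinh (u * l) / u)) \<longlongrightarrow> 1 / l) (at 0)" by simp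
  have "filterlim sqrt (at 0) (at_right (0::real))"
  proof (rule filterlim_atI)
    have "(sqrt \<longlongrightarrow> sqrt 0) (at_right 0)" by (intro tendsto_intros)
    then show "(sqrt \<longlongrightarrow> 0) (at_right 0)" by simp
  qed (auto simp: eventually_at_filter)
  from filterlim_compose[OF lim this]
  have "((\<lambda>\<theta>. cosh (sqrt \<theta> * l) / (sinh (sqrt \<theta> * l) / sqrt \<theta>)) \<longlongrightarrow> 1 / l) (at_right 0)" .
  then show ?thesis unfolding odd_profile_0
    by (rule Lim_transform_eventually) (auto simp: eventually_at_filter odd_profile_eq)
qed

lemma concave_odd_profile:
  assumes l: "l > 0" shows "concave_profile (odd_profile l)"
proof (rule concave_profileI)
  define P where "P v = cosh v / (v * sinh v) - 1 / (sinh v)\<^sup>2" for v :: real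
  show d: "(odd_profile l has_real_derivative (l / 2) * P (sqrt x * l)) (at x)" if x: "x > 0" for x
  proof -
    define u where "u = sqrt x"
    have u: "u > 0" using x by (simp add: u_def)
    define s c where "s = sinh (u * l)" and "c = cosh (u * l)"
    have s: "s > 0" using u l by (simp add: s_def)
    have "((\<lambda>\<theta>. sqrt \<theta> * (cosh (sqrt \<theta> * l) / sinh (sqrt \<theta> * l))) has_real_derivative
        (inverse u / 2) * (c / s) + ((s * (inverse u / 2 * l) * s - c * (c * (inverse u / 2 * l))) / (s * s)) * u) (at x)"
    proof -
      have su: "(sqrt has_real_derivative inverse u / 2) (at x)"
        unfolding u_def by (rule DERIV_real_sqrt[OF x])
      note ul = DERIV_cmult_right[OF su, of l]
      have D1: "((\<lambda>\<theta>. cosh (sqrt \<theta> * l)) has_real_derivative s * (inverse u / 2 * l)) (at x)"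
        unfolding s_def u_def by (rule has_field_derivative_cosh[OF ul[unfolded u_def]])
      have D2: "((\<lambda>\<theta>. sinh (sqrt \<theta> * l)) has_real_derivative c * (inverse u / 2 * l)) (at x)"
        unfolding c_def u_def by (rule has_field_derivative_sinh[OF ul[unfolded u_def]])
      have nz: "sinh (sqrt x * l) \<noteq> 0" using x l by simp
      show ?thesis
        using DERIV_mult[OF su DERIV_divide[OF D1 D2 nz]] by (simp add: s_def c_def u_def)
    qed
    also have "(inverse u / 2) * (c / s) + ((s * (inverse u / 2 * l) * s - c * (c * (inverse u / 2 * l))) / (s * s)) * u
       = (inverse u / 2) * (c / s) + (l / 2) * ((s * s - c * c) / (s * s))"
    proof -
      have "s * (inverse u / 2 * l) * s - c * (c * (inverse u / 2 * l)) = inverse u * (l / 2 * (s * s - c * c))"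
        by (simp add: algebra_simps)
      moreover have "(inverse u * Y) / (s * s) * u = Y / (s * s)" for Y using u by simp
      ultimately show ?thesis by (simp only: times_divide_eq_right)
    qed
    also have "s * s - c * c = -1"
      using cosh_square_eq[of "u * l"] by (simp add: s_def c_def power2_eq_square)
    also have "(inverse u / 2) * (c / s) + (l / 2) * ((-1) / (s * s)) = (l / 2) * P (u * l)"
    proof -
      have "P (u * l) = c / (u * l * s) - 1 / s\<^sup>2" by (simp add: P_def s_def c_def)
      then show ?thesis using u l s by (simp add: power2_eq_square field_simps)
    qed
    finally show ?thesis unfolding u_def
      by (rule DERIV_cong_ev[THEN iffD1, rotated 3, OF _ refl _ refl])
        (use x eventually_nhds_in_open[of "{0<..}" x] in \<open>auto simp: odd_profile_eq elim!: eventually_mono\<close>)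
  qed
  show "continuous_on {0..} (odd_profile l)"
    unfolding continuous_on_def
  proof
    fix x :: real assume x: "x \<in> {0..}"
    show "(odd_profile l \<longlongrightarrow> odd_profile l x) (at x within {0..})"
    proof (cases "x = 0")
      case True
      have "at (0::real) within {0..} = at_right 0" by (rule at_within_Ici_at_right)
      then show ?thesis using True odd_profile_continuous_at_0[OF l] by simp
    next
      case False
      then show ?thesis using d[of x] x DERIV_isCont[of "odd_profile l"]
        by (auto simp: isCont_def intro: tendsto_within_subset)
    qed
  qed
  show "odd_profile l 0 \<ge> 0" using l by (simp add: odd_profile_0)
  show "odd_profile l x > 0" if "x > 0" for x using that l by (simp add: odd_profile_eq)
  have "P v \<ge> 0" if v: "v > 0" for v
  proof -
    have s: "sinh v > 0" using v by simp
    have "P v = (sinh v * cosh v - v) / (v * (sinh v)\<^sup>2)"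
      using v s by (simp add: P_def field_simps power2_eq_square)
    then show ?thesis using sinh_cosh_gt_self[OF v] v by simp
  qed
  then show "(l / 2) * P (sqrt x * l) \<ge> 0" if "x > 0" for x using that l by simp
  have anti: "P v \<le> P u" if uv: "0 < u" "u \<le> v" for u v
  proof (rule DERIV_nonpos_imp_nonincreasing[OF uv(2)])
    fix x assume "u \<le> x" "x \<le> v"
    then have x: "x > 0" using uv by simp
    define s c where "s = sinh x" and "c = cosh x"
    have s: "s > 0" and c: "c > 0" using x by (auto simp: s_def c_def)
    have cs: "c * c = 1 + s * s" using cosh_square_eq[of x] by (simp add: s_def c_def power2_eq_square)
    have dS: "(sinh has_real_derivative c) (at x)" and dC: "(cosh has_real_derivative s) (at x)"
      using has_field_derivative_sinh[OF DERIV_ident] has_field_derivative_cosh[OF DERIV_ident]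
      by (simp_all add: s_def c_def)
    have nz: "x * sinh x \<noteq> 0" "sinh x * sinh x \<noteq> 0" using x by auto
    note D = DERIV_diff[OF DERIV_divide[OF dC DERIV_mult[OF DERIV_ident dS] nz(1)]
        DERIV_divide[OF DERIV_const[of "1::real"] DERIV_mult[OF dS dS] nz(2)]]
    have "(P has_real_derivative (s * (x * s) - c * (1 * s + c * x)) / ((x * s) * (x * s)) - (0 * (s * s) - 1 * (c * s + c * s)) / ((s * s) * (s * s))) (at x)"
      unfolding P_def[abs_def] power2_eq_square using D unfolding s_def c_def .
    moreover have "(s * (x * s) - c * (1 * s + c * x)) / ((x * s) * (x * s)) - (0 * (s * s) - 1 * (c * s + c * s)) / ((s * s) * (s * s))
       = - (c * ((s\<^sup>2 + x * (s / c)) - 2 * x\<^sup>2)) / (x\<^sup>2 * s ^ 3)"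
    proof -
      have "c * (c * x) = (c * c) * x" by simp
      then have "c * (c * x) = x + s * (s * x)" unfolding cs by (simp add: algebra_simps)
      then have "s * (x * s) - c * (1 * s + c * x) = - (x + c * s)" by (simp add: algebra_simps)
      then have "(s * (x * s) - c * (1 * s + c * x)) / ((x * s) * (x * s)) - (0 * (s * s) - 1 * (c * s + c * s)) / ((s * s) * (s * s))
         = (- (x + c * s)) / (x\<^sup>2 * s\<^sup>2) + (2 * c * s) / (s\<^sup>2 * s\<^sup>2)"
        by (simp add: power2_eq_square mult_ac)
      also have "(- (x + c * s)) / (x\<^sup>2 * s\<^sup>2) = (- (x + c * s) * s) / (x\<^sup>2 * s ^ 3)"
        using s by (simp add: power2_eq_square power3_eq_cube)
      also have "(2 * c * s) / (s\<^sup>2 * s\<^sup>2) = (2 * c * x\<^sup>2) / (x\<^sup>2 * s ^ 3)"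
        using s x by (simp add: power2_eq_square power3_eq_cube)
      also have "(- (x + c * s) * s) / (x\<^sup>2 * s ^ 3) + (2 * c * x\<^sup>2) / (x\<^sup>2 * s ^ 3) = (- (x + c * s) * s + 2 * c * x\<^sup>2) / (x\<^sup>2 * s ^ 3)"
        by (rule add_divide_distrib[symmetric])
      also have "- (x + c * s) * s + 2 * c * x\<^sup>2 = - (c * ((s\<^sup>2 + x * (s / c)) - 2 * x\<^sup>2))"
      proof -
        have "c * (x * (s / c)) = x * s" using c by simp
        then show ?thesis by (simp add: power2_eq_square algebra_simps)
      qed
      finally show ?thesis .
    qed
    moreover have "- (c * ((s\<^sup>2 + x * (s / c)) - 2 * x\<^sup>2)) / (x\<^sup>2 * s ^ 3) \<le> 0"
      using sinh_squared_bound[of x] x s c by (simp add: s_def c_def tanh_def divide_nonpos_pos)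
    ultimately have "(P has_real_derivative - (c * ((s\<^sup>2 + x * (s / c)) - 2 * x\<^sup>2)) / (x\<^sup>2 * s ^ 3)) (at x) \<and>
        - (c * ((s\<^sup>2 + x * (s / c)) - 2 * x\<^sup>2)) / (x\<^sup>2 * s ^ 3) \<le> 0" by (simp only: simp_thms)
    then show "\<exists>y. (P has_real_derivative y) (at x) \<and> y \<le> 0" by (rule exI)
  qed
  show "(l / 2) * P (sqrt y * l) \<le> (l / 2) * P (sqrt x * l)" if "0 < x" "x \<le> y" for x y
    using that l by (intro mult_left_mono anti) auto
qed

lemma char_eq_gap:
  assumes "0 < r" "r \<le> M" "l > 0"
  shows "even_char l \<nu> M r = gcosh (M - r) l * gcosh (M + r) l * gap (1 - \<nu>) (even_profile l) M r"
    "odd_char l \<nu> M r = gsinh (M - r) l * gsinh (M + r) l * gap (1 - \<nu>) (odd_profile l) M r"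
proof -
  have "gcosh (M - r) l > 0" "gcosh (M + r) l > 0" "gsinh (M - r) l > 0" "gsinh (M + r) l > 0"
    using assms by (auto intro!: gcosh_pos gsinh_pos)
  then show "even_char l \<nu> M r = gcosh (M - r) l * gcosh (M + r) l * gap (1 - \<nu>) (even_profile l) M r"
    "odd_char l \<nu> M r = gsinh (M - r) l * gsinh (M + r) l * gap (1 - \<nu>) (odd_profile l) M r"
    unfolding even_char_def odd_char_def gap_def even_profile_def odd_profile_def
    by (simp_all add: right_diff_distrib)
qed

lemma char_zero_iff_gap_zero:
  assumes "0 < r" "r \<le> M" "l > 0"
  shows "even_char l \<nu> M r = 0 \<longleftrightarrow> gap (1 - \<nu>) (even_profile l) M r = 0"
    "odd_char l \<nu> M r = 0 \<longleftrightarrow> gap (1 - \<nu>) (odd_profile l) M r = 0"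
proof -
  have "gcosh (M - r) l > 0" "gcosh (M + r) l > 0" "gsinh (M - r) l > 0" "gsinh (M + r) l > 0"
    using assms by (auto intro!: gcosh_pos gsinh_pos)
  then show "even_char l \<nu> M r = 0 \<longleftrightarrow> gap (1 - \<nu>) (even_profile l) M r = 0"
    "odd_char l \<nu> M r = 0 \<longleftrightarrow> gap (1 - \<nu>) (odd_profile l) M r = 0"
    unfolding char_eq_gap[OF assms] by simp_all
qed

lemma even_gap_at_M: "0 < \<nu> \<Longrightarrow> M > 0 \<Longrightarrow> l > 0 \<Longrightarrow> gap (1 - \<nu>) (even_profile l) M M < 0"
proof -
  assume a: "0 < \<nu>" "M > 0" "l > 0"
  have "even_profile l (M + M) > 0" using a by (simp add: even_profile_eq)
  moreover have "M - (1 - \<nu>) * M = \<nu> * M" by (simp add: algebra_simps)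
  ultimately show ?thesis using a by (simp add: gap_def even_profile_def[of l 0])
qed

text \<open>The sign of this value decides whether the odd equation has a root below the threshold, exactly at it,
  or neither.\<close>

lemma odd_gap_at_M:
  assumes "0 < \<nu>" "M > 0" "l > 0"
  shows "gap (1 - \<nu>) (odd_profile l) M M =
    \<nu>\<^sup>2 * M\<^sup>2 / l * (((2 - \<nu>) / \<nu>)\<^sup>2 - sqrt (2 * M) * l * (cosh (sqrt (2 * M) * l) / sinh (sqrt (2 * M) * l)))"
proof -
  have e: "M - (1 - \<nu>) * M = \<nu> * M" "M + (1 - \<nu>) * M = (2 - \<nu>) * M" by (simp_all add: algebra_simps)
  have o: "odd_profile l (M + M) = sqrt (2 * M) * (cosh (sqrt (2 * M) * l) / sinh (sqrt (2 * M) * l))"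
    using assms odd_profile_eq[of "M + M" l] by simp
  define X where "X = sqrt (2 * M) * (cosh (sqrt (2 * M) * l) / sinh (sqrt (2 * M) * l))"
  have "gap (1 - \<nu>) (odd_profile l) M M = ((2 - \<nu>) * M)\<^sup>2 * (1 / l) - (\<nu> * M)\<^sup>2 * X"
    unfolding gap_def e o X_def by (simp add: odd_profile_0)
  also have "\<dots> = \<nu>\<^sup>2 * M\<^sup>2 / l * (((2 - \<nu>) / \<nu>)\<^sup>2 - X * l)"
    using assms by (simp add: power_mult_distrib power_divide right_diff_distrib)
  finally show ?thesis by (simp add: X_def mult_ac)
qed

text \<open>The two profiles have quotient \<open>tanh\<^sup>2\<close>, which is increasing; so at a root of the odd equation
  the even gap is already negative.\<close>

lemma even_root_less_odd_root:
  assumes \<nu>: "0 < \<nu>" "\<nu> < 1" and M: "M > 0" and l: "l > 0"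
    and r: "(1 - \<nu>) * M < r" "r < M" "gap (1 - \<nu>) (even_profile l) M r = 0"
    and r': "(1 - \<nu>) * M < r'" "r' < M" "gap (1 - \<nu>) (odd_profile l) M r' = 0"
  shows "r < r'"
proof -
  define p q where "p = sqrt (M - r')" and "q = sqrt (M + r')"
  have aM: "0 < (1 - \<nu>) * M" using \<nu> M by simp
  have pq: "0 < p" "p < q" using r' aM by (auto simp: p_def q_def)
  define s t where "s = (r' + (1 - \<nu>) * M)\<^sup>2" and "t = (r' - (1 - \<nu>) * M)\<^sup>2"
  define x y where "x = tanh (p * l)" and "y = tanh (q * l)"
  have xy: "0 < x" "x < y" using pq l by (auto simp: x_def y_def)
  have t: "t > 0" using r' by (simp add: t_def)
  have oe: "odd_profile l (M - r') = p / x" "odd_profile l (M + r') = q / y"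
    "even_profile l (M - r') = p * x" "even_profile l (M + r') = q * y"
    using r' aM by (simp_all add: odd_profile_eq even_profile_eq x_def y_def p_def q_def tanh_def)
  have "s * (p / x) = t * (q / y)" using r'(3) unfolding gap_def oe s_def t_def by simp
  then have s: "s * p = t * q * x / y" using xy by (simp add: field_simps)
  have "s * (p * x) = t * q * (x * x / y)" using s by (simp add: mult.assoc[symmetric])
  also have "\<dots> < t * q * y"
  proof -
    have "x * x < y * y" using xy by (intro mult_strict_mono) auto
    then have "x * x / y < y" using xy by (simp add: pos_divide_less_eq)
    then show ?thesis using t pq by (intro mult_strict_left_mono) auto
  qed
  finally have neg: "gap (1 - \<nu>) (even_profile l) M r' < 0"
    unfolding gap_def oe s_def t_def by (simp add: mult.assoc)
  show ?thesis
  proof (rule ccontr)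
    assume "\<not> r < r'"
    then consider "r' = r" | "r' < r" by linarith
    then show False
    proof cases
      case 1 then show False using neg r by simp
    next
      case 2
      have "gap (1 - \<nu>) (even_profile l) M r < 0"
        by (rule gap_decreasing[OF concave_even_profile[OF l] _ M r'(1) 2]) (use \<nu> r neg in auto)
      then show False using r by simp
    qed
  qed
qed

lemma tanh_line_unique:
  assumes k: "0 < k" "k < 1"
  shows "\<exists>!s::real. s > 0 \<and> tanh s = k * s"
proof -
  define f where "f s = tanh s - k * s" for s :: real
  have d: "(f has_real_derivative (1 - (tanh s)\<^sup>2) - k) (at s)" for s
    unfolding f_def[abs_def] by (auto intro!: derivative_eq_intros)
  obtain e where e: "e > 0" "\<And>h. 0 < h \<Longrightarrow> h < e \<Longrightarrow> f 0 < f (0 + h)"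
    using DERIV_pos_inc_right[OF d[of 0]] k by auto
  define b where "b = min (e / 2) (1 / k)"
  have b: "b > 0" "b < e" "b \<le> 1 / k" using e k by (auto simp: b_def)
  have "f b > 0" using e(2)[of b] b by (simp add: f_def)
  moreover have "f (1 / k) \<le> 0" using tanh_real_lt_1[of "1 / k"] k by (simp add: f_def)
  moreover have "continuous_on {b..1 / k} f" unfolding f_def[abs_def] by (intro continuous_intros) auto
  ultimately obtain s where s: "b \<le> s" "f s = 0"
    using IVT2'[of f "1 / k" 0 b] b by auto
  have "s > 0 \<and> tanh s = k * s" using s b by (simp add: f_def)
  moreover have "s' = s" if "s' > 0 \<and> tanh s' = k * s'" for s'
  proof -
    have "tanh s / s = k" "tanh s' / s' = k" using calculation that by simp_all
    then show ?thesis
      using tanh_over_self_strict_antimono[of s s'] tanh_over_self_strict_antimono[of s' s] calculation that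
      by (cases s s' rule: linorder_cases) auto
  qed
  ultimately show ?thesis by blast
qed

section \<open>Eigenvalues above the threshold\<close>

lemma char_above:
  assumes M: "M > 0" and \<gamma>: "\<gamma> > 0"
  shows "even_char l \<nu> M (\<gamma>\<^sup>2 + M) =
      - ((\<gamma>\<^sup>2 + M + (1 - \<nu>) * M)\<^sup>2 * (\<gamma> * sin (\<gamma> * l)) * cosh (sqrt (\<gamma>\<^sup>2 + 2 * M) * l)
        + (\<gamma>\<^sup>2 + M - (1 - \<nu>) * M)\<^sup>2 * (sqrt (\<gamma>\<^sup>2 + 2 * M) * sinh (sqrt (\<gamma>\<^sup>2 + 2 * M) * l)) * cos (\<gamma> * l))"
    "odd_char l \<nu> M (\<gamma>\<^sup>2 + M) * \<gamma> =
      (\<gamma>\<^sup>2 + M + (1 - \<nu>) * M)\<^sup>2 * (\<gamma> * cos (\<gamma> * l)) * (sinh (sqrt (\<gamma>\<^sup>2 + 2 * M) * l) / sqrt (\<gamma>\<^sup>2 + 2 * M))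
        - (\<gamma>\<^sup>2 + M - (1 - \<nu>) * M)\<^sup>2 * cosh (sqrt (\<gamma>\<^sup>2 + 2 * M) * l) * sin (\<gamma> * l)"
proof -
  define \<beta> where "\<beta> = sqrt (\<gamma>\<^sup>2 + 2 * M)"
  have e: "M - (\<gamma>\<^sup>2 + M) = - \<gamma>\<^sup>2" "M + (\<gamma>\<^sup>2 + M) = \<gamma>\<^sup>2 + 2 * M" by simp_all
  have g: "gcosh (- \<gamma>\<^sup>2) l = cos (\<gamma> * l)" "gsinh (- \<gamma>\<^sup>2) l = sin (\<gamma> * l) / \<gamma>"
    using \<gamma> by (simp_all add: gcosh_def gsinh_def)
  have p: "\<gamma>\<^sup>2 + 2 * M > 0" using M by (simp add: add_nonneg_pos)
  then have b: "gcosh (\<gamma>\<^sup>2 + 2 * M) l = cosh (\<beta> * l)" "gsinh (\<gamma>\<^sup>2 + 2 * M) l = sinh (\<beta> * l) / \<beta>"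
    by (simp_all add: gcosh_def gsinh_def \<beta>_def)
  have bp: "\<beta> > 0" and bb: "\<gamma>\<^sup>2 + 2 * M = \<beta> * \<beta>" using p by (simp_all add: \<beta>_def)
  have k: "(- \<gamma>\<^sup>2) * (sin (\<gamma> * l) / \<gamma>) = - (\<gamma> * sin (\<gamma> * l))" using \<gamma> by (simp add: power2_eq_square)
  have k2: "(\<gamma>\<^sup>2 + 2 * M) * (sinh (\<beta> * l) / \<beta>) = \<beta> * sinh (\<beta> * l)" unfolding bb using bp by simp
  show "even_char l \<nu> M (\<gamma>\<^sup>2 + M) =
      - ((\<gamma>\<^sup>2 + M + (1 - \<nu>) * M)\<^sup>2 * (\<gamma> * sin (\<gamma> * l)) * cosh (sqrt (\<gamma>\<^sup>2 + 2 * M) * l)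
        + (\<gamma>\<^sup>2 + M - (1 - \<nu>) * M)\<^sup>2 * (sqrt (\<gamma>\<^sup>2 + 2 * M) * sinh (sqrt (\<gamma>\<^sup>2 + 2 * M) * l)) * cos (\<gamma> * l))"
    unfolding even_char_def e g b k k2 unfolding \<beta>_def[symmetric] by simp
  have "odd_char l \<nu> M (\<gamma>\<^sup>2 + M) * \<gamma> =
      (\<gamma>\<^sup>2 + M + (1 - \<nu>) * M)\<^sup>2 * (\<gamma> * cos (\<gamma> * l)) * (sinh (\<beta> * l) / \<beta>)
        - (\<gamma>\<^sup>2 + M - (1 - \<nu>) * M)\<^sup>2 * cosh (\<beta> * l) * (sin (\<gamma> * l) / \<gamma> * \<gamma>)"
    unfolding odd_char_def e g b by (simp only: left_diff_distrib right_diff_distrib mult_ac)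
  then show "odd_char l \<nu> M (\<gamma>\<^sup>2 + M) * \<gamma> =
      (\<gamma>\<^sup>2 + M + (1 - \<nu>) * M)\<^sup>2 * (\<gamma> * cos (\<gamma> * l)) * (sinh (sqrt (\<gamma>\<^sup>2 + 2 * M) * l) / sqrt (\<gamma>\<^sup>2 + 2 * M))
        - (\<gamma>\<^sup>2 + M - (1 - \<nu>) * M)\<^sup>2 * cosh (sqrt (\<gamma>\<^sup>2 + 2 * M) * l) * sin (\<gamma> * l)"
    using \<gamma> unfolding \<beta>_def[symmetric] by simp
qed

text \<open>The characteristic functions extend holomorphically in \<open>\<gamma>\<close> to a strip around the real axis, in
  which \<open>\<gamma>\<^sup>2 + 2 M\<close> stays away from the cut of the square root.\<close>

lemma strip_finite_real_zeros:
  fixes F :: "complex \<Rightarrow> complex" and f :: "real \<Rightarrow> real"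
  assumes c: "c > 0" and F: "F holomorphic_on {z. \<bar>Im z\<bar> < c}"
    and real: "\<And>x. x \<ge> 0 \<Longrightarrow> F (of_real x) = of_real (f x)"
    and xy: "x \<ge> 0" "y \<ge> 0" "f x \<noteq> f y"
  shows "finite {t. 0 \<le> t \<and> t \<le> R \<and> f t = 0}"
proof -
  define S where "S = {z. \<bar>Im z\<bar> < c}"
  have S: "S = {z. Im z < c} \<inter> {z. Im z > - c}" by (auto simp: S_def)
  have "convex S" unfolding S by (intro convex_Int convex_halfspace_Im_lt convex_halfspace_Im_gt)
  then have "connected S" by (rule convex_connected)
  moreover have "open S" unfolding S by (intro open_Int open_halfspace_Im_lt open_halfspace_Im_gt)
  moreover have "compact (of_real ` {0..R} :: complex set)"
    by (intro compact_continuous_image continuous_intros) auto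
  moreover have "of_real ` {0..R} \<subseteq> S" using c by (auto simp: S_def)
  moreover have "\<not> F constant_on S"
  proof
    assume "F constant_on S"
    then obtain k where "\<And>z. z \<in> S \<Longrightarrow> F z = k" unfolding constant_on_def by blast
    then have "F (of_real x) = k" "F (of_real y) = k" using c by (auto simp: S_def)
    then have "complex_of_real (f x) = of_real (f y)" using real[OF xy(1)] real[OF xy(2)] by simp
    then show False using xy(3) by (simp only: of_real_eq_iff)
  qed
  ultimately have "finite {z \<in> of_real ` {0..R}. F z = 0}"
    using holomorphic_compact_finite_zeros[OF F[folded S_def]] by blast
  moreover have "of_real ` {t. 0 \<le> t \<and> t \<le> R \<and> f t = 0} \<subseteq> {z \<in> of_real ` {0..R}. F z = 0}"
    using real by auto
  ultimately have "finite (of_real ` {t. 0 \<le> t \<and> t \<le> R \<and> f t = 0} :: complex set)"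
    by (rule finite_subset[rotated])
  then show ?thesis by (rule finite_imageD) (simp add: inj_on_def)
qed

lemma csqrt_strip_holomorphic:
  assumes "M > 0"
  shows "(\<lambda>z. csqrt (z\<^sup>2 + of_real (2 * M))) holomorphic_on {z. \<bar>Im z\<bar> < sqrt (2 * M)}"
    "\<And>z. \<bar>Im z\<bar> < sqrt (2 * M) \<Longrightarrow> csqrt (z\<^sup>2 + of_real (2 * M)) \<noteq> 0"
proof -
  have pos: "Re (z\<^sup>2 + of_real (2 * M)) > 0" if "\<bar>Im z\<bar> < sqrt (2 * M)" for z
  proof -
    have "\<bar>Im z\<bar>\<^sup>2 < (sqrt (2 * M))\<^sup>2" using that by (intro power_strict_mono) auto
    then have "(Im z)\<^sup>2 < 2 * M" using assms by simp
    moreover have "(Re z)\<^sup>2 \<ge> 0" by simp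
    moreover have "Re (z\<^sup>2 + of_real (2 * M)) = (Re z)\<^sup>2 - (Im z)\<^sup>2 + 2 * M" by (simp add: power2_eq_square)
    ultimately show ?thesis by linarith
  qed
  have "csqrt \<circ> (\<lambda>z. z\<^sup>2 + of_real (2 * M)) holomorphic_on {z. \<bar>Im z\<bar> < sqrt (2 * M)}"
  proof (rule holomorphic_on_compose_gen)
    show "csqrt holomorphic_on - \<real>\<^sub>\<le>\<^sub>0" by (rule holomorphic_on_csqrt)
    show "(\<lambda>z. z\<^sup>2 + of_real (2 * M)) ` {z. \<bar>Im z\<bar> < sqrt (2 * M)} \<subseteq> - \<real>\<^sub>\<le>\<^sub>0"
      using pos by (auto simp: complex_nonpos_Reals_iff) (smt (verit) pos)
  qed (intro holomorphic_intros)
  then show "(\<lambda>z. csqrt (z\<^sup>2 + of_real (2 * M))) holomorphic_on {z. \<bar>Im z\<bar> < sqrt (2 * M)}"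
    by (simp add: o_def)
  show "csqrt (z\<^sup>2 + of_real (2 * M)) \<noteq> 0" if "\<bar>Im z\<bar> < sqrt (2 * M)" for z
    using pos[OF that] by (metis csqrt_eq_0 less_irrefl zero_complex.sel(1))
qed

lemma of_real_hyperbolic:
  "(exp (of_real x) + exp (- of_real x)) / 2 = (of_real (cosh x) :: complex)"
  "(exp (of_real x) - exp (- of_real x)) / 2 = (of_real (sinh x) :: complex)"
proof -
  have "exp (- of_real x) = (of_real (exp (- x)) :: complex)" using exp_of_real[of "- x"] by simp
  then show "(exp (of_real x) + exp (- of_real x)) / 2 = (of_real (cosh x) :: complex)"
    "(exp (of_real x) - exp (- of_real x)) / 2 = (of_real (sinh x) :: complex)"
    by (simp_all add: cosh_field_def sinh_field_def exp_of_real)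
qed

lemma even_char_finite_zeros:
  assumes M: "M > 0" and l: "l > 0" and \<nu>: "0 < \<nu>" "\<nu> < 1"
  shows "finite {\<gamma>. 0 < \<gamma> \<and> \<gamma> \<le> R \<and> even_char l \<nu> M (\<gamma>\<^sup>2 + M) = 0}"
proof -
  define a where "a = (1 - \<nu>) * M"
  define f where "f \<gamma> = (\<gamma>\<^sup>2 + M + a)\<^sup>2 * (\<gamma> * sin (\<gamma> * l)) * cosh (sqrt (\<gamma>\<^sup>2 + 2 * M) * l)
        + (\<gamma>\<^sup>2 + M - a)\<^sup>2 * (sqrt (\<gamma>\<^sup>2 + 2 * M) * sinh (sqrt (\<gamma>\<^sup>2 + 2 * M) * l)) * cos (\<gamma> * l)" for \<gamma>
  define \<beta> where "\<beta> z = csqrt (z\<^sup>2 + of_real (2 * M))" for z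
  define F where "F z = (z\<^sup>2 + of_real M + of_real a)\<^sup>2 * (z * sin (z * of_real l)) * ((exp (\<beta> z * of_real l) + exp (- (\<beta> z * of_real l))) / 2)
        + (z\<^sup>2 + of_real M - of_real a)\<^sup>2 * (\<beta> z * ((exp (\<beta> z * of_real l) - exp (- (\<beta> z * of_real l))) / 2)) * cos (z * of_real l)" for z
  have h: "\<beta> holomorphic_on {z. \<bar>Im z\<bar> < sqrt (2 * M)}"
    unfolding \<beta>_def[abs_def] by (rule csqrt_strip_holomorphic[OF M])
  have F: "F holomorphic_on {z. \<bar>Im z\<bar> < sqrt (2 * M)}"
    unfolding F_def[abs_def] by (intro holomorphic_intros h) auto
  have real: "F (of_real x) = of_real (f x)" if "x \<ge> 0" for x
  proof -
    have "\<beta> (of_real x) = of_real (sqrt (x\<^sup>2 + 2 * M))"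
      unfolding \<beta>_def using M csqrt_of_real[of "x\<^sup>2 + 2 * M"] by simp
    then have bl: "\<beta> (of_real x) * of_real l = of_real (sqrt (x\<^sup>2 + 2 * M) * l)" and b: "\<beta> (of_real x) = of_real (sqrt (x\<^sup>2 + 2 * M))" by simp_all
    have xl: "of_real x * of_real l = (of_real (x * l) :: complex)" by simp
    show ?thesis unfolding F_def f_def bl xl unfolding b of_real_hyperbolic sin_of_real cos_of_real by simp
    qed
  have sgn: "f (pi / l) < 0" "f (2 * pi / l) > 0"
  proof -
    have pos: "(\<gamma>\<^sup>2 + M - a)\<^sup>2 * (sqrt (\<gamma>\<^sup>2 + 2 * M) * sinh (sqrt (\<gamma>\<^sup>2 + 2 * M) * l)) > 0" for \<gamma>
    proof -
      have "\<gamma>\<^sup>2 + M - a = \<gamma>\<^sup>2 + \<nu> * M" by (simp add: a_def algebra_simps)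
      also have "\<dots> > 0" using \<nu> M by (simp add: add_nonneg_pos)
      finally have "\<gamma>\<^sup>2 + M - a > 0" .
      moreover have "\<gamma>\<^sup>2 + 2 * M > 0" using M by (simp add: add_nonneg_pos)
      ultimately show ?thesis using l by (intro mult_pos_pos) auto
    qed
    show "f (pi / l) < 0" using pos[of "pi / l"] l by (simp add: f_def)
    show "f (2 * pi / l) > 0" using pos[of "2 * pi / l"] l by (simp add: f_def)
  qed
  have "finite {t. 0 \<le> t \<and> t \<le> R \<and> f t = 0}"
    by (rule strip_finite_real_zeros[OF _ F real, of "pi / l" "2 * pi / l"]) (use M l sgn in auto)
  then show ?thesis
    by (rule finite_subset[rotated]) (auto simp: char_above[OF M] f_def a_def)
qed

lemma odd_char_finite_zeros:
  assumes M: "M > 0" and l: "l > 0" and \<nu>: "0 < \<nu>" "\<nu> < 1"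
  shows "finite {\<gamma>. 0 < \<gamma> \<and> \<gamma> \<le> R \<and> odd_char l \<nu> M (\<gamma>\<^sup>2 + M) = 0}"
proof -
  define a where "a = (1 - \<nu>) * M"
  define f where "f \<gamma> = (\<gamma>\<^sup>2 + M + a)\<^sup>2 * (\<gamma> * cos (\<gamma> * l)) * (sinh (sqrt (\<gamma>\<^sup>2 + 2 * M) * l) / sqrt (\<gamma>\<^sup>2 + 2 * M))
        - (\<gamma>\<^sup>2 + M - a)\<^sup>2 * cosh (sqrt (\<gamma>\<^sup>2 + 2 * M) * l) * sin (\<gamma> * l)" for \<gamma>
  define \<beta> where "\<beta> z = csqrt (z\<^sup>2 + of_real (2 * M))" for z
  define F where "F z = (z\<^sup>2 + of_real M + of_real a)\<^sup>2 * (z * cos (z * of_real l)) * (((exp (\<beta> z * of_real l) - exp (- (\<beta> z * of_real l))) / 2) / \<beta> z)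
        - (z\<^sup>2 + of_real M - of_real a)\<^sup>2 * ((exp (\<beta> z * of_real l) + exp (- (\<beta> z * of_real l))) / 2) * sin (z * of_real l)" for z
  have h: "\<beta> holomorphic_on {z. \<bar>Im z\<bar> < sqrt (2 * M)}"
    unfolding \<beta>_def[abs_def] by (rule csqrt_strip_holomorphic[OF M])
  have F: "F holomorphic_on {z. \<bar>Im z\<bar> < sqrt (2 * M)}"
    unfolding F_def[abs_def]
    by (intro holomorphic_intros h) (use csqrt_strip_holomorphic(2)[OF M] in \<open>auto simp: \<beta>_def\<close>)
  have real: "F (of_real x) = of_real (f x)" if "x \<ge> 0" for x
  proof -
    have "\<beta> (of_real x) = of_real (sqrt (x\<^sup>2 + 2 * M))"
      unfolding \<beta>_def using M csqrt_of_real[of "x\<^sup>2 + 2 * M"] by simp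
    then have bl: "\<beta> (of_real x) * of_real l = of_real (sqrt (x\<^sup>2 + 2 * M) * l)" and b: "\<beta> (of_real x) = of_real (sqrt (x\<^sup>2 + 2 * M))" by simp_all
    have xl: "of_real x * of_real l = (of_real (x * l) :: complex)" by simp
    show ?thesis unfolding F_def f_def bl xl unfolding b of_real_hyperbolic sin_of_real cos_of_real by simp
    qed
  have sgn: "f (pi / (2 * l)) < 0" "f (3 * pi / (2 * l)) > 0"
  proof -
    have pos: "(\<gamma>\<^sup>2 + M - a)\<^sup>2 * cosh (sqrt (\<gamma>\<^sup>2 + 2 * M) * l) > 0" for \<gamma>
    proof -
      have "\<gamma>\<^sup>2 + M - a = \<gamma>\<^sup>2 + \<nu> * M" by (simp add: a_def algebra_simps)
      also have "\<dots> > 0" using \<nu> M by (simp add: add_nonneg_pos)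
      finally have "\<gamma>\<^sup>2 + M - a > 0" .
      then show ?thesis by (intro mult_pos_pos) auto
    qed
    have t: "pi / (2 * l) * l = pi / 2" "3 * pi / (2 * l) * l = 3 / 2 * pi" using l by (simp_all add: field_simps)
    have s: "sin (3 / 2 * pi) = -1" "cos (3 / 2 * pi) = 0"
    proof -
      have "3 / 2 * pi = pi + pi / 2" by simp
      then show "sin (3 / 2 * pi) = -1" "cos (3 / 2 * pi) = 0" by (simp_all only: sin_add cos_add) simp_all
    qed
    show "f (pi / (2 * l)) < 0" unfolding f_def t using pos[of "pi / (2 * l)"] by simp
    show "f (3 * pi / (2 * l)) > 0" unfolding f_def t s using pos[of "3 * pi / (2 * l)"] by simp
  qed
  have "finite {t. 0 \<le> t \<and> t \<le> R \<and> f t = 0}"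
    by (rule strip_finite_real_zeros[OF _ F real, of "pi / (2 * l)" "3 * pi / (2 * l)"]) (use M l sgn in auto)
  moreover have "f \<gamma> = 0" if "0 < \<gamma>" "odd_char l \<nu> M (\<gamma>\<^sup>2 + M) = 0" for \<gamma>
    using char_above(2)[OF M that(1), of l \<nu>] that(2) by (simp add: f_def a_def)
  then have "{\<gamma>. 0 < \<gamma> \<and> \<gamma> \<le> R \<and> odd_char l \<nu> M (\<gamma>\<^sup>2 + M) = 0} \<subseteq> {t. 0 \<le> t \<and> t \<le> R \<and> f t = 0}" by auto
  ultimately show ?thesis by (rule finite_subset[rotated])
qed

text \<open>At \<open>\<gamma> = k \<pi> / l\<close> the sine term vanishes and the cosine term has the sign \<open>(-1)\<^sup>k\<close>.\<close>

lemma even_char_zero_between: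
  assumes M: "M > 0" and l: "l > 0" and \<nu>: "0 < \<nu>" "\<nu> < 1" and k: "k \<ge> 1"
  shows "\<exists>\<gamma>. real k * pi / l \<le> \<gamma> \<and> \<gamma> \<le> real (Suc k) * pi / l \<and> even_char l \<nu> M (\<gamma>\<^sup>2 + M) = 0"
proof -
  define g where "g \<gamma> = (-1) ^ k * ((\<gamma>\<^sup>2 + M + (1 - \<nu>) * M)\<^sup>2 * (\<gamma> * sin (\<gamma> * l)) * cosh (sqrt (\<gamma>\<^sup>2 + 2 * M) * l)
        + (\<gamma>\<^sup>2 + M - (1 - \<nu>) * M)\<^sup>2 * (sqrt (\<gamma>\<^sup>2 + 2 * M) * sinh (sqrt (\<gamma>\<^sup>2 + 2 * M) * l)) * cos (\<gamma> * l))" for \<gamma>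
  define P where "P \<gamma> = (\<gamma>\<^sup>2 + M - (1 - \<nu>) * M)\<^sup>2 * (sqrt (\<gamma>\<^sup>2 + 2 * M) * sinh (sqrt (\<gamma>\<^sup>2 + 2 * M) * l))" for \<gamma>
  have pos: "P \<gamma> > 0" for \<gamma>
  proof -
    have "\<gamma>\<^sup>2 + M - (1 - \<nu>) * M = \<gamma>\<^sup>2 + \<nu> * M" by (simp add: algebra_simps)
    also have "\<dots> > 0" using \<nu> M by (simp add: add_nonneg_pos)
    finally have "(\<gamma>\<^sup>2 + M - (1 - \<nu>) * M)\<^sup>2 > 0" by (rule zero_less_power)
    moreover have "sqrt (\<gamma>\<^sup>2 + 2 * M) > 0" using M by (simp add: add_nonneg_pos)
    ultimately show ?thesis unfolding P_def using l by (intro mult_pos_pos) simp_all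
  qed
  have at: "g (real n * pi / l) = (-1) ^ k * ((-1) ^ n * P (real n * pi / l))" for n
    using l by (simp add: g_def P_def cos_npi)
  have "((-1::real) ^ k) * ((-1) ^ k) = 1" by (simp flip: power_mult_distrib)
  then have "g (real k * pi / l) = P (real k * pi / l)" "g (real (Suc k) * pi / l) = - P (real (Suc k) * pi / l)"
    unfolding at by (simp_all add: mult.assoc[symmetric])
  then have "g (real k * pi / l) \<ge> 0" "g (real (Suc k) * pi / l) \<le> 0"
    using pos[of "real k * pi / l"] pos[of "real (Suc k) * pi / l"] by linarith+
  moreover have "continuous_on {real k * pi / l..real (Suc k) * pi / l} g"
    unfolding g_def[abs_def] by (intro continuous_intros)
  moreover have "real k * pi / l \<le> real (Suc k) * pi / l"
    using l by (intro divide_right_mono mult_right_mono) auto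
  ultimately obtain \<gamma> where \<gamma>: "real k * pi / l \<le> \<gamma>" "\<gamma> \<le> real (Suc k) * pi / l" "g \<gamma> = 0"
    using IVT2'[of g "real (Suc k) * pi / l" 0 "real k * pi / l"] by blast
  have "real k * pi / l > 0" using k l by simp
  then have "\<gamma> > 0" using \<gamma>(1) by linarith
  then have "even_char l \<nu> M (\<gamma>\<^sup>2 + M) = 0" using \<gamma>(3) unfolding char_above(1)[OF M \<open>\<gamma> > 0\<close>] by (simp add: g_def)
  then show ?thesis using \<gamma> by blast
qed

definition upper_spectrum :: "real \<Rightarrow> real \<Rightarrow> real \<Rightarrow> real set" where
  "upper_spectrum l \<nu> M = {\<rho>. \<rho> > M\<^sup>2 \<and> (\<exists>G. mode_eigen l \<nu> M \<rho> G)}"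

lemma upper_spectrum_iff:
  assumes M: "M > 0" and l: "l > 0" and \<nu>: "\<nu> < 1" and \<gamma>: "\<gamma> > 0"
  shows "(\<gamma>\<^sup>2 + M)\<^sup>2 \<in> upper_spectrum l \<nu> M \<longleftrightarrow>
    even_char l \<nu> M (\<gamma>\<^sup>2 + M) = 0 \<or> odd_char l \<nu> M (\<gamma>\<^sup>2 + M) = 0"
proof -
  have r: "\<gamma>\<^sup>2 + M > 0" "M < \<gamma>\<^sup>2 + M" using M \<gamma> by (simp_all add: add_pos_pos)
  have "M\<^sup>2 < (\<gamma>\<^sup>2 + M)\<^sup>2" using r M by (intro power_strict_mono) auto
  then show ?thesis
    using even_eigen[OF _ l M r(1) \<nu>] odd_eigen[OF _ l M r(1) \<nu>] eigen_imp_char_zero[OF _ r(1)]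
    unfolding upper_spectrum_def by blast
qed

lemma upper_spectrum_param:
  fixes M \<rho> :: real
  assumes M: "M > 0" and \<rho>: "\<rho> > M\<^sup>2"
  obtains \<gamma> where "\<gamma> > 0" "\<rho> = (\<gamma>\<^sup>2 + M)\<^sup>2"
proof -
  have "sqrt (M\<^sup>2) < sqrt \<rho>" using \<rho> by (simp only: real_sqrt_less_iff)
  then have s: "sqrt \<rho> > M" using M by simp
  have "\<rho> \<ge> 0" using \<rho> zero_le_power2[of M] by linarith
  then have "((sqrt (sqrt \<rho> - M))\<^sup>2 + M)\<^sup>2 = \<rho>" using s by simp
  then show ?thesis using s by (intro that[of "sqrt (sqrt \<rho> - M)"]) auto
qed

lemma upper_spectrum_finite:
  assumes M: "M > 0" and l: "l > 0" and \<nu>: "0 < \<nu>" "\<nu> < 1"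
  shows "finite {\<rho> \<in> upper_spectrum l \<nu> M. \<rho> \<le> R}"
proof (rule finite_subset)
  let ?Z = "{\<gamma>. 0 < \<gamma> \<and> \<gamma> \<le> max 1 R \<and> even_char l \<nu> M (\<gamma>\<^sup>2 + M) = 0} \<union> {\<gamma>. 0 < \<gamma> \<and> \<gamma> \<le> max 1 R \<and> odd_char l \<nu> M (\<gamma>\<^sup>2 + M) = 0}"
  show "finite ((\<lambda>\<gamma>. (\<gamma>\<^sup>2 + M)\<^sup>2) ` ?Z)"
    using even_char_finite_zeros[OF M l \<nu>] odd_char_finite_zeros[OF M l \<nu>] by blast
  show "{\<rho> \<in> upper_spectrum l \<nu> M. \<rho> \<le> R} \<subseteq> (\<lambda>\<gamma>. (\<gamma>\<^sup>2 + M)\<^sup>2) ` ?Z"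
  proof
    fix \<rho> assume \<rho>: "\<rho> \<in> {\<rho> \<in> upper_spectrum l \<nu> M. \<rho> \<le> R}"
    then have "\<rho> > M\<^sup>2" by (simp add: upper_spectrum_def)
    then obtain \<gamma> where \<gamma>: "\<gamma> > 0" "\<rho> = (\<gamma>\<^sup>2 + M)\<^sup>2" using upper_spectrum_param[OF M] by blast
    have "\<gamma> \<le> max 1 R"
    proof (cases "\<gamma> \<le> 1")
      case False
      then have g: "1 \<le> \<gamma>" by simp
      have "\<gamma> \<le> \<gamma>\<^sup>2" using power_increasing[of 1 2 \<gamma>] g by simp
      then have "\<gamma> \<le> \<gamma>\<^sup>2 + M" using M by simp
      also have "\<dots> \<le> (\<gamma>\<^sup>2 + M)\<^sup>2" using power_increasing[of 1 2 "\<gamma>\<^sup>2 + M"] calculation g by simp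
      also have "\<dots> \<le> R" using \<rho> \<gamma> by simp
      finally show ?thesis by simp
    qed simp
    then show "\<rho> \<in> (\<lambda>\<gamma>. (\<gamma>\<^sup>2 + M)\<^sup>2) ` ?Z"
      using \<rho> \<gamma> upper_spectrum_iff[OF M l \<nu>(2) \<gamma>(1)] by auto
  qed
qed

lemma upper_spectrum_infinite:
  assumes M: "M > 0" and l: "l > 0" and \<nu>: "0 < \<nu>" "\<nu> < 1"
  shows "infinite (upper_spectrum l \<nu> M)"
proof
  assume fin: "finite (upper_spectrum l \<nu> M)"
  have "\<exists>\<rho>\<in>upper_spectrum l \<nu> M. \<rho> > B" for B
  proof -
    define C where "C = max 1 B"
    obtain k0 :: nat where k0: "real k0 > C * l / pi" using reals_Archimedean2 by blast
    define k where "k = max 1 k0"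
    have k: "k \<ge> 1" "real k > C * l / pi" using k0 by (auto simp: k_def)
    obtain \<gamma> where \<gamma>: "real k * pi / l \<le> \<gamma>" "even_char l \<nu> M (\<gamma>\<^sup>2 + M) = 0"
      using even_char_zero_between[OF M l \<nu> k(1)] by blast
    have "C < real k * pi / l" using k(2) l by (simp add: field_simps)
    then have C: "C < \<gamma>" using \<gamma>(1) by simp
    then have g: "1 < \<gamma>" "B < \<gamma>" by (simp_all add: C_def)
    have "\<gamma> \<le> \<gamma>\<^sup>2" using power_increasing[of 1 2 \<gamma>] g by simp
    then have "\<gamma> \<le> \<gamma>\<^sup>2 + M" using M by simp
    also have "\<dots> \<le> (\<gamma>\<^sup>2 + M)\<^sup>2" using power_increasing[of 1 2 "\<gamma>\<^sup>2 + M"] calculation g by simp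
    finally have "B < (\<gamma>\<^sup>2 + M)\<^sup>2" using g by simp
    moreover have "(\<gamma>\<^sup>2 + M)\<^sup>2 \<in> upper_spectrum l \<nu> M"
      using upper_spectrum_iff[OF M l \<nu>(2)] g \<gamma>(2) by simp
    ultimately show ?thesis by blast
  qed
  from this[of "Max (upper_spectrum l \<nu> M)"] fin show False
    using Max_ge by (metis leD)
qed

text \<open>The enumeration iterates the map to the next larger element.\<close>

lemma discrete_set_enumeration:
  fixes A :: "real set"
  assumes inf: "infinite A" and fin: "\<And>R. finite {x \<in> A. x \<le> R}"
  obtains e :: "nat \<Rightarrow> real" where "strict_mono e" "range e = A" "filterlim e at_top sequentially"
proof -
  have least: "\<exists>y\<in>A. y > x \<and> (\<forall>z\<in>A. z > x \<longrightarrow> y \<le> z)" for x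
  proof -
    have "\<not> A \<subseteq> {z \<in> A. z \<le> x}" using inf fin[of x] finite_subset by blast
    then obtain b where "b \<in> A" "\<not> b \<le> x" by blast
    then have b: "b \<in> A" "b > x" by simp_all
    define S where "S = {z \<in> A. z \<le> b \<and> z > x}"
    have S: "finite S" "S \<noteq> {}" using b by (auto simp: S_def intro: finite_subset[OF _ fin[of b]])
    then have "Min S \<in> S" by (rule Min_in)
    moreover have "Min S \<le> z" if "z \<in> A" "z > x" for z
    proof (cases "z \<le> b")
      case True then show ?thesis using that S by (intro Min_le) (auto simp: S_def)
    next
      case False then show ?thesis using \<open>Min S \<in> S\<close> by (auto simp: S_def)
    qed
    ultimately show ?thesis by (auto simp: S_def)
  qed
  define nxt where "nxt x = (SOME y. y \<in> A \<and> y > x \<and> (\<forall>z\<in>A. z > x \<longrightarrow> y \<le> z))" for x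
  have nxt: "nxt x \<in> A \<and> nxt x > x \<and> (\<forall>z\<in>A. z > x \<longrightarrow> nxt x \<le> z)" for x
    unfolding nxt_def by (rule someI_ex) (use least in blast)
  obtain a0 where a0: "a0 \<in> A" using inf by (metis finite.emptyI ex_in_conv)
  define m where "m = Min {x \<in> A. x \<le> a0}"
  have ne: "{x \<in> A. x \<le> a0} \<noteq> {}" using a0 by auto
  have mA: "m \<in> A" using Min_in[OF fin ne] by (simp add: m_def)
  have mle: "m \<le> z" if "z \<in> A" for z
  proof (cases "z \<le> a0")
    case True then show ?thesis unfolding m_def using that fin by (intro Min_le) auto
  next
    case False then show ?thesis using Min_in[OF fin ne] by (simp add: m_def)
  qed
  define e where "e n = (nxt ^^ n) m" for n
  have eS: "e (Suc n) = nxt (e n)" for n by (simp add: e_def)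
  have sm: "strict_mono e" unfolding strict_mono_Suc_iff eS using nxt by blast
  have eA: "e n \<in> A" for n by (cases n) (use mA nxt in \<open>auto simp: e_def\<close>)
  have large: "\<exists>n. e n > R" for R
  proof (rule ccontr)
    assume "\<not> ?thesis"
    then have "range e \<subseteq> {x \<in> A. x \<le> R}" using eA by (auto simp: not_less)
    then have "finite (range e)" using fin finite_subset by blast
    then show False using sm strict_mono_imp_inj_on[of e] finite_imageD infinite_UNIV_nat by blast
  qed
  have "A \<subseteq> range e"
  proof
    fix x assume x: "x \<in> A"
    show "x \<in> range e"
    proof (rule ccontr)
      assume no: "x \<notin> range e"
      have "e n < x" for n
      proof (induction n)
        case 0
        have "e 0 \<le> x" using mle[OF x] by (simp add: e_def)
        moreover have "e 0 \<noteq> x" using no by auto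
        ultimately show ?case by simp
      next
        case (Suc n)
        have "e (Suc n) \<le> x" unfolding eS using nxt x Suc by blast
        moreover have "e (Suc n) \<noteq> x" using no by auto
        ultimately show ?case by simp
      qed
      then show False using large[of x] by (meson less_asym)
    qed
  qed
  then have "range e = A" using eA by blast
  moreover have "filterlim e at_top sequentially"
    unfolding filterlim_at_top
  proof
    fix R
    obtain n where n: "e n > R" using large by blast
    have "R \<le> e k" if "k \<ge> n" for k
      using n strict_mono_leD[OF sm that] by simp
    then show "eventually (\<lambda>k. R \<le> e k) sequentially" unfolding eventually_sequentially by blast
  qed
  ultimately show thesis using that sm by blast
qed

section \<open>The spectrum\<close>

lemma the1_iff: "\<exists>!x. P x \<Longrightarrow> y = (THE x. P x) \<longleftrightarrow> P y"
  by (auto intro: theI' the1_equality[symmetric])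

lemma root_part_eq: "r \<ge> 0 \<Longrightarrow> root_part \<kappa> m (\<kappa> * real m ^ 4 + r\<^sup>2) = r"
  by (simp add: root_part_def)

lemma power4_eq_square: "(x::real) ^ 4 = (x\<^sup>2)\<^sup>2"
  by (simp add: power_mult[symmetric])

lemma generated_by_multiple:
  assumes G: "mode_eigen l \<nu> ((real m)\<^sup>2) \<rho> G" and l: "l > 0" and m: "m \<ge> 1" and \<nu>: "0 < \<nu>" "\<nu> < 1"
    and \<mu>: "\<mu> = \<kappa> * real m ^ 4 + \<rho>" and c: "c \<noteq> 0" and f: "\<And>y. f y = c * G 0 y"
  shows "eigenfunctions_generated_by l \<nu> \<kappa> m \<mu> (\<lambda>(x, y). f y * sin (real m * x))"
proof -
  have "(\<lambda>(x, y). f y * sin (real m * x)) = sep (sine m) ((\<lambda>k y. c * G k y) 0)"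
    by (auto simp: fun_eq_iff sep_def sine_def f)
  then show ?thesis
    using mode_eigenfunctions_generated[OF mode_eigen_scale[OF G c] l m \<nu> \<mu>] by simp
qed

lemma generated_imp_eigenvalue:
  "eigenfunctions_generated_by l \<nu> \<kappa> m \<mu> w \<Longrightarrow> is_eigenvalue l \<nu> \<kappa> \<mu>"
  by (auto simp: eigenfunctions_generated_by_def is_eigenvalue_def)

lemma generated_above:
  assumes \<rho>: "\<rho> \<in> upper_spectrum l \<nu> ((real m)\<^sup>2)" and l: "l > 0" and m: "m \<ge> 1" and \<nu>: "0 < \<nu>" "\<nu> < 1"
    and \<mu>: "\<mu> = \<kappa> * real m ^ 4 + \<rho>"
  shows "\<exists>a b c d. eigenfunctions_generated_by l \<nu> \<kappa> m \<mu> (eigfun_above \<kappa> m \<mu> a b c d)"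
proof -
  let ?M = "(real m)\<^sup>2"
  have M: "?M > 0" using m by simp
  obtain G where G: "mode_eigen l \<nu> ?M \<rho> G" and gt: "\<rho> > ?M\<^sup>2"
    using \<rho> unfolding upper_spectrum_def by blast
  obtain \<gamma> where \<gamma>: "\<gamma> > 0" "\<rho> = (\<gamma>\<^sup>2 + ?M)\<^sup>2" using upper_spectrum_param[OF M gt] by blast
  define r where "r = \<gamma>\<^sup>2 + ?M"
  have r: "r > 0" using M by (simp add: r_def add_nonneg_pos)
  have ode: "mode_ode ?M (r\<^sup>2) (\<lambda>_. 0) G" using G \<gamma>(2) by (simp add: mode_eigen_def r_def)
  obtain A B C D where FG: "\<And>k. G k = gsol ?M r A B C D k"
    using mode_ode_is_gsol[OF ode] r by blast
  have rp: "root_part \<kappa> m \<mu> = r" using root_part_eq[of r \<kappa> m] r \<mu> \<gamma>(2) by (simp add: r_def)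
  have b: "beta \<kappa> m \<mu> = sqrt (?M + r)" unfolding beta_def rp by (simp add: add.commute)
  have g: "gamma_above \<kappa> m \<mu> = \<gamma>" unfolding gamma_above_def rp using \<gamma>(1) by (simp add: r_def)
  have bp: "?M + r > 0" using M r by (rule add_pos_pos)
  have t: "?M - r = - \<gamma>\<^sup>2" by (simp add: r_def)
  have gs: "gcosh (- \<gamma>\<^sup>2) y = cos (\<gamma> * y)" "gsinh (- \<gamma>\<^sup>2) y = sin (\<gamma> * y) / \<gamma>" for y
    using \<gamma>(1) by (simp_all add: gcosh_def gsinh_def)
  define f where "f y = A * cosh (beta \<kappa> m \<mu> * y) + B / beta \<kappa> m \<mu> * sinh (beta \<kappa> m \<mu> * y)
      + C * cos (gamma_above \<kappa> m \<mu> * y) + D / \<gamma> * sin (gamma_above \<kappa> m \<mu> * y)" for y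
  have "f y = 1 * G 0 y" for y
    unfolding f_def FG gsol_0 t gs g b using bp by (simp add: gcosh_def gsinh_def)
  from generated_by_multiple[OF G l m \<nu> \<mu> _ this]
  have "eigenfunctions_generated_by l \<nu> \<kappa> m \<mu> (eigfun_above \<kappa> m \<mu> A (B / beta \<kappa> m \<mu>) C (D / \<gamma>))"
    by (simp add: eigfun_above_def f_def)
  then show ?thesis by blast
qed

lemma generated_minus:
  assumes r: "(1 - \<nu>) * (real m)\<^sup>2 < r" "r < (real m)\<^sup>2" and e: "gap (1 - \<nu>) (even_profile l) ((real m)\<^sup>2) r = 0"
    and l: "l > 0" and m: "m \<ge> 1" and \<nu>: "0 < \<nu>" "\<nu> < 1" and \<mu>: "\<mu> = \<kappa> * real m ^ 4 + r\<^sup>2"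
  shows "eigenfunctions_generated_by l \<nu> \<kappa> m \<mu> (eigfun_minus l \<nu> \<kappa> m \<mu>)"
proof -
  let ?M = "(real m)\<^sup>2"
  have M: "?M > 0" using m by simp
  have "0 < 1 - \<nu>" using \<nu> by simp
  from less_trans[OF mult_pos_pos[OF this M] r(1)] have r0: "r > 0" .
  have ec: "even_char l \<nu> ?M r = 0" using char_zero_iff_gap_zero(1)[OF r0 _ l, of ?M \<nu>] e r by simp
  note G = even_eigen[OF ec l M r0 \<nu>(2)]
  have rp: "root_part \<kappa> m \<mu> = r" using root_part_eq[of r \<kappa> m] r0 \<mu> by simp
  define b g where "b = sqrt (?M + r)" and "g = sqrt (?M - r)"
  have bg: "beta \<kappa> m \<mu> = b" "gamma_below \<kappa> m \<mu> = g"
    unfolding beta_def gamma_below_def rp b_def g_def by (simp_all add: add.commute)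
  have gc: "gcosh (?M + r) y = cosh (b * y)" "gcosh (?M - r) y = cosh (g * y)" for y
    using r r0 M by (simp_all add: gcosh_def b_def g_def)
  have nz: "cosh (b * l) \<noteq> 0" "cosh (g * l) \<noteq> 0" by simp_all
  have "(r - (1 - \<nu>) * ?M) / cosh (b * l) * cosh (b * y) + (r + (1 - \<nu>) * ?M) / cosh (g * l) * cosh (g * y)
     = 1 / (cosh (b * l) * cosh (g * l)) * gsol ?M r ((r - (1 - \<nu>) * ?M) * gcosh (?M - r) l) 0 ((r + (1 - \<nu>) * ?M) * gcosh (?M + r) l) 0 0 y" for y
    unfolding gsol_0 gc using nz by (simp add: distrib_left)
  from generated_by_multiple[OF G l m \<nu> \<mu> _ this] show ?thesis
    unfolding eigfun_minus_def rp bg by simp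
qed

lemma generated_plus:
  assumes r: "(1 - \<nu>) * (real m)\<^sup>2 < r" "r < (real m)\<^sup>2" and e: "gap (1 - \<nu>) (odd_profile l) ((real m)\<^sup>2) r = 0"
    and l: "l > 0" and m: "m \<ge> 1" and \<nu>: "0 < \<nu>" "\<nu> < 1" and \<mu>: "\<mu> = \<kappa> * real m ^ 4 + r\<^sup>2"
  shows "eigenfunctions_generated_by l \<nu> \<kappa> m \<mu> (eigfun_plus l \<nu> \<kappa> m \<mu>)"
proof -
  let ?M = "(real m)\<^sup>2"
  have M: "?M > 0" using m by simp
  have "0 < 1 - \<nu>" using \<nu> by simp
  from less_trans[OF mult_pos_pos[OF this M] r(1)] have r0: "r > 0" .
  have oc: "odd_char l \<nu> ?M r = 0" using char_zero_iff_gap_zero(2)[OF r0 _ l, of ?M \<nu>] e r by simp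
  note G = odd_eigen[OF oc l M r0 \<nu>(2)]
  have rp: "root_part \<kappa> m \<mu> = r" using root_part_eq[of r \<kappa> m] r0 \<mu> by simp
  define b g where "b = sqrt (?M + r)" and "g = sqrt (?M - r)"
  have bg: "beta \<kappa> m \<mu> = b" "gamma_below \<kappa> m \<mu> = g"
    unfolding beta_def gamma_below_def rp b_def g_def by (simp_all add: add.commute)
  have gs: "gsinh (?M + r) y = sinh (b * y) / b" "gsinh (?M - r) y = sinh (g * y) / g" for y
    using r r0 M by (simp_all add: gsinh_def b_def g_def)
  have bgp: "b > 0" "g > 0" using r r0 M by (simp_all add: b_def g_def)
  have nz: "sinh (b * l) \<noteq> 0" "sinh (g * l) \<noteq> 0" using bgp l by simp_all
  have eq: "(r - (1 - \<nu>) * ?M) / sinh (b * l) * sinh (b * y) + (r + (1 - \<nu>) * ?M) / sinh (g * l) * sinh (g * y)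
     = (b * g) / (sinh (b * l) * sinh (g * l)) * gsol ?M r 0 ((r - (1 - \<nu>) * ?M) * gsinh (?M - r) l) 0 ((r + (1 - \<nu>) * ?M) * gsinh (?M + r) l) 0 y" for y
    unfolding gsol_0 gs using nz bgp by (simp add: distrib_left)
  have "(b * g) / (sinh (b * l) * sinh (g * l)) \<noteq> 0" using nz bgp by simp
  from generated_by_multiple[OF G l m \<nu> \<mu> this eq] show ?thesis
    unfolding eigfun_plus_def rp bg .
qed

lemma poisson_ratio_factor:
  fixes \<nu> :: real
  assumes "0 < \<nu>" "\<nu> < 1" shows "0 < (\<nu> / (2 - \<nu>))\<^sup>2" "(\<nu> / (2 - \<nu>))\<^sup>2 < 1"
proof -
  have *: "0 < \<nu> / (2 - \<nu>)" "\<nu> / (2 - \<nu>) < 1" using assms by (simp_all add: field_simps)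
  show "0 < (\<nu> / (2 - \<nu>))\<^sup>2" by (rule zero_less_power[OF *(1)])
  show "(\<nu> / (2 - \<nu>))\<^sup>2 < 1" using power_strict_mono[OF *(2), of 2] *(1) by simp
qed

lemma s_bar_unique:
  assumes "0 < \<nu>" "\<nu> < 1" shows "\<exists>!s::real. s > 0 \<and> tanh s = (\<nu> / (2 - \<nu>))\<^sup>2 * s"
  by (rule tanh_line_unique[OF poisson_ratio_factor[OF assms]])

lemma s_bar_iff:
  assumes "0 < \<nu>" "\<nu> < 1"
  shows "s = s_bar \<nu> \<longleftrightarrow> s > 0 \<and> tanh s = (\<nu> / (2 - \<nu>))\<^sup>2 * s"
  unfolding s_bar_def by (rule the1_iff[OF s_bar_unique[OF assms]])

lemma tanh_eq_iff_coth:
  fixes \<nu> s :: real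
  assumes \<nu>: "0 < \<nu>" "\<nu> < 1" and s: "s > 0"
  shows "tanh s = (\<nu> / (2 - \<nu>))\<^sup>2 * s \<longleftrightarrow> s * (cosh s / sinh s) = ((2 - \<nu>) / \<nu>)\<^sup>2"
proof -
  define k where "k = (\<nu> / (2 - \<nu>))\<^sup>2"
  have k: "k > 0" using poisson_ratio_factor[OF \<nu>] by (simp add: k_def)
  have ik: "((2 - \<nu>) / \<nu>)\<^sup>2 = 1 / k" by (simp add: k_def power_divide)
  have sh: "sinh s > 0" "cosh s > 0" using s by simp_all
  have "tanh s = k * s \<longleftrightarrow> sinh s = k * s * cosh s" using sh by (simp add: tanh_def divide_eq_eq)
  also have "\<dots> \<longleftrightarrow> s * (cosh s / sinh s) = 1 / k"
    using k sh by (auto simp: field_simps)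
  finally show ?thesis unfolding ik k_def[symmetric] .
qed

lemma sqrt_2_square: "sqrt (2 * (real m)\<^sup>2) = sqrt 2 * real m"
  by (simp add: real_sqrt_mult)

lemma critical_iff:
  assumes \<nu>: "0 < \<nu>" "\<nu> < 1" and l: "l > 0" and m: "m \<ge> 1"
  shows "real m = m_star l \<nu> \<longleftrightarrow> gap (1 - \<nu>) (odd_profile l) ((real m)\<^sup>2) ((real m)\<^sup>2) = 0"
proof -
  define s where "s = sqrt (2 * (real m)\<^sup>2) * l"
  have s: "s > 0" using l m by (simp add: s_def)
  have M: "(real m)\<^sup>2 > 0" using m by simp
  have "real m = m_star l \<nu> \<longleftrightarrow> s = s_bar \<nu>"
    using l by (auto simp: m_star_def s_def sqrt_2_square field_simps)
  also have "\<dots> \<longleftrightarrow> s * (cosh s / sinh s) = ((2 - \<nu>) / \<nu>)\<^sup>2"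
    using s_bar_iff[OF \<nu>] tanh_eq_iff_coth[OF \<nu> s] s by simp
  also have "\<dots> \<longleftrightarrow> gap (1 - \<nu>) (odd_profile l) ((real m)\<^sup>2) ((real m)\<^sup>2) = 0"
    unfolding odd_gap_at_M[OF \<nu>(1) M l] s_def[symmetric] using \<nu> l M by auto
  finally show ?thesis .
qed

lemma plus_condition_iff:
  assumes \<nu>: "0 < \<nu>" "\<nu> < 1" and l: "l > 0" and m: "m \<ge> 1"
  shows "plus_condition l \<nu> m \<longleftrightarrow> gap (1 - \<nu>) (odd_profile l) ((real m)\<^sup>2) ((real m)\<^sup>2) < 0"
proof -
  define s where "s = sqrt (2 * (real m)\<^sup>2) * l"
  have M: "(real m)\<^sup>2 > 0" using m by simp
  have s: "l * real m * sqrt 2 = s" by (simp add: s_def sqrt_2_square)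
  define K where "K = \<nu>\<^sup>2 * ((real m)\<^sup>2)\<^sup>2 / l"
  have K: "K > 0" using \<nu> l M by (simp add: K_def)
  have "gap (1 - \<nu>) (odd_profile l) ((real m)\<^sup>2) ((real m)\<^sup>2) = K * (((2 - \<nu>) / \<nu>)\<^sup>2 - s * (cosh s / sinh s))"
    unfolding odd_gap_at_M[OF \<nu>(1) M l] K_def s_def ..
  then show ?thesis unfolding plus_condition_def coth_def s
    using K by (simp add: mult_less_0_iff)
qed

lemma generated_critical:
  assumes \<nu>: "0 < \<nu>" "\<nu> < 1" and l: "l > 0" and m: "real m = m_star l \<nu>"
  shows "eigenfunctions_generated_by l \<nu> \<kappa> m ((\<kappa> + 1) * real m ^ 4) (eigfun_critical l \<nu> m)" and "m \<ge> 1"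
proof -
  have "s_bar \<nu> > 0" using s_bar_iff[OF \<nu>, of "s_bar \<nu>"] by simp
  then have "real m > 0" unfolding m m_star_def using l by simp
  then show m1: "m \<ge> 1" by simp
  let ?M = "(real m)\<^sup>2"
  have M: "?M > 0" using m1 by simp
  have oc: "odd_char l \<nu> ?M ?M = 0"
    using char_zero_iff_gap_zero(2)[OF M order_refl l, of \<nu>] critical_iff[OF \<nu> l m1] m by simp
  note G = odd_eigen[OF oc l M M \<nu>(2)]
  have \<mu>: "(\<kappa> + 1) * real m ^ 4 = \<kappa> * real m ^ 4 + ?M\<^sup>2" unfolding power4_eq_square by (simp only: distrib_right mult_1_left)
  define b where "b = sqrt 2 * real m"
  have b: "b > 0" using m1 by (simp add: b_def)
  have gs: "gsinh (?M + ?M) y = sinh (b * y) / b" "gsinh (?M - ?M) y = y" for y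
    using M sqrt_2_square[of m] by (simp_all add: gsinh_def b_def)
  have a: "?M - (1 - \<nu>) * ?M = \<nu> * ?M" "?M + (1 - \<nu>) * ?M = (2 - \<nu>) * ?M" by (simp_all add: algebra_simps)
  have eq: "\<nu> * l * sinh (b * y) + (2 - \<nu>) * sinh (b * l) * y
     = (b / ?M) * gsol ?M ?M 0 ((?M - (1 - \<nu>) * ?M) * gsinh (?M - ?M) l) 0 ((?M + (1 - \<nu>) * ?M) * gsinh (?M + ?M) l) 0 y" for y
  proof -
    have "(b / K) * ((\<nu> * K * l) * (S / b)) = \<nu> * l * S" "(b / K) * (((2 - \<nu>) * K * (S / b)) * y) = (2 - \<nu>) * S * y"
      if "K \<noteq> 0" for K S using b that by simp_all
    note c = this[OF less_imp_neq[OF M, symmetric]]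
    show ?thesis unfolding gsol_0 a gs by (simp only: mult_zero_left add_0_left distrib_left c)
  qed
  have nz: "b / ?M \<noteq> 0" using b M by simp
  from generated_by_multiple[OF G l m1 \<nu> \<mu> nz eq]
  show "eigenfunctions_generated_by l \<nu> \<kappa> m ((\<kappa> + 1) * real m ^ 4) (eigfun_critical l \<nu> m)"
    unfolding eigfun_critical_def b_def .
qed

definition minus_root :: "real \<Rightarrow> real \<Rightarrow> nat \<Rightarrow> real" where
  "minus_root l \<nu> m = (THE r. (1 - \<nu>) * (real m)\<^sup>2 < r \<and> r < (real m)\<^sup>2 \<and> gap (1 - \<nu>) (even_profile l) ((real m)\<^sup>2) r = 0)"

definition plus_root :: "real \<Rightarrow> real \<Rightarrow> nat \<Rightarrow> real" where
  "plus_root l \<nu> m = (THE r. (1 - \<nu>) * (real m)\<^sup>2 < r \<and> r < (real m)\<^sup>2 \<and> gap (1 - \<nu>) (odd_profile l) ((real m)\<^sup>2) r = 0)"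

lemma minus_root_iff:
  assumes \<nu>: "0 < \<nu>" "\<nu> < 1" and l: "l > 0" and m: "m \<ge> 1"
  shows "r = minus_root l \<nu> m \<longleftrightarrow>
    (1 - \<nu>) * (real m)\<^sup>2 < r \<and> r < (real m)\<^sup>2 \<and> gap (1 - \<nu>) (even_profile l) ((real m)\<^sup>2) r = 0"
proof -
  have M: "(real m)\<^sup>2 > 0" using m by simp
  have u: "\<exists>!r. (1 - \<nu>) * (real m)\<^sup>2 < r \<and> r < (real m)\<^sup>2 \<and> gap (1 - \<nu>) (even_profile l) ((real m)\<^sup>2) r = 0"
    by (rule gap_root[OF concave_even_profile[OF l] _ _ M even_gap_at_M[OF \<nu>(1) M l]]) (use \<nu> in auto)
  show ?thesis unfolding minus_root_def by (rule the1_iff[OF u])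
qed

lemma plus_root_iff:
  assumes \<nu>: "0 < \<nu>" "\<nu> < 1" and l: "l > 0" and m: "m \<ge> 1" and p: "plus_condition l \<nu> m"
  shows "r = plus_root l \<nu> m \<longleftrightarrow>
    (1 - \<nu>) * (real m)\<^sup>2 < r \<and> r < (real m)\<^sup>2 \<and> gap (1 - \<nu>) (odd_profile l) ((real m)\<^sup>2) r = 0"
proof -
  have M: "(real m)\<^sup>2 > 0" using m by simp
  have u: "\<exists>!r. (1 - \<nu>) * (real m)\<^sup>2 < r \<and> r < (real m)\<^sup>2 \<and> gap (1 - \<nu>) (odd_profile l) ((real m)\<^sup>2) r = 0"
    by (rule gap_root[OF concave_odd_profile[OF l] _ _ M]) (use \<nu> p plus_condition_iff[OF \<nu> l m] in auto)
  show ?thesis unfolding plus_root_def by (rule the1_iff[OF u])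
qed

text \<open>The energy estimate and \<open>(1 - \<nu>)\<^sup>2 \<le> 1 - \<nu>\<^sup>2\<close> place \<open>r = \<surd>\<rho>\<close> above \<open>(1 - \<nu>) M\<close>, where the
  analysis of the gap applies up to the threshold.\<close>

lemma mode_eigen_cases:
  assumes G: "mode_eigen l \<nu> ((real m)\<^sup>2) \<rho> G" and \<nu>: "0 < \<nu>" "\<nu> < 1" and l: "l > 0" and m: "m \<ge> 1"
  shows "\<rho> \<in> upper_spectrum l \<nu> ((real m)\<^sup>2) \<or> (real m = m_star l \<nu> \<and> \<rho> = ((real m)\<^sup>2)\<^sup>2) \<or>
    \<rho> = (minus_root l \<nu> m)\<^sup>2 \<or> (plus_condition l \<nu> m \<and> \<rho> = (plus_root l \<nu> m)\<^sup>2)"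
proof -
  let ?M = "(real m)\<^sup>2"
  have M: "?M > 0" using m by simp
  have low: "\<rho> > (1 - \<nu>\<^sup>2) * ?M\<^sup>2" by (rule mode_eigen_lower_bound[OF G l M \<nu>])
  have "(1 - \<nu>)\<^sup>2 \<le> 1 - \<nu>\<^sup>2"
  proof -
    have "1 - \<nu>\<^sup>2 - (1 - \<nu>)\<^sup>2 = 2 * (\<nu> * (1 - \<nu>))" by (simp add: power2_eq_square algebra_simps)
    moreover have "0 \<le> \<nu> * (1 - \<nu>)" using \<nu> by simp
    ultimately show ?thesis by linarith
  qed
  then have "(1 - \<nu>)\<^sup>2 * ?M\<^sup>2 \<le> (1 - \<nu>\<^sup>2) * ?M\<^sup>2" by (rule mult_right_mono) simp
  with low have low2: "((1 - \<nu>) * ?M)\<^sup>2 < \<rho>" by (simp add: power_mult_distrib)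
  define r where "r = sqrt \<rho>"
  have \<rho>0: "\<rho> > 0" using low2 zero_le_power2[of "(1 - \<nu>) * ?M"] by linarith
  have \<rho>: "\<rho> = r\<^sup>2" and r0: "r > 0" using \<rho>0 by (simp_all add: r_def)
  have ra: "(1 - \<nu>) * ?M < r" using low2 r0 unfolding \<rho> by (simp add: power2_less_imp_less)
  have ch: "even_char l \<nu> ?M r = 0 \<or> odd_char l \<nu> ?M r = 0"
    by (rule eigen_imp_char_zero[OF G[unfolded \<rho>] r0])
  consider "r < ?M" | "r = ?M" | "?M < r" by linarith
  then show ?thesis
  proof cases
    case 1
    have "gap (1 - \<nu>) (even_profile l) ?M r = 0 \<or> gap (1 - \<nu>) (odd_profile l) ?M r = 0"
      using ch char_zero_iff_gap_zero[OF r0 _ l, of ?M \<nu>] 1 by simp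
    then show ?thesis
    proof
      assume "gap (1 - \<nu>) (even_profile l) ?M r = 0"
      then show ?thesis using minus_root_iff[OF \<nu> l m, of r] ra 1 \<rho> by blast
    next
      assume o: "gap (1 - \<nu>) (odd_profile l) ?M r = 0"
      have "gap (1 - \<nu>) (odd_profile l) ?M ?M < 0"
        using gap_no_root[OF concave_odd_profile[OF l] _ M _ ra 1] o \<nu> by force
      then have p: "plus_condition l \<nu> m" using plus_condition_iff[OF \<nu> l m] by simp
      then show ?thesis using plus_root_iff[OF \<nu> l m p, of r] ra 1 \<rho> o by blast
    qed
  next
    case 2
    have "gap (1 - \<nu>) (even_profile l) ?M ?M \<noteq> 0" using even_gap_at_M[OF \<nu>(1) M l] by simp
    then have "gap (1 - \<nu>) (odd_profile l) ?M ?M = 0"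
      using ch char_zero_iff_gap_zero[OF M order_refl l, of \<nu>] unfolding 2 by blast
    then show ?thesis using critical_iff[OF \<nu> l m] \<rho> 2 by simp
  next
    case 3
    then have "?M\<^sup>2 < r\<^sup>2" by (intro power_strict_mono) auto
    then show ?thesis using G \<rho> unfolding upper_spectrum_def by blast
  qed
qed

lemma minus_root_less_plus_root:
  assumes \<nu>: "0 < \<nu>" "\<nu> < 1" and l: "l > 0" and m: "m \<ge> 1" and p: "plus_condition l \<nu> m"
  shows "minus_root l \<nu> m < plus_root l \<nu> m"
proof -
  have "(real m)\<^sup>2 > 0" using m by simp
  then show ?thesis
    using even_root_less_odd_root[OF \<nu> _ l] minus_root_iff[OF \<nu> l m] plus_root_iff[OF \<nu> l m p] by blast
qed

lemma minus_root_strict_mono: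
  assumes \<nu>: "0 < \<nu>" "\<nu> < 1" and l: "l > 0" and m: "m \<ge> 1" "m < n"
  shows "minus_root l \<nu> m < minus_root l \<nu> n"
proof -
  have M: "0 < (real m)\<^sup>2" "(real m)\<^sup>2 < (real n)\<^sup>2" using m by (auto intro: power_strict_mono)
  have n: "n \<ge> 1" using m by simp
  show ?thesis
    using gap_root_increasing[OF concave_even_profile[OF l] _ _ M, of "1 - \<nu>" "minus_root l \<nu> m" "minus_root l \<nu> n"]
      minus_root_iff[OF \<nu> l m(1), of "minus_root l \<nu> m"] minus_root_iff[OF \<nu> l n, of "minus_root l \<nu> n"] \<nu> by simp
qed

lemma plus_root_strict_mono:
  assumes \<nu>: "0 < \<nu>" "\<nu> < 1" and l: "l > 0" and m: "m \<ge> 1" "m < n"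
    and p: "plus_condition l \<nu> m" "plus_condition l \<nu> n"
  shows "plus_root l \<nu> m < plus_root l \<nu> n"
proof -
  have M: "0 < (real m)\<^sup>2" "(real m)\<^sup>2 < (real n)\<^sup>2" using m by (auto intro: power_strict_mono)
  have n: "n \<ge> 1" using m by simp
  show ?thesis
    using gap_root_increasing[OF concave_odd_profile[OF l] _ _ M, of "1 - \<nu>" "plus_root l \<nu> m" "plus_root l \<nu> n"]
      plus_root_iff[OF \<nu> l m(1) p(1), of "plus_root l \<nu> m"] plus_root_iff[OF \<nu> l n p(2), of "plus_root l \<nu> n"] \<nu> by simp
qed

lemma eigenvalue_less:
  assumes "\<kappa> > 0" "0 < r" "r < s" "m \<le> n"
  shows "\<kappa> * real m ^ 4 + r\<^sup>2 < \<kappa> * real n ^ 4 + s\<^sup>2"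
proof -
  have "r\<^sup>2 < s\<^sup>2" using assms by (intro power_strict_mono) auto
  moreover have "\<kappa> * real m ^ 4 \<le> \<kappa> * real n ^ 4"
    using assms by (intro mult_left_mono power_mono) auto
  ultimately show ?thesis by linarith
qed

theorem theorem3p3:
  fixes l \<nu> \<kappa> E1 E2 :: real
  assumes "l > 0" and "0 < \<nu>" and "\<nu> < 1 / 2"
    and "E1 > E2" and "E2 > 0" and "\<kappa> = (E1 - E2) / E2"
  shows "(\<exists>!s::real. s > 0 \<and> tanh s = (\<nu> / (2 - \<nu>))\<^sup>2 * s) \<and>
    (\<exists>(lam :: nat \<Rightarrow> nat \<Rightarrow> real) (lam_minus :: nat \<Rightarrow> real) (lam_plus :: nat \<Rightarrow> real).
      \<comment> \<open>(i)\<close>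
      (\<forall>m\<ge>1.
         strict_mono_on {1..} (\<lambda>j. lam j m) \<and> filterlim (\<lambda>j. lam j m) at_top sequentially \<and>
         (\<forall>j\<ge>1. lam j m > (\<kappa> + 1) * real m ^ 4 \<and> is_eigenvalue l \<nu> \<kappa> (lam j m) \<and>
            (\<exists>a b c d. eigenfunctions_generated_by l \<nu> \<kappa> m (lam j m)
                         (eigfun_above \<kappa> m (lam j m) a b c d)))) \<and>
      \<comment> \<open>(ii)\<close>
      (\<forall>m. real m = m_star l \<nu> \<longrightarrow>
         is_eigenvalue l \<nu> \<kappa> ((\<kappa> + 1) * real m ^ 4) \<and>
         eigenfunctions_generated_by l \<nu> \<kappa> m ((\<kappa> + 1) * real m ^ 4) (eigfun_critical l \<nu> m)) \<and>
      \<comment> \<open>(iii)\<close>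
      (\<forall>m\<ge>1.
         lam_minus m \<in> {((1 - \<nu>)\<^sup>2 + \<kappa>) * real m ^ 4 <..< (\<kappa> + 1) * real m ^ 4} \<and>
         is_eigenvalue l \<nu> \<kappa> (lam_minus m) \<and>
         eigenfunctions_generated_by l \<nu> \<kappa> m (lam_minus m) (eigfun_minus l \<nu> \<kappa> m (lam_minus m))) \<and>
      strict_mono_on {1..} lam_minus \<and>
      \<comment> \<open>(iv)\<close>
      (\<forall>m\<ge>1. plus_condition l \<nu> m \<longrightarrow>
         lam_plus m \<in> {lam_minus m <..< (\<kappa> + 1) * real m ^ 4} \<and>
         is_eigenvalue l \<nu> \<kappa> (lam_plus m) \<and>
         eigenfunctions_generated_by l \<nu> \<kappa> m (lam_plus m) (eigfun_plus l \<nu> \<kappa> m (lam_plus m))) \<and>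
      strict_mono_on {m. m \<ge> 1 \<and> plus_condition l \<nu> m} lam_plus \<and>
      \<comment> \<open>(v)\<close>
      (\<forall>\<mu>. is_eigenvalue l \<nu> \<kappa> \<mu> \<longrightarrow>
         (\<exists>m. listed_eigenvalue l \<nu> \<kappa> lam lam_minus lam_plus m \<mu>)) \<and>
      \<comment> \<open>every eigenfunction is a finite combination of the generators listed above\<close>
      (\<forall>\<mu> u. is_eigenfunction l \<nu> \<kappa> \<mu> u \<longrightarrow>
         (\<exists>M w. finite M \<and>
            (\<forall>m\<in>M. listed_eigenvalue l \<nu> \<kappa> lam lam_minus lam_plus m \<mu> \<and>
                    is_eigenfunction l \<nu> \<kappa> \<mu> (w m) \<and> in_mode l m (w m)) \<and>
            (AE p in lebesgue_on (plate l). u p = (\<Sum>m\<in>M. w m p)))))"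
proof -
  note l = \<open>l > 0\<close>
  have \<nu>: "0 < \<nu>" "\<nu> < 1" using assms by simp_all
  have \<kappa>: "\<kappa> > 0" using assms by simp
  have "\<exists>e. strict_mono e \<and> range e = upper_spectrum l \<nu> ((real m)\<^sup>2) \<and> filterlim e at_top sequentially"
    if m: "m \<ge> 1" for m :: nat
  proof -
    have M: "(real m)\<^sup>2 > 0" using m by simp
    show ?thesis
      using discrete_set_enumeration[OF upper_spectrum_infinite[OF M l \<nu>] upper_spectrum_finite[OF M l \<nu>]] by metis
  qed
  then obtain e :: "nat \<Rightarrow> nat \<Rightarrow> real" where e: "\<And>m. m \<ge> 1 \<Longrightarrow> strict_mono (e m)"
    "\<And>m. m \<ge> 1 \<Longrightarrow> range (e m) = upper_spectrum l \<nu> ((real m)\<^sup>2)"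
    "\<And>m. m \<ge> 1 \<Longrightarrow> filterlim (e m) at_top sequentially"
    by metis
  \<comment> \<open>the enumerations start at \<open>0\<close>, the sequences of eigenvalues at \<open>1\<close>\<close>
  define lam where "lam j m = \<kappa> * real m ^ 4 + e m (j - 1)" for j m
  define lam_minus where "lam_minus m = \<kappa> * real m ^ 4 + (minus_root l \<nu> m)\<^sup>2" for m
  define lam_plus where "lam_plus m = \<kappa> * real m ^ 4 + (plus_root l \<nu> m)\<^sup>2" for m
  have minus: "(1 - \<nu>) * (real m)\<^sup>2 < minus_root l \<nu> m" "minus_root l \<nu> m < (real m)\<^sup>2"
    "gap (1 - \<nu>) (even_profile l) ((real m)\<^sup>2) (minus_root l \<nu> m) = 0" "0 < minus_root l \<nu> m" if m: "m \<ge> 1" for m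
  proof -
    show *: "(1 - \<nu>) * (real m)\<^sup>2 < minus_root l \<nu> m" "minus_root l \<nu> m < (real m)\<^sup>2"
      "gap (1 - \<nu>) (even_profile l) ((real m)\<^sup>2) (minus_root l \<nu> m) = 0"
      using minus_root_iff[OF \<nu> l m, of "minus_root l \<nu> m"] by simp_all
    have "0 < 1 - \<nu>" "0 < (real m)\<^sup>2" using \<nu> m by simp_all
    then show "0 < minus_root l \<nu> m" by (rule less_trans[OF mult_pos_pos *(1)])
  qed
  have plus: "(1 - \<nu>) * (real m)\<^sup>2 < plus_root l \<nu> m" "plus_root l \<nu> m < (real m)\<^sup>2"
    "gap (1 - \<nu>) (odd_profile l) ((real m)\<^sup>2) (plus_root l \<nu> m) = 0" "0 < plus_root l \<nu> m"
    if m: "m \<ge> 1" "plus_condition l \<nu> m" for m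
  proof -
    show *: "(1 - \<nu>) * (real m)\<^sup>2 < plus_root l \<nu> m" "plus_root l \<nu> m < (real m)\<^sup>2"
      "gap (1 - \<nu>) (odd_profile l) ((real m)\<^sup>2) (plus_root l \<nu> m) = 0"
      using plus_root_iff[OF \<nu> l m, of "plus_root l \<nu> m"] by simp_all
    have "0 < 1 - \<nu>" "0 < (real m)\<^sup>2" using \<nu> m by simp_all
    then show "0 < plus_root l \<nu> m" by (rule less_trans[OF mult_pos_pos *(1)])
  qed
  have top: "(\<kappa> + 1) * real m ^ 4 = \<kappa> * real m ^ 4 + ((real m)\<^sup>2)\<^sup>2" for m
    unfolding power4_eq_square by (simp only: distrib_right mult_1_left)
  have i: "strict_mono_on {1..} (\<lambda>j. lam j m) \<and> filterlim (\<lambda>j. lam j m) at_top sequentially \<and>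
         (\<forall>j\<ge>1. lam j m > (\<kappa> + 1) * real m ^ 4 \<and> is_eigenvalue l \<nu> \<kappa> (lam j m) \<and>
            (\<exists>a b c d. eigenfunctions_generated_by l \<nu> \<kappa> m (lam j m)
                         (eigfun_above \<kappa> m (lam j m) a b c d)))" if m: "m \<ge> 1" for m
  proof (intro conjI allI impI)
    show "strict_mono_on {1..} (\<lambda>j. lam j m)"
      using e(1)[OF m] by (auto simp: strict_mono_on_def lam_def strict_mono_def)
    have "filterlim (\<lambda>j. e m (j - 1)) at_top sequentially"
      by (rule filterlim_compose[OF e(3)[OF m] filterlim_minus_const_nat_at_top])
    then show "filterlim (\<lambda>j. lam j m) at_top sequentially"
      unfolding lam_def by (rule filterlim_tendsto_add_at_top[OF tendsto_const])
    fix j :: nat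
    have up: "e m (j - 1) \<in> upper_spectrum l \<nu> ((real m)\<^sup>2)" using e(2)[OF m] by blast
    then show "lam j m > (\<kappa> + 1) * real m ^ 4" unfolding top lam_def upper_spectrum_def by simp
    show gen: "\<exists>a b c d. eigenfunctions_generated_by l \<nu> \<kappa> m (lam j m) (eigfun_above \<kappa> m (lam j m) a b c d)"
      by (rule generated_above[OF up l m \<nu>]) (simp add: lam_def)
    then show "is_eigenvalue l \<nu> \<kappa> (lam j m)" using generated_imp_eigenvalue by blast
  qed
  have ii: "is_eigenvalue l \<nu> \<kappa> ((\<kappa> + 1) * real m ^ 4) \<and>
         eigenfunctions_generated_by l \<nu> \<kappa> m ((\<kappa> + 1) * real m ^ 4) (eigfun_critical l \<nu> m)"
    if "real m = m_star l \<nu>" for m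
    using generated_critical(1)[OF \<nu> l that] generated_imp_eigenvalue by blast
  have iii: "lam_minus m \<in> {((1 - \<nu>)\<^sup>2 + \<kappa>) * real m ^ 4 <..< (\<kappa> + 1) * real m ^ 4} \<and>
         is_eigenvalue l \<nu> \<kappa> (lam_minus m) \<and>
         eigenfunctions_generated_by l \<nu> \<kappa> m (lam_minus m) (eigfun_minus l \<nu> \<kappa> m (lam_minus m))" if m: "m \<ge> 1" for m
  proof -
    have gen: "eigenfunctions_generated_by l \<nu> \<kappa> m (lam_minus m) (eigfun_minus l \<nu> \<kappa> m (lam_minus m))"
      by (rule generated_minus[OF minus(1,2,3)[OF m] l m \<nu>]) (simp add: lam_minus_def)
    have "0 \<le> (1 - \<nu>) * (real m)\<^sup>2" using \<nu> by simp
    then have "((1 - \<nu>) * (real m)\<^sup>2)\<^sup>2 < (minus_root l \<nu> m)\<^sup>2"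
      by (rule power_strict_mono[OF minus(1)[OF m]]) simp
    moreover have "(minus_root l \<nu> m)\<^sup>2 < ((real m)\<^sup>2)\<^sup>2"
      by (rule power_strict_mono[OF minus(2)[OF m] less_imp_le[OF minus(4)[OF m]]]) simp
    moreover have "((1 - \<nu>)\<^sup>2 + \<kappa>) * real m ^ 4 = \<kappa> * real m ^ 4 + ((1 - \<nu>) * (real m)\<^sup>2)\<^sup>2"
      unfolding power4_eq_square by (simp only: distrib_right power_mult_distrib add.commute)
    ultimately have "lam_minus m \<in> {((1 - \<nu>)\<^sup>2 + \<kappa>) * real m ^ 4 <..< (\<kappa> + 1) * real m ^ 4}"
      unfolding top lam_minus_def by simp
    then show ?thesis using gen generated_imp_eigenvalue by blast
  qed
  have iii': "strict_mono_on {1..} lam_minus"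
    unfolding strict_mono_on_def lam_minus_def
    using eigenvalue_less[OF \<kappa> minus(4) minus_root_strict_mono[OF \<nu> l]] by auto
  have iv: "lam_plus m \<in> {lam_minus m <..< (\<kappa> + 1) * real m ^ 4} \<and>
         is_eigenvalue l \<nu> \<kappa> (lam_plus m) \<and>
         eigenfunctions_generated_by l \<nu> \<kappa> m (lam_plus m) (eigfun_plus l \<nu> \<kappa> m (lam_plus m))"
    if m: "m \<ge> 1" and p: "plus_condition l \<nu> m" for m
  proof -
    have gen: "eigenfunctions_generated_by l \<nu> \<kappa> m (lam_plus m) (eigfun_plus l \<nu> \<kappa> m (lam_plus m))"
      by (rule generated_plus[OF plus(1,2,3)[OF m p] l m \<nu>]) (simp add: lam_plus_def)
    have "lam_minus m < lam_plus m" unfolding lam_minus_def lam_plus_def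
      by (rule eigenvalue_less[OF \<kappa> minus(4)[OF m] minus_root_less_plus_root[OF \<nu> l m p] order_refl])
    moreover have "(plus_root l \<nu> m)\<^sup>2 < ((real m)\<^sup>2)\<^sup>2"
      by (rule power_strict_mono[OF plus(2)[OF m p] less_imp_le[OF plus(4)[OF m p]]]) simp
    ultimately have "lam_plus m \<in> {lam_minus m <..< (\<kappa> + 1) * real m ^ 4}" unfolding top by (simp add: lam_plus_def)
    then show ?thesis using gen generated_imp_eigenvalue by blast
  qed
  have iv': "strict_mono_on {m. m \<ge> 1 \<and> plus_condition l \<nu> m} lam_plus"
    unfolding strict_mono_on_def lam_plus_def
    using eigenvalue_less[OF \<kappa> plus(4) plus_root_strict_mono[OF \<nu> l]] by auto
  have listed: "listed_eigenvalue l \<nu> \<kappa> lam lam_minus lam_plus m \<mu>"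
    if m: "m \<ge> 1" and G: "mode_eigen l \<nu> ((real m)\<^sup>2) (\<mu> - \<kappa> * real m ^ 4) G" for m \<mu> G
    using mode_eigen_cases[OF G \<nu> l m]
  proof (elim disjE)
    assume "\<mu> - \<kappa> * real m ^ 4 \<in> upper_spectrum l \<nu> ((real m)\<^sup>2)"
    then obtain i where "\<mu> - \<kappa> * real m ^ 4 = e m i" unfolding e(2)[OF m, symmetric] by blast
    then have "\<mu> = lam (Suc i) m" by (simp add: lam_def)
    then have "\<exists>j\<ge>1. \<mu> = lam j m" by (intro exI[of _ "Suc i"]) simp
    then show ?thesis using m by (simp add: listed_eigenvalue_def)
  next
    assume "real m = m_star l \<nu> \<and> \<mu> - \<kappa> * real m ^ 4 = ((real m)\<^sup>2)\<^sup>2"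
    then have "real m = m_star l \<nu> \<and> \<mu> = (\<kappa> + 1) * real m ^ 4" unfolding top by auto
    then show ?thesis using m unfolding listed_eigenvalue_def by blast
  next
    assume "\<mu> - \<kappa> * real m ^ 4 = (minus_root l \<nu> m)\<^sup>2"
    then have "\<mu> = lam_minus m" by (simp add: lam_minus_def)
    then show ?thesis using m unfolding listed_eigenvalue_def by blast
  next
    assume "plus_condition l \<nu> m \<and> \<mu> - \<kappa> * real m ^ 4 = (plus_root l \<nu> m)\<^sup>2"
    then have "plus_condition l \<nu> m \<and> \<mu> = lam_plus m" by (auto simp: lam_plus_def)
    then show ?thesis using m unfolding listed_eigenvalue_def by blast
  qed
  have vi: "\<exists>M w. finite M \<and>
            (\<forall>m\<in>M. listed_eigenvalue l \<nu> \<kappa> lam lam_minus lam_plus m \<mu> \<and>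
                    is_eigenfunction l \<nu> \<kappa> \<mu> (w m) \<and> in_mode l m (w m)) \<and>
            (AE p in lebesgue_on (plate l). u p = (\<Sum>m\<in>M. w m p))" if u: "is_eigenfunction l \<nu> \<kappa> \<mu> u" for \<mu> u
    using eigenfunction_mode_decomposition[OF u l \<nu> \<kappa>] listed by meson
  have v: "\<exists>m. listed_eigenvalue l \<nu> \<kappa> lam lam_minus lam_plus m \<mu>" if ev: "is_eigenvalue l \<nu> \<kappa> \<mu>" for \<mu>
  proof -
    obtain u where u: "is_eigenfunction l \<nu> \<kappa> \<mu> u" using ev unfolding is_eigenvalue_def by blast
    obtain M w where M: "\<forall>m\<in>M. listed_eigenvalue l \<nu> \<kappa> lam lam_minus lam_plus m \<mu> \<and>
                    is_eigenfunction l \<nu> \<kappa> \<mu> (w m) \<and> in_mode l m (w m)"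
      "AE p in lebesgue_on (plate l). u p = (\<Sum>m\<in>M. w m p)" using vi[OF u] by blast
    have "M \<noteq> {}"
    proof
      assume "M = {}"
      then show False using M(2) u unfolding is_eigenfunction_def by simp
    qed
    then show ?thesis using M(1) by blast
  qed
  show ?thesis
  proof (rule conjI[OF s_bar_unique[OF \<nu>]], rule exI[of _ lam], rule exI[of _ lam_minus], rule exI[of _ lam_plus],
      rule conjI, intro allI impI, erule i, rule conjI, intro allI impI, erule ii, rule conjI, intro allI impI, erule iii,
      rule conjI[OF iii'], rule conjI, intro allI impI, erule (1) iv, rule conjI[OF iv'], rule conjI)
    show "\<forall>\<mu>. is_eigenvalue l \<nu> \<kappa> \<mu> \<longrightarrow> (\<exists>m. listed_eigenvalue l \<nu> \<kappa> lam lam_minus lam_plus m \<mu>)"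
      by (intro allI impI, erule v)
  qed (intro allI impI, erule vi)
qed

end
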